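(* Let $0<\alpha\le\infty$ and $0<p\le2$, and consider, for $d\in\mathbb N$, the problem of sampling ridge functions from the class $\mathcal R_d^{\alpha,p}$ with worst-case error in $L_\infty(\Omega)$ and adaptive sampling algorithms. This problem (1) suffers from the curse of dimensionality if $p=2$ and $\alpha<\infty$; (2) never suffers from the curse of dimensionality if $p<2$; (3) is intractable if $p<2$ and $\alpha\le\frac{1}{1/p-1/2}$; (4) is weakly tractable if $p<2$ and $\alpha>\frac{1}{1/\max\{1,p\}-1/2}$; (5) is quasi-polynomially tractable if $\alpha=\infty$. Moreover, (6) if $\alpha>1$ and $0<\kappa\le1$, then the corresponding problem for the classes $\mathcal R_d^{\alpha,p,\kappa}$ is polynomially tractable, for every $1<\alpha\le\infty$ and every $0<p\le2$.
   Context: $\mathbb N=\{1,2,\dots\}$. $\Omega=\bar B_2^d=\{x\in\mathbb R^d:\|x\|_2\le1\}$. Lipschitz spaces: for a domain $D$ (here $D=[-1,1]$), $C^s(D)$ consists of the functions $f:D\to\mathbb R$ with bounded continuous partial derivatives up to order $s$, normed by $\|f\|_{C^s}=\max_{|\gamma|\le s}\|D^\gamma f\|_\infty$; $C^\infty(D)$ is normed by $\|f\|_{C^\infty}=\sup_\gamma\|D^\gamma f\|_\infty$ (and consists of the functions for which this is finite). For $0<\beta\le1$ the Hölder constant is $|f|_\beta=\sup_{x\ne y}\frac{|f(x)-f(y)|}{2\min\{1,\|x-y\|_1\}^\beta}$. For $0<\alpha<\infty$, with $s$ the largest integer strictly less than $\alpha$ and $\beta=\alpha-s\in(0,1]$,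 $\mathrm{Lip}_\alpha(D)$ is the space of $f\in C^s(D)$ with $\|f\|_{\mathrm{Lip}_\alpha(D)}=\max\{\|f\|_{C^s},\max_{|\gamma|=s}|D^\gamma f|_\beta\}<\infty$. Ridge function classes: for $0<\alpha<\infty$, $\mathcal R_d^{\alpha,p}=\{f:\Omega\to\mathbb R:\ f(x)=g(a\cdot x),\ \|g\|_{\mathrm{Lip}_\alpha[-1,1]}\le1,\ \|a\|_p\le1\}$; $\mathcal R_d^{\infty,p}$ is defined in the same way with $\|g\|_{C^\infty[-1,1]}\le1$. For $\alpha>1$ (including $\alpha=\infty$), $\mathcal R_d^{\alpha,p,\kappa}$ is the set of those $g(a\cdot)\in\mathcal R_d^{\alpha,p}$ (with $g,a$ as in the definition) satisfying additionally $|g'(0)|\ge\kappa$. Sampling problem: let $\mathcal F$ be a class of functions on $\Omega$. An adaptive sampling algorithm using at most $n$ points is a map $S=\varphi\circ N:\mathcal F\to L_\infty(\Omega)$, where for some $m\le n$ the information map is $N(f)=(f(x_1),\dots,f(x_m))$ with $x_1\in\Omega$ fixed and each $x_i\in\Omega$ allowed to depend on $f(x_1),\dots,f(x_{i-1})$, and $\varphi:\mathbb R^m\to L_\infty(\Omega)$ is an arbitrary map with $\varphi(0)=0$. $g^{\mathrm{ada}}_{n,d}(\mathcal F,L_\infty)$ is the infimum of $\sup_{f\in\mathcal F}\|f-S(f)\|_\infty$ over all such $S$. The information complexity is $n(\varepsilon,d)=\min\{n\in\mathbb N: g^{\mathrm{ada}}_{n,d}(\mathcal F_d,L_\infty)\le\varepsilon\}$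 for $0<\varepsilon\le1$, $d\in\mathbb N$, where $\mathcal F_d$ is the class considered in dimension $d$. Tractability notions. Polynomially tractable: there are $c,q_1,q_2>0$ with $n(\varepsilon,d)\le c\,\varepsilon^{-q_1}d^{q_2}$ for all $0<\varepsilon<1$, $d\in\mathbb N$. Quasi-polynomially tractable: there are $C,t>0$ with $n(\varepsilon,d)\le C\exp(t(1+\ln(1/\varepsilon))(1+\ln d))$ for all such $\varepsilon,d$. Weakly tractable: $\lim_{1/\varepsilon+d\to\infty}\frac{\log n(\varepsilon,d)}{1/\varepsilon+d}=0$. Intractable: not weakly tractable. Curse of dimensionality: there are $c,\varepsilon_0,\gamma>0$ such that $n(\varepsilon,d)\ge c(1+\gamma)^d$ for all $0<\varepsilon\le\varepsilon_0$ and infinitely many $d\in\mathbb N$. *)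

theory Defs
  imports "HOL-Probability.Probability"
begin

text \<open>
  Derivatives are taken within $[-1,1]$, hence one-sided at the end points, so that the values of
  a function outside of $[-1,1]$ are irrelevant. Norms are extended nonnegative reals.
\<close>

primrec iterated_deriv :: "nat \<Rightarrow> (real \<Rightarrow> real) \<Rightarrow> real \<Rightarrow> real" where
  "iterated_deriv 0 g = g"
| "iterated_deriv (Suc k) g =
     (\<lambda>t. vector_derivative (iterated_deriv k g) (at t within {-1..1}))"

definition C_space :: "nat \<Rightarrow> (real \<Rightarrow> real) set" where
  "C_space s = {g.
     (\<forall>k<s. \<forall>t\<in>{-1..1}. iterated_deriv k g differentiable (at t within {-1..1})) \<and>
     (\<forall>k\<le>s. continuous_on {-1..1} (iterated_deriv k g) \<and> bounded (iterated_deriv k g ` {-1..1}))}"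

definition sup_norm :: "(real \<Rightarrow> real) \<Rightarrow> ennreal" where
  "sup_norm h = (SUP t\<in>{-1..1}. ennreal \<bar>h t\<bar>)"

definition C_norm :: "nat \<Rightarrow> (real \<Rightarrow> real) \<Rightarrow> ennreal" where
  "C_norm s g = (MAX k\<in>{..s}. sup_norm (iterated_deriv k g))"

definition C_inf_norm :: "(real \<Rightarrow> real) \<Rightarrow> ennreal" where
  "C_inf_norm g = (SUP k. sup_norm (iterated_deriv k g))"

definition C_inf_space :: "(real \<Rightarrow> real) set" where
  "C_inf_space = {g. (\<forall>s. g \<in> C_space s) \<and> C_inf_norm g < \<infinity>}"

definition holder_const :: "real \<Rightarrow> (real \<Rightarrow> real) \<Rightarrow> ennreal" where
  "holder_const \<beta> h =
     (SUP (t, u)\<in>{(t, u). t \<in> {-1..1} \<and> u \<in> {-1..1} \<and> t \<noteq> u}.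
        ennreal (\<bar>h t - h u\<bar> / (2 * min 1 \<bar>t - u\<bar> powr \<beta>)))"

definition lip_order :: "real \<Rightarrow> nat" where
  "lip_order \<alpha> = (GREATEST s. real s < \<alpha>)"

definition lip_norm :: "real \<Rightarrow> (real \<Rightarrow> real) \<Rightarrow> ennreal" where
  "lip_norm \<alpha> g =
     max (C_norm (lip_order \<alpha>) g)
         (holder_const (\<alpha> - real (lip_order \<alpha>)) (iterated_deriv (lip_order \<alpha>) g))"

definition lip_space :: "real \<Rightarrow> (real \<Rightarrow> real) set" where
  "lip_space \<alpha> = {g \<in> C_space (lip_order \<alpha>). lip_norm \<alpha> g < \<infinity>}"

definition smooth_ball :: "ereal \<Rightarrow> (real \<Rightarrow> real) set" where
  "smooth_ball \<alpha> =
     (if \<alpha> = \<infinity> then {g \<in> C_inf_space. C_inf_norm g \<le> 1}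
      else {g \<in> lip_space (real_of_ereal \<alpha>). lip_norm (real_of_ereal \<alpha>) g \<le> 1})"

text \<open>The vectors of $\mathbb{R}^d$ are the functions on \<open>nat\<close> that are extensional on \<open>{..<d}\<close>.\<close>

type_synonym rvec = "nat \<Rightarrow> real"

definition vectors :: "nat \<Rightarrow> rvec set" where
  "vectors d = {..<d} \<rightarrow>\<^sub>E UNIV"

definition inner_prod :: "nat \<Rightarrow> rvec \<Rightarrow> rvec \<Rightarrow> real" where
  "inner_prod d a x = (\<Sum>i<d. a i * x i)"

definition p_norm :: "nat \<Rightarrow> real \<Rightarrow> rvec \<Rightarrow> real" where
  "p_norm d p a = (\<Sum>i<d. \<bar>a i\<bar> powr p) powr (1 / p)"

definition Omega :: "nat \<Rightarrow> rvec set" where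
  "Omega d = {x \<in> vectors d. p_norm d 2 x \<le> 1}"

definition ridge_class :: "ereal \<Rightarrow> real \<Rightarrow> nat \<Rightarrow> (rvec \<Rightarrow> real) set" where
  "ridge_class \<alpha> p d =
     {(\<lambda>x\<in>Omega d. g (inner_prod d a x)) | g a.
        g \<in> smooth_ball \<alpha> \<and> a \<in> vectors d \<and> p_norm d p a \<le> 1}"

definition ridge_class_deriv :: "ereal \<Rightarrow> real \<Rightarrow> real \<Rightarrow> nat \<Rightarrow> (rvec \<Rightarrow> real) set" where
  "ridge_class_deriv \<alpha> p \<kappa> d =
     {(\<lambda>x\<in>Omega d. g (inner_prod d a x)) | g a.
        g \<in> smooth_ball \<alpha> \<and> a \<in> vectors d \<and> p_norm d p a \<le> 1 \<and> \<kappa> \<le> \<bar>deriv g 0\<bar>}"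

definition Omega_measure :: "nat \<Rightarrow> rvec measure" where
  "Omega_measure d = restrict_space (PiM {..<d} (\<lambda>_. lborel)) (Omega d)"

definition Linf_norm :: "nat \<Rightarrow> (rvec \<Rightarrow> real) \<Rightarrow> ennreal" where
  "Linf_norm d h = esssup (Omega_measure d) (\<lambda>x. ennreal \<bar>h x\<bar>)"

text \<open>Elements of $L_\infty(\Omega)$ are given by representatives.\<close>

definition Linf :: "nat \<Rightarrow> (rvec \<Rightarrow> real) set" where
  "Linf d = {h \<in> borel_measurable (Omega_measure d). Linf_norm d h < \<infinity>}"

text \<open>
  \<open>pt\<close> is the sampling strategy: after the values \<open>ys\<close> have been observed, the next sample is taken
  at \<open>pt ys\<close>. In particular the first sample is always taken at \<open>pt []\<close>.
\<close>

primrec information :: "(real list \<Rightarrow> rvec) \<Rightarrow> nat \<Rightarrow> (rvec \<Rightarrow> real) \<Rightarrow> real list" where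
  "information pt 0 f = []"
| "information pt (Suc k) f = information pt k f @ [f (pt (information pt k f))]"

definition adaptive_algorithms :: "nat \<Rightarrow> nat \<Rightarrow> ((rvec \<Rightarrow> real) \<Rightarrow> rvec \<Rightarrow> real) set" where
  "adaptive_algorithms n d =
     {(\<lambda>f. \<phi> (information pt m f)) | m pt \<phi>.
        1 \<le> m \<and> m \<le> n \<and> (\<forall>ys. pt ys \<in> Omega d) \<and>
        (\<forall>ys. length ys = m \<longrightarrow> \<phi> ys \<in> Linf d) \<and>
        (AE x in Omega_measure d. \<phi> (replicate m 0) x = 0)}"

definition g_ada :: "nat \<Rightarrow> nat \<Rightarrow> (rvec \<Rightarrow> real) set \<Rightarrow> ennreal" where
  "g_ada n d \<F> =
     (INF S\<in>adaptive_algorithms n d. SUP f\<in>\<F>. Linf_norm d (\<lambda>x. f x - S f x))"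

text \<open>\<open>\<F>\<close> is a family of classes indexed by the dimension. If no \<open>n\<close> is admissible, the
  infimum is \<open>\<infinity>\<close>.\<close>

definition info_complexity :: "(nat \<Rightarrow> (rvec \<Rightarrow> real) set) \<Rightarrow> real \<Rightarrow> nat \<Rightarrow> enat" where
  "info_complexity \<F> \<epsilon> d = Inf {enat n | n. 1 \<le> n \<and> g_ada n d (\<F> d) \<le> ennreal \<epsilon>}"

definition polynomially_tractable :: "(nat \<Rightarrow> (rvec \<Rightarrow> real) set) \<Rightarrow> bool" where
  "polynomially_tractable \<F> \<longleftrightarrow>
     (\<exists>c q1 q2. c > 0 \<and> q1 > 0 \<and> q2 > 0 \<and>
        (\<forall>\<epsilon> d. 0 < \<epsilon> \<and> \<epsilon> < 1 \<and> 1 \<le> d \<longrightarrow>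
           ereal_of_enat (info_complexity \<F> \<epsilon> d) \<le> ereal (c * \<epsilon> powr (- q1) * real d powr q2)))"

definition quasi_polynomially_tractable :: "(nat \<Rightarrow> (rvec \<Rightarrow> real) set) \<Rightarrow> bool" where
  "quasi_polynomially_tractable \<F> \<longleftrightarrow>
     (\<exists>C t. C > 0 \<and> t > 0 \<and>
        (\<forall>\<epsilon> d. 0 < \<epsilon> \<and> \<epsilon> < 1 \<and> 1 \<le> d \<longrightarrow>
           ereal_of_enat (info_complexity \<F> \<epsilon> d)
             \<le> ereal (C * exp (t * (1 + ln (1 / \<epsilon>)) * (1 + ln (real d))))))"

definition ln_enat :: "enat \<Rightarrow> ereal" where
  "ln_enat n = (case n of enat k \<Rightarrow> ereal (ln (real k)) | \<infinity> \<Rightarrow> \<infinity>)"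

definition weakly_tractable :: "(nat \<Rightarrow> (rvec \<Rightarrow> real) set) \<Rightarrow> bool" where
  "weakly_tractable \<F> \<longleftrightarrow>
     ((\<lambda>(\<epsilon>, d). ln_enat (info_complexity \<F> \<epsilon> d) / ereal (1 / \<epsilon> + real d)) \<longlongrightarrow> 0)
       (filtercomap (\<lambda>(\<epsilon>, d). 1 / \<epsilon> + real d) at_top \<sqinter> principal ({0<..1} \<times> {1..}))"

definition intractable :: "(nat \<Rightarrow> (rvec \<Rightarrow> real) set) \<Rightarrow> bool" where
  "intractable \<F> \<longleftrightarrow> \<not> weakly_tractable \<F>"

definition curse_of_dimensionality :: "(nat \<Rightarrow> (rvec \<Rightarrow> real) set) \<Rightarrow> bool" where
  "curse_of_dimensionality \<F> \<longleftrightarrow>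
     (\<exists>c \<epsilon>0 \<gamma>. c > 0 \<and> 0 < \<epsilon>0 \<and> \<epsilon>0 \<le> 1 \<and> \<gamma> > 0 \<and>
        infinite {d. 1 \<le> d \<and> (\<forall>\<epsilon>. 0 < \<epsilon> \<and> \<epsilon> \<le> \<epsilon>0 \<longrightarrow>
           ereal (c * (1 + \<gamma>) ^ d) \<le> ereal_of_enat (info_complexity \<F> \<epsilon> d))})"

end

theory Submission
  imports Defs "HOL-Real_Asymp.Real_Asymp"
begin

text \<open>The lower bounds come from fooling functions, the upper bounds from the fact that a class can be
sampled well as soon as any two of its members that agree on the sample points are uniformly close.

\<^bold>\<open>Lower bounds (curse and intractability).\<close> An algorithm that sees only zeros outputs zero, so it errs
on every member of the class that vanishes at the points queried along the all-zero branch. Take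
$a = d^{-1/p}\sigma$ with a sign vector $\sigma$, and let $g$ be a small multiple of
$t \mapsto \max(0, t - \delta/2)^\alpha$ where $\delta = \|a\|_2 = d^{1/2-1/p}$. A Chernoff bound over
random signs shows that for fewer than $e^{d/16}$ points some $\sigma$ has $a \cdot x \le \delta/2$ at
all of them (\<open>sign_vector_almost_orthogonal\<close>). The resulting ridge function vanishes at the samples
but is of size about $\delta^\alpha$ on a box of positive measure (\<open>info_complexity_ridge_ge\<close>). For
$p = 2$ this size does not depend on $d$, which is the curse; for $p < 2$ and
$\alpha(1/p - 1/2) \le 1$ it is at least of order $1/d$, which contradicts weak tractability.

\<^bold>\<open>Upper bounds for the full classes.\<close> Write $\alpha = s + \beta$ with $0 < \beta \le 1$. Around a point $y$,
a ridge function is determined up to $O(|a \cdot (x - y)|^\alpha)$ by its Taylor polynomial of degree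
$s$, whose coefficients are products $g^{(j)}(a \cdot y)\, a_{i_1} \cdots a_{i_j}$. Mixed finite
differences with a tiny step $\tau$ at $(d+1)^s$ points near $y$ determine these products up to an
error that vanishes with $\tau$; sampling is exact, so $\tau$ may depend on everything and costs
nothing. Hence sampling around every point of a net of $\Omega$ with resolution $\delta$ in the seminorm
$\sup_{\|a\|_p \le 1} |a \cdot {}|$ gives error $4\delta^\alpha/s!$ plus an arbitrarily small term
(\<open>info_complexity_ridge_le_net\<close>). Two nets are used. Rounding to the grid of width $K^{-1/2}$ costs at
most $(2d+1)^K$ points, because a vector of the ball becomes an integer vector of $\ell_1$-norm at most
$K$, and has resolution of order $K^{-(1/p-1/2)}$ for $1 \le p < 2$. For a fixed error $K$ is constant
and the number of points is polynomial in $d$, so there is no curse; for $\alpha(1/p-1/2) > 1$ the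
required $K$ grows like $\varepsilon^{-\theta}$ with $\theta < 1$, so the problem is weakly tractable.
For $\alpha = \infty$ the net consisting of the origin suffices: the resolution is $1$, and the factor
$1/s!$ makes $s = O(1 + \ln(1/\varepsilon))$ large enough.

\<^bold>\<open>Derivative bounded below at the origin.\<close> If $|g'(0)| \ge \kappa$, first differences at the origin
give the direction of $a$ to arbitrary precision. Then $f$ nearly coincides with its values on the
line through the origin in that direction, and an equidistant grid on this line finishes the job with
$O(d + 1/\varepsilon)$ points (\<open>line_approximation\<close>).\<close>

section \<open>Norms of vectors\<close>

lemma p_norm_le_one_iff:
  assumes "0 < p"
  shows "p_norm d p a \<le> 1 \<longleftrightarrow> (\<Sum>i<d. \<bar>a i\<bar> powr p) \<le> 1"
proof -
  have nn: "0 \<le> (\<Sum>i<d. \<bar>a i\<bar> powr p)" by (simp add: sum_nonneg)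
  show ?thesis
  proof
    assume le: "p_norm d p a \<le> 1"
    show "(\<Sum>i<d. \<bar>a i\<bar> powr p) \<le> 1"
    proof (rule ccontr)
      assume "\<not> ?thesis"
      then have "1 < (\<Sum>i<d. \<bar>a i\<bar> powr p) powr (1 / p)"
        using assms by (intro gr_one_powr) auto
      with le show False by (simp add: p_norm_def)
    qed
  next
    assume "(\<Sum>i<d. \<bar>a i\<bar> powr p) \<le> 1"
    then show "p_norm d p a \<le> 1"
      unfolding p_norm_def using nn assms by (simp add: powr_le_one_le powr_le1)
  qed
qed

lemma p_norm_2_le_one_iff: "p_norm d 2 x \<le> 1 \<longleftrightarrow> (\<Sum>i<d. (x i)\<^sup>2) \<le> 1"
  by (subst p_norm_le_one_iff) (simp_all add: powr_numeral flip: powr_realpow)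

lemma p_norm_le_one_mono:
  assumes "0 < p" "p \<le> q" "p_norm d p a \<le> 1"
  shows "p_norm d q a \<le> 1"
proof -
  have s: "(\<Sum>i<d. \<bar>a i\<bar> powr p) \<le> 1" using assms by (simp add: p_norm_le_one_iff)
  have "\<bar>a i\<bar> powr q \<le> \<bar>a i\<bar> powr p" if "i < d" for i
  proof -
    have "\<bar>a i\<bar> powr p \<le> (\<Sum>i<d. \<bar>a i\<bar> powr p)"
      using that by (intro member_le_sum) auto
    then have "\<bar>a i\<bar> powr p \<le> 1" using s by linarith
    then have "\<bar>a i\<bar> \<le> 1"
      using assms(1) by (metis gr_one_powr not_le)
    then show ?thesis using assms by (intro powr_mono') auto
  qed
  then have "(\<Sum>i<d. \<bar>a i\<bar> powr q) \<le> (\<Sum>i<d. \<bar>a i\<bar> powr p)" by (intro sum_mono) auto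
  then show ?thesis using s assms by (subst p_norm_le_one_iff) auto
qed

lemma inner_prod_abs_le:
  assumes "(\<Sum>i<d. (a i)\<^sup>2) \<le> A\<^sup>2" "(\<Sum>i<d. (x i)\<^sup>2) \<le> B\<^sup>2" "0 \<le> A" "0 \<le> B"
  shows "\<bar>inner_prod d a x\<bar> \<le> A * B"
proof -
  have "(inner_prod d a x)\<^sup>2 \<le> (\<Sum>i<d. (a i)\<^sup>2) * (\<Sum>i<d. (x i)\<^sup>2)"
    unfolding inner_prod_def by (rule Cauchy_Schwarz_ineq_sum)
  also have "\<dots> \<le> A\<^sup>2 * B\<^sup>2" using assms by (intro mult_mono) (auto simp: sum_nonneg)
  finally have "(inner_prod d a x)\<^sup>2 \<le> (A * B)\<^sup>2" by (simp add: power_mult_distrib)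
  then show ?thesis using assms abs_le_square_iff[of "inner_prod d a x" "A * B"] by simp
qed

lemma mem_Omega_iff: "x \<in> Omega d \<longleftrightarrow> x \<in> vectors d \<and> (\<Sum>i<d. (x i)\<^sup>2) \<le> 1"
  by (simp add: Omega_def p_norm_2_le_one_iff)

lemma restrict_mem_Omega_iff: "restrict x {..<d} \<in> Omega d \<longleftrightarrow> (\<Sum>i<d. (x i)\<^sup>2) \<le> 1"
  by (simp add: mem_Omega_iff vectors_def)

lemma inner_prod_restrict: "inner_prod d a (restrict x {..<d}) = inner_prod d a x"
  by (simp add: inner_prod_def)

text \<open>This is what makes \<open>g (inner_prod d a x)\<close> meaningful: for $p \le 2$ the profile \<open>g\<close> is only ever
evaluated on $[-1,1]$.\<close>

lemma inner_prod_mem_interval: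
  assumes "p_norm d p a \<le> 1" "0 < p" "p \<le> 2" "(\<Sum>i<d. (x i)\<^sup>2) \<le> 1"
  shows "inner_prod d a x \<in> {-1..1}"
proof -
  have "(\<Sum>i<d. (a i)\<^sup>2) \<le> 1"
    using p_norm_le_one_mono[OF assms(2,3,1)] by (simp add: p_norm_2_le_one_iff)
  then have "\<bar>inner_prod d a x\<bar> \<le> 1 * 1" using assms by (intro inner_prod_abs_le) auto
  then show ?thesis by auto
qed

section \<open>Unit balls of the Lipschitz spaces\<close>

text \<open>The unit ball of $\mathrm{Lip}_{s+\beta}[-1,1]$ in terms of real numbers (see
\<open>smooth_ball_eq_holder_ball\<close>). Derivatives, suprema and the Hoelder constant are spelled out so that
no extended reals occur in the analytic arguments.\<close>

definition holder_ball :: "nat \<Rightarrow> real \<Rightarrow> (real \<Rightarrow> real) set" where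
  "holder_ball s \<beta> = {g.
     (\<forall>k<s. \<forall>t\<in>{-1..1}.
        (iterated_deriv k g has_real_derivative iterated_deriv (Suc k) g t) (at t within {-1..1})) \<and>
     (\<forall>k\<le>s. \<forall>t\<in>{-1..1}. \<bar>iterated_deriv k g t\<bar> \<le> 1) \<and>
     (\<forall>t\<in>{-1..1}. \<forall>u\<in>{-1..1}.
        \<bar>iterated_deriv s g t - iterated_deriv s g u\<bar> \<le> 2 * min 1 \<bar>t - u\<bar> powr \<beta>)}"

lemma holder_continuous_on:
  fixes h :: "real \<Rightarrow> real"
  assumes "0 < \<beta>" and h: "\<And>t u. t \<in> S \<Longrightarrow> u \<in> S \<Longrightarrow> \<bar>h t - h u\<bar> \<le> 2 * \<bar>t - u\<bar> powr \<beta>"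
  shows "continuous_on S h"
  unfolding continuous_on_def
proof
  fix t assume t: "t \<in> S"
  have "((\<lambda>u. \<bar>u - t\<bar>) \<longlongrightarrow> 0) (at t within S)"
    by (rule tendsto_rabs_zero) (simp add: LIM_zero tendsto_ident_at)
  then have "((\<lambda>u. \<bar>u - t\<bar> powr \<beta>) \<longlongrightarrow> 0) (at t within S)"
    by (rule tendsto_zero_powrI[OF _ tendsto_const]) (auto simp: assms(1))
  then have "((\<lambda>u. 2 * \<bar>u - t\<bar> powr \<beta>) \<longlongrightarrow> 0) (at t within S)"
    by (rule tendsto_mult_right_zero)
  moreover have "\<forall>\<^sub>F u in at t within S. norm (h u - h t) \<le> 2 * \<bar>u - t\<bar> powr \<beta>"
    unfolding eventually_at_filter using h t by (intro always_eventually) simp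
  ultimately have "((\<lambda>u. h u - h t) \<longlongrightarrow> 0) (at t within S)"
    by (rule Lim_null_comparison[rotated])
  then show "(h \<longlongrightarrow> h t) (at t within S)" by (simp add: LIM_zero_iff)
qed

lemma min_powr_le: "0 < \<beta> \<Longrightarrow> min 1 \<bar>t - u\<bar> powr \<beta> \<le> \<bar>t - u :: real\<bar> powr \<beta>"
  by (intro powr_mono2) auto

lemma holder_ball_continuous_on:
  assumes "g \<in> holder_ball s \<beta>" "0 < \<beta>" "k \<le> s"
  shows "continuous_on {-1..1} (iterated_deriv k g)"
proof (cases "k = s")
  case True
  show ?thesis unfolding True
  proof (rule holder_continuous_on[OF assms(2)])
    fix t u :: real assume "t \<in> {-1..1}" "u \<in> {-1..1}"
    then have "\<bar>iterated_deriv s g t - iterated_deriv s g u\<bar> \<le> 2 * min 1 \<bar>t - u\<bar> powr \<beta>"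
      using assms(1) by (auto simp: holder_ball_def)
    with min_powr_le[OF assms(2), of t u]
    show "\<bar>iterated_deriv s g t - iterated_deriv s g u\<bar> \<le> 2 * \<bar>t - u\<bar> powr \<beta>" by linarith
  qed
next
  case False
  with assms have "k < s" by simp
  then show ?thesis using assms(1)
    by (intro DERIV_continuous_on[of _ _ "iterated_deriv (Suc k) g"]) (auto simp: holder_ball_def)
qed

lemma C_space_iff:
  "g \<in> C_space s \<longleftrightarrow>
     (\<forall>k<s. \<forall>t\<in>{-1..1}.
        (iterated_deriv k g has_real_derivative iterated_deriv (Suc k) g t) (at t within {-1..1})) \<and>
     (\<forall>k\<le>s. continuous_on {-1..1} (iterated_deriv k g) \<and> bounded (iterated_deriv k g ` {-1..1}))"
  by (simp add: C_space_def vector_derivative_works has_real_derivative_iff_has_vector_derivative)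

lemma sup_norm_le_one_iff: "sup_norm h \<le> 1 \<longleftrightarrow> (\<forall>t\<in>{-1..1}. \<bar>h t\<bar> \<le> 1)"
  by (simp add: sup_norm_def SUP_le_iff)

lemma holder_const_le_one_iff:
  "holder_const \<beta> h \<le> 1 \<longleftrightarrow>
     (\<forall>t\<in>{-1..1}. \<forall>u\<in>{-1..1}. \<bar>h t - h u\<bar> \<le> 2 * min 1 \<bar>t - u\<bar> powr \<beta>)"
proof -
  have K: "(t \<noteq> u \<longrightarrow> \<bar>h t - h u\<bar> / (2 * min 1 \<bar>t - u\<bar> powr \<beta>) \<le> 1) \<longleftrightarrow>
      \<bar>h t - h u\<bar> \<le> 2 * min 1 \<bar>t - u\<bar> powr \<beta>" for t u
  proof (cases "t = u")
    case False
    then show ?thesis by (subst pos_divide_le_eq) auto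
  qed simp
  have sup: "(SUP (t, u)\<in>{(t, u). t \<in> {-1..1} \<and> u \<in> {-1..1} \<and> t \<noteq> u}. ennreal (q t u)) \<le> 1 \<longleftrightarrow>
      (\<forall>t\<in>{-1..1}. \<forall>u\<in>{-1..1}. t \<noteq> u \<longrightarrow> q t u \<le> 1)" for q :: "real \<Rightarrow> real \<Rightarrow> real"
    by (auto simp: SUP_le_iff)
  have "holder_const \<beta> h \<le> 1 \<longleftrightarrow> (\<forall>t\<in>{-1..1}. \<forall>u\<in>{-1..1}.
      t \<noteq> u \<longrightarrow> \<bar>h t - h u\<bar> / (2 * min 1 \<bar>t - u\<bar> powr \<beta>) \<le> 1)"
    unfolding holder_const_def by (rule sup)
  then show ?thesis unfolding K .
qed

lemma lip_order_eq:
  assumes "0 < \<beta>" "\<beta> \<le> 1"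
  shows "lip_order (real s + \<beta>) = s"
  unfolding lip_order_def using assms by (intro Greatest_equality) linarith+

lemma smooth_ball_eq_holder_ball:
  assumes "0 < \<beta>" "\<beta> \<le> 1"
  shows "smooth_ball (ereal (real s + \<beta>)) = holder_ball s \<beta>"
proof -
  have lip: "lip_norm (real s + \<beta>) g \<le> 1 \<longleftrightarrow>
      (\<forall>k\<le>s. \<forall>t\<in>{-1..1}. \<bar>iterated_deriv k g t\<bar> \<le> 1) \<and>
      (\<forall>t\<in>{-1..1}. \<forall>u\<in>{-1..1}.
        \<bar>iterated_deriv s g t - iterated_deriv s g u\<bar> \<le> 2 * min 1 \<bar>t - u\<bar> powr \<beta>)" for g
    by (simp add: lip_norm_def lip_order_eq[OF assms] C_norm_def Max_le_iff sup_norm_le_one_iff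
        holder_const_le_one_iff) (auto simp del: iterated_deriv.simps)
  have fin: "lip_norm (real s + \<beta>) g < \<infinity>" if "lip_norm (real s + \<beta>) g \<le> 1" for g
    using that by (metis ennreal_one_less_top infinity_ennreal_def le_less_trans)
  have "g \<in> C_space s" if g: "g \<in> holder_ball s \<beta>" for g
    unfolding C_space_iff
  proof (intro conjI allI impI)
    fix k assume "k \<le> s"
    then have "\<forall>t\<in>{-1..1}. \<bar>iterated_deriv k g t\<bar> \<le> 1" using g by (auto simp: holder_ball_def)
    then show "bounded (iterated_deriv k g ` {-1..1})" by (auto simp: bounded_iff)
  qed (use g holder_ball_continuous_on[OF g assms(1)] in \<open>auto simp: holder_ball_def\<close>)
  moreover have "g \<in> holder_ball s \<beta>"
    if "g \<in> C_space s" "lip_norm (real s + \<beta>) g \<le> 1" for g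
    using that unfolding lip C_space_iff holder_ball_def by blast
  moreover have "lip_norm (real s + \<beta>) g \<le> 1" if "g \<in> holder_ball s \<beta>" for g
    using that unfolding lip holder_ball_def by blast
  ultimately show ?thesis
    unfolding smooth_ball_def lip_space_def lip_order_eq[OF assms] using fin
    by (auto simp: lip_order_eq[OF assms])
qed

lemma min_one_le_min_powr:
  fixes x :: real
  assumes "0 < \<beta>" "\<beta> \<le> \<beta>'" "0 \<le> x"
  shows "min 1 x powr \<beta>' \<le> min 1 x powr \<beta>"
  using assms by (intro powr_mono') auto

lemma holder_ball_antimono_exponent:
  assumes "0 < \<beta>" "\<beta> \<le> \<beta>'"
  shows "holder_ball s \<beta>' \<subseteq> holder_ball s \<beta>"
proof
  fix g assume g: "g \<in> holder_ball s \<beta>'"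
  have "\<bar>iterated_deriv s g t - iterated_deriv s g u\<bar> \<le> 2 * min 1 \<bar>t - u\<bar> powr \<beta>"
    if "t \<in> {-1..1}" "u \<in> {-1..1}" for t u
  proof -
    have "\<bar>iterated_deriv s g t - iterated_deriv s g u\<bar> \<le> 2 * min 1 \<bar>t - u\<bar> powr \<beta>'"
      using g that by (simp add: holder_ball_def)
    then show ?thesis using min_one_le_min_powr[OF assms, of "\<bar>t - u\<bar>"] by linarith
  qed
  with g show "g \<in> holder_ball s \<beta>" by (auto simp: holder_ball_def)
qed

lemma holder_ball_lipschitz:
  assumes "g \<in> holder_ball s \<beta>" "k < s" "t \<in> {-1..1}" "u \<in> {-1..1}"
  shows "\<bar>iterated_deriv k g t - iterated_deriv k g u\<bar> \<le> \<bar>t - u\<bar>"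
proof -
  have "norm (iterated_deriv k g t - iterated_deriv k g u) \<le> 1 * norm (t - u)"
  proof (rule field_differentiable_bound[of "{-1..1}" _ "iterated_deriv (Suc k) g"])
    fix z :: real assume z: "z \<in> {-1..1}"
    show "(iterated_deriv k g has_field_derivative iterated_deriv (Suc k) g z) (at z within {-1..1})"
      using assms(1,2) z by (auto simp: holder_ball_def)
    show "norm (iterated_deriv (Suc k) g z) \<le> 1"
      using assms(1,2) z unfolding holder_ball_def by (auto simp del: iterated_deriv.simps)
  qed (use assms in auto)
  then show ?thesis by simp
qed

text \<open>The normalization of the Hoelder constant makes this an inclusion of unit balls without any constant:
a derivative that is bounded by $1$ gives the Lipschitz bound $|t-u| \le 2\min\{1,|t-u|\}$ on
$[-1,1]$.\<close>

lemma holder_ball_antimono_order: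
  assumes "0 < \<beta>" "\<beta> \<le> 1" "s < s'"
  shows "holder_ball s' \<beta>' \<subseteq> holder_ball s \<beta>"
proof
  fix g assume g: "g \<in> holder_ball s' \<beta>'"
  have "\<bar>iterated_deriv s g t - iterated_deriv s g u\<bar> \<le> 2 * min 1 \<bar>t - u\<bar> powr \<beta>"
    if t: "t \<in> {-1..1}" "u \<in> {-1..1}" for t u
  proof -
    have "\<bar>iterated_deriv s g t - iterated_deriv s g u\<bar> \<le> \<bar>t - u\<bar>"
      by (rule holder_ball_lipschitz[OF g assms(3) t])
    also have "\<dots> \<le> 2 * min 1 \<bar>t - u\<bar> powr 1" using t by (auto simp: min_def abs_if)
    also have "\<dots> \<le> 2 * min 1 \<bar>t - u\<bar> powr \<beta>"
      using min_one_le_min_powr[OF assms(1,2), of "\<bar>t - u\<bar>"] by simp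
    finally show ?thesis .
  qed
  with g assms(3) show "g \<in> holder_ball s \<beta>" by (auto simp: holder_ball_def)
qed

text \<open>Reduces the case $\alpha = \infty$ to finite smoothness of arbitrary order.\<close>

lemma smooth_ball_infinity_subset: "smooth_ball \<infinity> \<subseteq> holder_ball s 1"
proof
  fix g assume "g \<in> smooth_ball \<infinity>"
  then have C: "g \<in> C_inf_space" and n: "C_inf_norm g \<le> 1" by (auto simp: smooth_ball_def)
  have "\<And>k. sup_norm (iterated_deriv k g) \<le> 1"
    using n by (simp add: C_inf_norm_def SUP_le_iff)
  then have b: "\<And>k t. t \<in> {-1..1} \<Longrightarrow> \<bar>iterated_deriv k g t\<bar> \<le> 1"
    by (simp add: sup_norm_le_one_iff del: iterated_deriv.simps)
  have d: "(iterated_deriv k g has_real_derivative iterated_deriv (Suc k) g t) (at t within {-1..1})"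
    if "t \<in> {-1..1}" for k t
    using C that unfolding C_inf_space_def C_space_iff by blast
  have "\<bar>iterated_deriv (Suc s) g t - iterated_deriv (Suc s) g u\<bar> \<le> 2 * min 1 \<bar>t - u\<bar> powr 0"
    if t: "t \<in> {-1..1}" "u \<in> {-1..1}" for t u
    using b[OF t(1), of "Suc s"] b[OF t(2), of "Suc s"]
    by (cases "t = u") (auto simp del: iterated_deriv.simps)
  then have "g \<in> holder_ball (Suc s) 0"
    unfolding holder_ball_def using b d by blast
  then show "g \<in> holder_ball s 1" using holder_ball_antimono_order[of 1 s "Suc s" 0] by auto
qed

lemma order_exponent_split:
  fixes r :: real
  assumes "0 < r"
  obtains s \<beta> where "r = real s + \<beta>" "0 < \<beta>" "\<beta> \<le> 1"
proof
  show "r = real (nat (\<lceil>r\<rceil> - 1)) + (r - real (nat (\<lceil>r\<rceil> - 1)))" by simp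
  have "0 \<le> \<lceil>r\<rceil> - 1" using assms by (simp add: le_ceiling_iff)
  then have "real (nat (\<lceil>r\<rceil> - 1)) = of_int \<lceil>r\<rceil> - 1" by simp
  then show "0 < r - real (nat (\<lceil>r\<rceil> - 1))" "r - real (nat (\<lceil>r\<rceil> - 1)) \<le> 1"
    by (simp_all, linarith+)
qed

text \<open>Together with the monotonicity in $p$ this gives \<open>ridge_class_mono\<close>, which allows every upper bound
to be proved for one convenient pair of parameters.\<close>

lemma smooth_ball_antimono:
  assumes "0 < \<alpha>" "\<alpha> \<le> \<alpha>'"
  shows "smooth_ball \<alpha>' \<subseteq> smooth_ball \<alpha>"
proof (cases "\<alpha> = \<infinity>")
  case False
  then obtain r where r: "\<alpha> = ereal r" "0 < r" using assms(1) by (cases \<alpha>) auto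
  obtain s \<beta> where s: "r = real s + \<beta>" "0 < \<beta>" "\<beta> \<le> 1" by (rule order_exponent_split[OF r(2)])
  show ?thesis
  proof (cases "\<alpha>' = \<infinity>")
    case True
    then show ?thesis
      using smooth_ball_infinity_subset[of s] holder_ball_antimono_exponent[OF s(2,3)]
      by (simp add: r s smooth_ball_eq_holder_ball) blast
  next
    case False
    with assms r obtain r' where r': "\<alpha>' = ereal r'" "r \<le> r'" by (cases \<alpha>') auto
    with r(2) have "0 < r'" by simp
    then obtain s' \<beta>' where s': "r' = real s' + \<beta>'" "0 < \<beta>'" "\<beta>' \<le> 1"
      by (rule order_exponent_split)
    have "s < s' \<or> s = s' \<and> \<beta> \<le> \<beta>'" using r'(2) s s' by linarith
    then show ?thesis
      using holder_ball_antimono_order[OF s(2,3)] holder_ball_antimono_exponent[OF s(2)]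
      by (elim disjE conjE) (simp_all add: r r' s s' smooth_ball_eq_holder_ball)
  qed
qed (use assms in auto)

lemma ridge_class_mono:
  assumes "0 < \<alpha>" "\<alpha> \<le> \<alpha>'" "0 < p" "p \<le> q"
  shows "ridge_class \<alpha>' p d \<subseteq> ridge_class \<alpha> q d"
  unfolding ridge_class_def
  using smooth_ball_antimono[OF assms(1,2)] p_norm_le_one_mono[OF assms(3,4)] by blast

text \<open>The restriction to \<open>t \<in> {-1..1}\<close> is essential: elsewhere the derivative within $[-1,1]$ is an
arbitrary value.\<close>

lemma iterated_deriv_eqI:
  assumes "\<And>t. t \<in> {-1..1} \<Longrightarrow> F 0 t = g t"
    and F: "\<And>k t. k < n \<Longrightarrow> t \<in> {-1..1} \<Longrightarrow>
          (F k has_real_derivative F (Suc k) t) (at t within {-1..1})"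
    and "k \<le> n" "t \<in> {-1..1}"
  shows "iterated_deriv k g t = F k t"
  using assms(3,4)
proof (induction k arbitrary: t)
  case 0
  then show ?case using assms(1) by simp
next
  case (Suc k)
  have "(F k has_vector_derivative F (Suc k) t) (at t within {-1..1})"
    using F[of k t] Suc.prems
    by (simp add: has_real_derivative_iff_has_vector_derivative)
  then have "(iterated_deriv k g has_vector_derivative F (Suc k) t) (at t within {-1..1})"
    by (rule has_vector_derivative_transform[rotated 2]) (use Suc in simp_all)
  then have "vector_derivative (iterated_deriv k g) (at t within {-1..1}) = F (Suc k) t"
    by (rule vector_derivative_within_closed_interval[rotated 2]) (use Suc.prems in simp_all)
  then show ?case by simp
qed

lemma holder_ballI:
  assumes "\<And>t. t \<in> {-1..1} \<Longrightarrow> F 0 t = g t"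
    and F: "\<And>k t. k < s \<Longrightarrow> t \<in> {-1..1} \<Longrightarrow>
          (F k has_real_derivative F (Suc k) t) (at t within {-1..1})"
    and bound: "\<And>k t. k \<le> s \<Longrightarrow> t \<in> {-1..1} \<Longrightarrow> \<bar>F k t\<bar> \<le> 1"
    and holder: "\<And>t u. t \<in> {-1..1} \<Longrightarrow> u \<in> {-1..1} \<Longrightarrow>
          \<bar>F s t - F s u\<bar> \<le> 2 * min 1 \<bar>t - u\<bar> powr \<beta>"
  shows "g \<in> holder_ball s \<beta>"
proof -
  have eq: "iterated_deriv k g t = F k t" if "k \<le> s" "t \<in> {-1..1}" for k t
    using assms(1,2) that by (rule iterated_deriv_eqI)
  have "(iterated_deriv k g has_real_derivative iterated_deriv (Suc k) g t) (at t within {-1..1})"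
    if "k < s" "t \<in> {-1..1}" for k t
  proof -
    have "(F k has_vector_derivative F (Suc k) t) (at t within {-1..1})"
      using F[OF that] by (simp add: has_real_derivative_iff_has_vector_derivative)
    then have "(iterated_deriv k g has_vector_derivative F (Suc k) t) (at t within {-1..1})"
      by (rule has_vector_derivative_transform[rotated 2]) (use that eq in simp_all)
    moreover have "iterated_deriv (Suc k) g t = F (Suc k) t" using that by (intro eq) auto
    ultimately show ?thesis unfolding has_real_derivative_iff_has_vector_derivative by metis
  qed
  then show ?thesis
    unfolding holder_ball_def using eq bound holder by (auto simp del: iterated_deriv.simps)
qed

lemma zero_mem_holder_ball: "(\<lambda>_. 0) \<in> holder_ball s \<beta>"
  by (rule holder_ballI[where F="\<lambda>_ _. 0"]) auto

section \<open>Adaptive algorithms and information complexity\<close>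

lemma space_Omega_measure: "space (Omega_measure d) = Omega d"
  by (auto simp: Omega_measure_def space_restrict_space space_PiM Omega_def vectors_def)

lemma inner_prod_measurable [measurable]: "inner_prod d a \<in> borel_measurable (Omega_measure d)"
proof -
  have "(\<lambda>x. \<Sum>i<d. a i * x i) \<in> borel_measurable (PiM {..<d} (\<lambda>_. lborel))"
    by measurable
  then show ?thesis
    unfolding Omega_measure_def inner_prod_def by (rule measurable_restrict_space1)
qed

lemma ridge_class_subset_Linf:
  assumes "0 < \<alpha>" "0 < p" "p \<le> 2"
  shows "ridge_class \<alpha> p d \<subseteq> Linf d"
proof
  fix f assume f: "f \<in> ridge_class \<alpha> p d"
  obtain r where r: "0 < ereal r" "ereal r \<le> \<alpha>"
    using assms(1) by (cases \<alpha>) (auto intro: that[of 1])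
  then have "0 < r" by simp
  then obtain s \<beta> where s: "r = real s + \<beta>" "0 < \<beta>" "\<beta> \<le> 1" by (rule order_exponent_split)
  have "f \<in> ridge_class (ereal r) p d"
    using ridge_class_mono[OF r assms(2) order_refl] f by auto
  then obtain g a where g: "g \<in> holder_ball s \<beta>" and a: "p_norm d p a \<le> 1"
      and feq: "f = (\<lambda>x\<in>Omega d. g (inner_prod d a x))"
    unfolding ridge_class_def s(1) smooth_ball_eq_holder_ball[OF s(2,3)] by blast
  have range: "inner_prod d a x \<in> {-1..1}" if "x \<in> Omega d" for x
    using that inner_prod_mem_interval[OF a assms(2,3)] by (simp add: mem_Omega_iff)
  have "continuous_on {-1..1} g" using holder_ball_continuous_on[OF g s(2), of 0] by simp
  then have "continuous_on UNIV (\<lambda>t. g (max (-1) (min 1 t)))"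
    by (rule continuous_on_compose2) (auto intro!: continuous_intros)
  then have [measurable]: "(\<lambda>t. g (max (-1) (min 1 t))) \<in> borel_measurable borel"
    by (rule borel_measurable_continuous_onI)
  have "(\<lambda>x. g (max (-1) (min 1 (inner_prod d a x)))) \<in> borel_measurable (Omega_measure d)"
    by measurable
  also have "?this \<longleftrightarrow> f \<in> borel_measurable (Omega_measure d)"
    using range by (intro measurable_cong) (auto simp: space_Omega_measure feq)
  finally have meas: "f \<in> borel_measurable (Omega_measure d)" .
  have "\<bar>f x\<bar> \<le> 1" if "x \<in> Omega d" for x
    using range[OF that] g that by (auto simp: feq holder_ball_def)
  then have "Linf_norm d f \<le> 1"
    unfolding Linf_norm_def using meas
    by (intro esssup_I) (auto intro!: AE_I2 simp: space_Omega_measure)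
  then show "f \<in> Linf d"
    using meas unfolding Linf_def by (auto intro: le_less_trans)
qed

lemma g_ada_mono: "F \<subseteq> G \<Longrightarrow> g_ada n d F \<le> g_ada n d G"
  unfolding g_ada_def by (rule INF_superset_mono[OF order_refl], rule SUP_subset_mono) auto

text \<open>The reconstruction picks an arbitrary member of the class that is consistent with the data. Its error
is at most the diameter of the set of consistent functions, and it inherits measurability from the
members of the class. The data $0$ have to be treated separately, since they must be answered by $0$, which may lie
outside the class.\<close>

lemma g_ada_leI:
  assumes "1 \<le> m" and pt: "\<And>ys. pt ys \<in> Omega d" and F: "F \<subseteq> Linf d"
    and "0 \<le> \<epsilon>"
    and two: "\<And>f1 f2 x. f1 \<in> F \<Longrightarrow> f2 \<in> F \<Longrightarrow> information pt m f1 = information pt m f2 \<Longrightarrow>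
                x \<in> Omega d \<Longrightarrow> \<bar>f1 x - f2 x\<bar> \<le> \<epsilon>"
    and zero: "\<And>f x. f \<in> F \<Longrightarrow> information pt m f = replicate m 0 \<Longrightarrow> x \<in> Omega d \<Longrightarrow> \<bar>f x\<bar> \<le> \<epsilon>"
  shows "g_ada m d F \<le> ennreal \<epsilon>"
proof -
  \<comment> \<open>If no member of the class produces the data \<open>ys\<close>, any element of $L_\infty$ will do.\<close>
  define \<phi> where "\<phi> ys = (if ys = replicate m 0 \<or> (\<forall>f\<in>F. information pt m f \<noteq> ys) then (\<lambda>_. 0)
      else (SOME f. f \<in> F \<and> information pt m f = ys))" for ys
  have sel: "(SOME f. f \<in> F \<and> information pt m f = ys) \<in> F \<and>
      information pt m (SOME f. f \<in> F \<and> information pt m f = ys) = ys"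
    if "f \<in> F" "information pt m f = ys" for f ys
    by (rule someI[of _ f]) (use that in simp)
  have "Linf_norm d (\<lambda>_. 0) \<le> 0"
    unfolding Linf_norm_def by (rule esssup_I) simp_all
  then have "(\<lambda>_. 0) \<in> Linf d" by (simp add: Linf_def)
  then have \<phi>: "\<phi> ys \<in> Linf d" for ys
  proof (cases "ys = replicate m 0 \<or> (\<forall>f\<in>F. information pt m f \<noteq> ys)")
    case False
    then show ?thesis using sel[of _ ys] F unfolding \<phi>_def by (subst if_not_P) auto
  qed (simp add: \<phi>_def)
  have "(\<lambda>f. \<phi> (information pt m f)) \<in> adaptive_algorithms m d"
    unfolding adaptive_algorithms_def using assms(1) pt \<phi>
    by (intro CollectI exI[of _ m] exI[of _ pt] exI[of _ \<phi>]) (auto simp: \<phi>_def)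
  moreover have "Linf_norm d (\<lambda>x. f x - \<phi> (information pt m f) x) \<le> ennreal \<epsilon>" if f: "f \<in> F" for f
  proof -
    have "\<bar>f x - \<phi> (information pt m f) x\<bar> \<le> \<epsilon>" if "x \<in> Omega d" for x
    proof (cases "information pt m f = replicate m 0")
      case True
      then show ?thesis using zero[OF f True that] by (simp add: \<phi>_def)
    next
      case False
      then show ?thesis
        using two[OF f _ _ that] sel[OF f refl] f unfolding \<phi>_def by auto
    qed
    moreover have [measurable]: "f \<in> borel_measurable (Omega_measure d)"
        "\<phi> (information pt m f) \<in> borel_measurable (Omega_measure d)"
      using f F \<phi> by (auto simp: Linf_def)
    ultimately show ?thesis
      unfolding Linf_norm_def
      by (intro esssup_I) (auto intro!: AE_I2 ennreal_leI simp: space_Omega_measure)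
  qed
  ultimately show ?thesis
    unfolding g_ada_def by (intro INF_lower2 SUP_least) auto
qed

lemma info_complexity_le:
  assumes "1 \<le> n" "g_ada n d (F d) \<le> ennreal \<epsilon>"
  shows "info_complexity F \<epsilon> d \<le> enat n"
  unfolding info_complexity_def using assms by (intro Inf_lower) auto

lemma information_sample_list:
  assumes "k \<le> length xs"
  shows "information (\<lambda>ys. if length ys < length xs then xs ! length ys else z) k f = map f (take k xs)"
  using assms
proof (induction k)
  case (Suc k)
  then show ?case by (simp add: take_Suc_conv_app_nth)
qed simp

text \<open>The nonadaptive case, in which the points are the elements of a finite set.\<close>

lemma info_complexity_le_card:
  assumes "finite X" "X \<noteq> {}" "X \<subseteq> Omega d" "card X \<le> n" "F d \<subseteq> Linf d" "0 \<le> \<epsilon>"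
    and two: "\<And>f1 f2 x. f1 \<in> F d \<Longrightarrow> f2 \<in> F d \<Longrightarrow> (\<And>x. x \<in> X \<Longrightarrow> f1 x = f2 x) \<Longrightarrow>
                x \<in> Omega d \<Longrightarrow> \<bar>f1 x - f2 x\<bar> \<le> \<epsilon>"
    and zero: "\<And>f x. f \<in> F d \<Longrightarrow> (\<And>x. x \<in> X \<Longrightarrow> f x = 0) \<Longrightarrow> x \<in> Omega d \<Longrightarrow> \<bar>f x\<bar> \<le> \<epsilon>"
  shows "info_complexity F \<epsilon> d \<le> enat n"
proof -
  obtain xs where xs: "set xs = X" "length xs = card X"
    using assms(1) finite_distinct_list distinct_card by metis
  define pt where "pt ys = (if length ys < length xs then xs ! length ys else xs ! 0)" for ys :: "real list"
  have pos: "1 \<le> length xs" using assms(2) xs(1) by (cases xs) auto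
  have info: "information pt (length xs) f = map f xs" for f
    using information_sample_list[of "length xs" xs "xs ! 0" f] unfolding pt_def by simp
  have "g_ada (length xs) d (F d) \<le> ennreal \<epsilon>"
  proof (rule g_ada_leI[OF pos _ assms(5,6)])
    show "pt ys \<in> Omega d" for ys
    proof -
      have "pt ys \<in> set xs"
        using pos unfolding pt_def by (cases "length ys < length xs") (auto intro!: nth_mem)
      then show ?thesis using assms(3) xs(1) by auto
    qed
    show "\<bar>f1 x - f2 x\<bar> \<le> \<epsilon>"
      if "f1 \<in> F d" "f2 \<in> F d" "information pt (length xs) f1 = information pt (length xs) f2"
        "x \<in> Omega d" for f1 f2 x
      using that(3) xs(1) by (intro two that) (auto simp: info)
    show "\<bar>f x\<bar> \<le> \<epsilon>"
      if "f \<in> F d" "information pt (length xs) f = replicate (length xs) 0" "x \<in> Omega d" for f x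
    proof (rule zero[OF that(1) _ that(3)])
      fix y assume "y \<in> X"
      then have "f y \<in> set (map f xs)" using xs(1) by simp
      also have "map f xs = replicate (length xs) 0" using that(2) by (simp add: info)
      finally show "f y = 0" by (auto dest: in_set_replicate[THEN iffD1])
    qed
  qed
  then have "info_complexity F \<epsilon> d \<le> enat (length xs)" by (rule info_complexity_le[OF pos])
  also have "\<dots> \<le> enat n" using assms(4) xs(2) by simp
  finally show ?thesis .
qed

lemma information_eq_zero:
  assumes "\<And>i. i < k \<Longrightarrow> f (pt (replicate i 0)) = 0"
  shows "information pt k f = replicate k 0"
  using assms by (induction k) (simp_all add: replicate_append_same)

text \<open>Fooling functions: along the branch on which all observed values are $0$ the algorithm uses a fixed
set of points and outputs $0$, hence it makes the error $|f|$ on any \<open>f\<close> that vanishes at these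
points.\<close>

lemma info_complexity_ge:
  fixes N :: real
  assumes fool: "\<And>X. finite X \<Longrightarrow> X \<subseteq> Omega d \<Longrightarrow> real (card X) < N \<Longrightarrow>
      \<exists>f\<in>F d. (\<forall>x\<in>X. f x = 0) \<and> \<not> (AE x in Omega_measure d. \<bar>f x\<bar> \<le> \<epsilon>')"
    and "0 \<le> \<epsilon>" "\<epsilon> < \<epsilon>'"
  shows "ereal N \<le> ereal_of_enat (info_complexity F \<epsilon> d)"
proof (cases "info_complexity F \<epsilon> d")
  case (enat k)
  have ne: "{enat n | n. 1 \<le> n \<and> g_ada n d (F d) \<le> ennreal \<epsilon>} \<noteq> {}"
    using enat unfolding info_complexity_def by (metis Inf_empty enat.distinct(1) top_enat_def)
  have "info_complexity F \<epsilon> d \<in> {enat n | n. 1 \<le> n \<and> g_ada n d (F d) \<le> ennreal \<epsilon>}"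
    unfolding info_complexity_def using ne by (meson ex_in_conv wellorder_InfI)
  then have small: "g_ada k d (F d) \<le> ennreal \<epsilon>" by (auto simp: enat)
  have "N \<le> real k"
  proof (rule ccontr)
    assume "\<not> N \<le> real k"
    then have kN: "real k < N" by simp
    have "ennreal \<epsilon>' \<le> g_ada k d (F d)"
      unfolding g_ada_def
    proof (rule INF_greatest)
      fix S assume "S \<in> adaptive_algorithms k d"
      then obtain m pt \<phi> where S: "S = (\<lambda>f. \<phi> (information pt m f))" and m: "m \<le> k"
        and pt: "\<And>ys. pt ys \<in> Omega d" and \<phi>: "AE x in Omega_measure d. \<phi> (replicate m 0) x = 0"
        unfolding adaptive_algorithms_def by blast
      define X where "X = (\<lambda>i. pt (replicate i 0)) ` {..<m}"
      have "card X \<le> m" unfolding X_def using card_image_le[of "{..<m}"] by simp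
      with m kN have "real (card X) < N" by linarith
      with fool[of X] pt obtain f where f: "f \<in> F d" "\<forall>x\<in>X. f x = 0"
          and big: "\<not> (AE x in Omega_measure d. \<bar>f x\<bar> \<le> \<epsilon>')"
        unfolding X_def by auto
      have info: "information pt m f = replicate m 0"
        by (rule information_eq_zero) (use f(2) in \<open>auto simp: X_def\<close>)
      have "ennreal \<epsilon>' \<le> Linf_norm d (\<lambda>x. f x - S f x)"
      proof (rule ccontr)
        assume "\<not> ?thesis"
        then have less: "Linf_norm d (\<lambda>x. f x - S f x) < ennreal \<epsilon>'" by simp
        have "AE x in Omega_measure d. ennreal \<bar>f x - S f x\<bar> \<le> Linf_norm d (\<lambda>x. f x - S f x)"
          unfolding Linf_norm_def by (rule esssup_AE)
        with \<phi> have "AE x in Omega_measure d. \<bar>f x\<bar> \<le> \<epsilon>'"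
        proof eventually_elim
          case (elim x)
          then have "ennreal \<bar>f x\<bar> < ennreal \<epsilon>'" using less by (simp add: S info)
          then show ?case using assms by (simp add: ennreal_less_iff)
        qed
        with big show False by simp
      qed
      also have "\<dots> \<le> (SUP f\<in>F d. Linf_norm d (\<lambda>x. f x - S f x))" by (rule SUP_upper[OF f(1)])
      finally show "ennreal \<epsilon>' \<le> (SUP f\<in>F d. Linf_norm d (\<lambda>x. f x - S f x))" .
    qed
    with small have "ennreal \<epsilon>' \<le> ennreal \<epsilon>" by simp
    with assms show False by (simp add: ennreal_le_iff)
  qed
  then show ?thesis by (simp add: enat)
qed simp

section \<open>Lower bounds\<close>

text \<open>A weak form of $\cosh t \le e^{t^2/2}$. The better constant in the exponent would improve only the
base of the exponential lower bounds.\<close>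

lemma exp_plus_exp_minus_le:
  fixes t :: real
  shows "exp t + exp (- t) \<le> 2 * exp (t\<^sup>2)"
proof -
  have main: "exp t + exp (- t) \<le> 2 * exp (t\<^sup>2)" if "0 \<le> t" for t :: real
  proof (cases "t \<le> 1")
    case True
    have a: "exp t \<le> 1 + t + t\<^sup>2" using exp_bound[OF that True] .
    have "1 \<le> (1 - t + t\<^sup>2) * (1 + t)" using that by (simp add: algebra_simps power2_eq_square)
    also have "\<dots> \<le> (1 - t + t\<^sup>2) * exp t"
      using True by (intro mult_left_mono) auto
    finally have "exp (- t) \<le> 1 - t + t\<^sup>2" by (simp add: exp_minus field_simps)
    with a show ?thesis using exp_ge_add_one_self[of "t\<^sup>2"] by linarith
  next
    case False
    then have "t \<le> t\<^sup>2" by (simp add: power2_eq_square)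
    then have "exp t \<le> exp (t\<^sup>2)" "exp (- t) \<le> exp (t\<^sup>2)" using that by auto
    then show ?thesis by linarith
  qed
  show ?thesis using main[of t] main[of "- t"] by (cases "0 \<le> t") (auto simp: add.commute)
qed

definition signs :: "nat \<Rightarrow> rvec set" where
  "signs d = {..<d} \<rightarrow>\<^sub>E {-1, 1}"

lemma card_signs: "real (card (signs d)) = 2 ^ d"
  by (simp add: signs_def card_PiE)

text \<open>The moment generating function of a Rademacher sum, multiplied by $2^d$; it factorizes over the
coordinates.\<close>

lemma sum_exp_signs_le:
  assumes "(\<Sum>i<d. (x i)\<^sup>2) \<le> 1"
  shows "(\<Sum>\<sigma>\<in>signs d. exp (\<theta> * (\<Sum>i<d. \<sigma> i * x i))) \<le> 2 ^ d * exp (\<theta>\<^sup>2)"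
proof -
  have "(\<Sum>\<sigma>\<in>signs d. exp (\<theta> * (\<Sum>i<d. \<sigma> i * x i))) =
      (\<Sum>\<sigma>\<in>signs d. \<Prod>i<d. exp (\<theta> * (\<sigma> i * x i)))"
    by (simp add: exp_sum sum_distrib_left)
  also have "\<dots> = (\<Prod>i<d. \<Sum>e\<in>{-1, 1}. exp (\<theta> * (e * x i)))"
    unfolding signs_def by (rule prod_sum_PiE[symmetric]) auto
  also have "\<dots> \<le> (\<Prod>i<d. 2 * exp ((\<theta> * x i)\<^sup>2))"
    using exp_plus_exp_minus_le by (intro prod_mono) (auto simp: add.commute intro!: add_nonneg_nonneg)
  also have "\<dots> = 2 ^ d * exp (\<theta>\<^sup>2 * (\<Sum>i<d. (x i)\<^sup>2))"
    by (simp add: prod.distrib exp_sum sum_distrib_left power_mult_distrib)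
  also have "\<dots> \<le> 2 ^ d * exp (\<theta>\<^sup>2 * 1)"
    using assms by (intro mult_left_mono, subst exp_le_cancel_iff) (auto intro: mult_left_mono simp: mult_left_le)
  finally show ?thesis by simp
qed

text \<open>A union bound: for each \<open>x\<close> at most the fraction $e^{-d/16}$ of all sign vectors violates the
inequality.\<close>

lemma sign_vector_almost_orthogonal:
  assumes "finite X" "X \<subseteq> Omega d" "real (card X) < exp (real d / 16)"
  obtains \<sigma> where "\<sigma> \<in> signs d" "\<And>x. x \<in> X \<Longrightarrow> (\<Sum>i<d. \<sigma> i * x i) \<le> sqrt (real d) / 2"
proof -
  \<comment> \<open>This value minimizes $\theta^2 - \theta\sqrt{d}/2$, the exponent in the Chernoff bound.\<close>
  define \<theta> where "\<theta> = sqrt (real d) / 4"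
  have l: "\<theta> * (sqrt (real d) / 2) = real d / 8" "\<theta>\<^sup>2 = real d / 16"
    by (simp_all add: \<theta>_def power2_eq_square)
  have "\<exists>\<sigma>\<in>signs d. \<forall>x\<in>X. (\<Sum>i<d. \<sigma> i * x i) \<le> sqrt (real d) / 2"
  proof (rule ccontr)
    assume "\<not> ?thesis"
    then have bad: "\<exists>x\<in>X. sqrt (real d) / 2 < (\<Sum>i<d. \<sigma> i * x i)" if "\<sigma> \<in> signs d" for \<sigma>
      using that by (meson not_le)
    have "exp (real d / 8) \<le> (\<Sum>x\<in>X. exp (\<theta> * (\<Sum>i<d. \<sigma> i * x i)))" if \<sigma>: "\<sigma> \<in> signs d" for \<sigma>
    proof -
      obtain x where x: "x \<in> X" "sqrt (real d) / 2 < (\<Sum>i<d. \<sigma> i * x i)" using bad[OF \<sigma>] by blast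
      have "exp (real d / 8) \<le> exp (\<theta> * (\<Sum>i<d. \<sigma> i * x i))"
        unfolding l(1)[symmetric] exp_le_cancel_iff
        using x(2) by (intro mult_left_mono) (auto simp: \<theta>_def)
      also have "\<dots> \<le> (\<Sum>x\<in>X. exp (\<theta> * (\<Sum>i<d. \<sigma> i * x i)))"
        using x(1) assms(1) by (intro member_le_sum) auto
      finally show ?thesis .
    qed
    then have "real (card (signs d)) * exp (real d / 8)
        \<le> (\<Sum>\<sigma>\<in>signs d. \<Sum>x\<in>X. exp (\<theta> * (\<Sum>i<d. \<sigma> i * x i)))"
      by (intro sum_bounded_below) auto
    also have "\<dots> = (\<Sum>x\<in>X. \<Sum>\<sigma>\<in>signs d. exp (\<theta> * (\<Sum>i<d. \<sigma> i * x i)))"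
      by (rule sum.swap)
    also have "\<dots> \<le> (\<Sum>x\<in>X. 2 ^ d * exp (\<theta>\<^sup>2))"
      using assms(2) by (intro sum_mono sum_exp_signs_le) (auto simp: mem_Omega_iff)
    also have "\<dots> = real (card X) * (2 ^ d * exp (real d / 16))" by (simp add: l)
    also have "\<dots> < exp (real d / 16) * (2 ^ d * exp (real d / 16))"
      using assms(3) by (intro mult_strict_right_mono) auto
    also have "\<dots> = 2 ^ d * exp (real d / 8)" by (simp flip: exp_add)
    finally show False by (simp add: card_signs)
  qed
  then show thesis using that by blast
qed

lemma DERIV_truncated_powr:
  fixes t :: real
  assumes "1 < \<gamma>"
  shows "((\<lambda>t. max 0 (t - \<eta>) powr \<gamma>) has_real_derivative \<gamma> * max 0 (t - \<eta>) powr (\<gamma> - 1)) (at t)"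
proof -
  consider "t < \<eta>" | "t > \<eta>" | "t = \<eta>" by linarith
  then show ?thesis
  proof cases
    case 1
    have "((\<lambda>_. 0) has_real_derivative 0) (at t)" by simp
    then have "((\<lambda>t. max 0 (t - \<eta>) powr \<gamma>) has_real_derivative 0) (at t)"
      by (rule has_field_derivative_transform_within_open[where S="{..<\<eta>}"]) (use 1 in auto)
    then show ?thesis using 1 by simp
  next
    case 2
    have "((\<lambda>t. t - \<eta>) has_real_derivative 1) (at t)"
      by (auto intro!: derivative_eq_intros)
    from DERIV_fun_powr[OF this, of \<gamma>] 2
    have "((\<lambda>t. (t - \<eta>) powr \<gamma>) has_real_derivative \<gamma> * (t - \<eta>) powr (\<gamma> - 1)) (at t)"
      by simp
    then have "((\<lambda>t. max 0 (t - \<eta>) powr \<gamma>) has_real_derivative \<gamma> * (t - \<eta>) powr (\<gamma> - 1)) (at t)"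
      by (rule has_field_derivative_transform_within_open[where S="{\<eta><..}"]) (use 2 in auto)
    moreover have "max 0 (t - \<eta>) = t - \<eta>" using 2 by simp
    ultimately show ?thesis by (simp only:)
  next
    case 3
    have "((\<lambda>y. \<bar>y - \<eta>\<bar>) \<longlongrightarrow> 0) (at \<eta>)"
      by (rule tendsto_rabs_zero) (simp add: LIM_zero tendsto_ident_at)
    then have "((\<lambda>y. \<bar>y - \<eta>\<bar> powr (\<gamma> - 1)) \<longlongrightarrow> 0) (at \<eta>)"
      by (rule tendsto_zero_powrI[OF _ tendsto_const]) (auto simp: assms)
    moreover have "\<forall>\<^sub>F y in at \<eta>. norm ((max 0 (y - \<eta>) powr \<gamma> - 0) / (y - \<eta>)) \<le> \<bar>y - \<eta>\<bar> powr (\<gamma> - 1)"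
    proof (intro always_eventually allI)
      fix y
      show "norm ((max 0 (y - \<eta>) powr \<gamma> - 0) / (y - \<eta>)) \<le> \<bar>y - \<eta>\<bar> powr (\<gamma> - 1)"
      proof (cases "y > \<eta>")
        case True
        then show ?thesis by (simp add: powr_diff)
      next
        case False
        then have "max 0 (y - \<eta>) = 0" by simp
        then show ?thesis by (simp only: powr_0) simp
      qed
    qed
    ultimately have "((\<lambda>y. (max 0 (y - \<eta>) powr \<gamma> - 0) / (y - \<eta>)) \<longlongrightarrow> 0) (at \<eta>)"
      by (rule Lim_null_comparison[rotated])
    moreover have "max 0 (\<eta> - \<eta>) = 0" by simp
    ultimately show ?thesis unfolding has_field_derivative_iff 3 by (simp only: powr_0 mult_zero_right)
  qed
qed

lemma powr_subadditive:
  fixes x y :: real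
  assumes "0 < \<beta>" "\<beta> \<le> 1" "0 \<le> x" "0 \<le> y"
  shows "(x + y) powr \<beta> \<le> x powr \<beta> + y powr \<beta>"
proof (cases "x + y = 0")
  case False
  with assms have pos: "0 < x + y" by linarith
  have ge: "z / (x + y) \<le> z powr \<beta> / (x + y) powr \<beta>" if "0 \<le> z" "z \<le> x + y" for z
  proof -
    have "(z / (x + y)) powr 1 \<le> (z / (x + y)) powr \<beta>"
      using assms that pos by (intro powr_mono') auto
    then show ?thesis using that pos by (simp add: powr_divide)
  qed
  have "1 = x / (x + y) + y / (x + y)" using pos by (simp flip: add_divide_distrib)
  also have "\<dots> \<le> x powr \<beta> / (x + y) powr \<beta> + y powr \<beta> / (x + y) powr \<beta>"
    using assms by (intro add_mono ge) auto
  also have "\<dots> = (x powr \<beta> + y powr \<beta>) / (x + y) powr \<beta>" by (simp add: add_divide_distrib)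
  finally show ?thesis using pos by (simp add: pos_le_divide_eq)
qed (use assms in simp)

lemma powr_holder:
  fixes P Q :: real
  assumes "0 < \<beta>" "\<beta> \<le> 1" "0 \<le> P" "0 \<le> Q"
  shows "\<bar>P powr \<beta> - Q powr \<beta>\<bar> \<le> \<bar>P - Q\<bar> powr \<beta>"
proof -
  have main: "\<bar>P powr \<beta> - Q powr \<beta>\<bar> \<le> \<bar>P - Q\<bar> powr \<beta>" if "0 \<le> Q" "Q \<le> P" for P Q :: real
  proof -
    have "P powr \<beta> \<le> Q powr \<beta> + (P - Q) powr \<beta>"
      using powr_subadditive[OF assms(1,2), of Q "P - Q"] that by simp
    moreover have "Q powr \<beta> \<le> P powr \<beta>" using that assms by (intro powr_mono2) auto
    ultimately show ?thesis using that by simp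
  qed
  show ?thesis using main[of Q P] main[of P Q] assms
    by (cases "Q \<le> P") (auto simp: abs_minus_commute)
qed

text \<open>The truncated power $(t-\eta)_+^{s+\beta}$, scaled so that all derivatives up to order \<open>s\<close> are at most
$1$ on $[-1,1]$: the factors produced by differentiation are at most $1 + s + \beta$ each.\<close>

definition bump :: "nat \<Rightarrow> real \<Rightarrow> real \<Rightarrow> real \<Rightarrow> real" where
  "bump s \<beta> \<eta> t = max 0 (t - \<eta>) powr (real s + \<beta>) / (1 + real s + \<beta>) ^ s"

lemma bump_mem_holder_ball:
  assumes "0 < \<beta>" "\<beta> \<le> 1" "0 \<le> \<eta>"
  shows "bump s \<beta> \<eta> \<in> holder_ball s \<beta>"
proof -
  define \<alpha> where "\<alpha> = real s + \<beta>"
  define w where "w k = (\<Prod>i<k. \<alpha> - real i) / (1 + \<alpha>) ^ s" for k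
  have w: "0 \<le> w k \<and> w k \<le> 1" if "k \<le> s" for k
  proof -
    have fac: "0 \<le> \<alpha> - real i \<and> \<alpha> - real i \<le> 1 + \<alpha>" if "i < k" for i
      using that \<open>k \<le> s\<close> assms by (auto simp: \<alpha>_def)
    have "(\<Prod>i<k. \<alpha> - real i) \<le> (\<Prod>i<k. 1 + \<alpha>)" using fac by (intro prod_mono) auto
    also have "\<dots> = (1 + \<alpha>) ^ k" by simp
    also have "\<dots> \<le> (1 + \<alpha>) ^ s"
      using that assms by (intro power_increasing) (auto simp: \<alpha>_def)
    finally have "(\<Prod>i<k. \<alpha> - real i) \<le> (1 + \<alpha>) ^ s" .
    moreover have "0 \<le> (\<Prod>i<k. \<alpha> - real i)" using fac by (intro prod_nonneg) auto
    ultimately show ?thesis using assms by (simp add: w_def \<alpha>_def divide_le_eq)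
  qed
  show ?thesis
  proof (rule holder_ballI[where F="\<lambda>k t. w k * max 0 (t - \<eta>) powr (\<alpha> - real k)"])
    show "w 0 * max 0 (t - \<eta>) powr (\<alpha> - real 0) = bump s \<beta> \<eta> t" for t
      by (simp add: w_def bump_def \<alpha>_def add.assoc)
  next
    fix k t assume k: "k < s"
    have "1 < \<alpha> - real k" using k assms by (simp add: \<alpha>_def)
    from DERIV_cmult[OF has_field_derivative_at_within[OF DERIV_truncated_powr[OF this]]]
    have "((\<lambda>t. w k * max 0 (t - \<eta>) powr (\<alpha> - real k)) has_real_derivative
        w k * ((\<alpha> - real k) * max 0 (t - \<eta>) powr (\<alpha> - real k - 1))) (at t within {-1..1})" .
    moreover have "w k * ((\<alpha> - real k) * max 0 (t - \<eta>) powr (\<alpha> - real k - 1))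
        = w (Suc k) * max 0 (t - \<eta>) powr (\<alpha> - real (Suc k))"
    proof -
      have "w (Suc k) = w k * (\<alpha> - real k)" by (simp add: w_def)
      moreover have "\<alpha> - real k - 1 = \<alpha> - real (Suc k)" by simp
      ultimately show ?thesis by (simp only: mult.assoc)
    qed
    ultimately show "((\<lambda>t. w k * max 0 (t - \<eta>) powr (\<alpha> - real k)) has_real_derivative
        w (Suc k) * max 0 (t - \<eta>) powr (\<alpha> - real (Suc k))) (at t within {-1..1})"
      by simp
  next
    fix k t assume k: "k \<le> s" and t: "t \<in> {-1..1::real}"
    have "max 0 (t - \<eta>) powr (\<alpha> - real k) \<le> 1"
      using k t assms by (intro powr_le1) (auto simp: \<alpha>_def)
    then show "\<bar>w k * max 0 (t - \<eta>) powr (\<alpha> - real k)\<bar> \<le> 1"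
      using w[OF k] by (simp add: abs_mult mult_le_one)
  next
    fix t u assume t: "t \<in> {-1..1::real}" "u \<in> {-1..1::real}"
    have "\<bar>w s * max 0 (t - \<eta>) powr (\<alpha> - real s) - w s * max 0 (u - \<eta>) powr (\<alpha> - real s)\<bar>
        = w s * \<bar>max 0 (t - \<eta>) powr \<beta> - max 0 (u - \<eta>) powr \<beta>\<bar>"
      using w[of s] by (simp add: \<alpha>_def abs_mult flip: right_diff_distrib)
    also have "\<dots> \<le> 1 * \<bar>max 0 (t - \<eta>) - max 0 (u - \<eta>)\<bar> powr \<beta>"
      using w[of s] powr_holder[OF assms(1,2)] by (intro mult_mono) auto
    also have "\<dots> \<le> \<bar>t - u\<bar> powr \<beta>"
      using assms by (simp, intro powr_mono2) (auto simp: max_def abs_if)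
    also have "\<dots> \<le> 2 * min 1 \<bar>t - u\<bar> powr \<beta>"
    proof (cases "\<bar>t - u\<bar> \<le> 1")
      case False
      have "\<bar>t - u\<bar> powr \<beta> \<le> \<bar>t - u\<bar> powr 1" using False assms by (intro powr_mono) auto
      also have "\<dots> \<le> 2" using t by (auto simp: abs_if)
      finally show ?thesis using False by simp
    qed simp
    finally show "\<bar>w s * max 0 (t - \<eta>) powr (\<alpha> - real s) - w s * max 0 (u - \<eta>) powr (\<alpha> - real s)\<bar>
        \<le> 2 * min 1 \<bar>t - u\<bar> powr \<beta>" .
  qed
qed

text \<open>A property that fails on a nondegenerate box inside the ball fails on a set of positive measure.\<close>

lemma not_AE_if_box:
  assumes "\<And>i. i < d \<Longrightarrow> lo i < hi i"
    and box: "\<And>x. x \<in> vectors d \<Longrightarrow> (\<And>i. i < d \<Longrightarrow> lo i \<le> x i \<and> x i \<le> hi i) \<Longrightarrow> x \<in> Omega d \<and> \<not> P x"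
  shows "\<not> (AE x in Omega_measure d. P x)"
proof
  interpret product_sigma_finite "\<lambda>_::nat. lborel :: real measure" ..
  define B where "B = (\<Pi>\<^sub>E i\<in>{..<d}. {lo i..hi i})"
  have [measurable]: "Omega d \<in> sets (PiM {..<d} (\<lambda>_. lborel))"
  proof -
    have "Omega d = {x \<in> space (PiM {..<d} (\<lambda>_. lborel)). (\<Sum>i<d. (x i)\<^sup>2) \<le> 1}"
      unfolding space_PiM space_lborel by (simp add: mem_Omega_iff vectors_def set_eq_iff)
    also have "\<dots> \<in> sets (PiM {..<d} (\<lambda>_. lborel))" by measurable
    finally show ?thesis .
  qed
  assume "AE x in Omega_measure d. P x"
  then have "AE x in PiM {..<d} (\<lambda>_. lborel). x \<in> Omega d \<longrightarrow> P x"
    unfolding Omega_measure_def by (subst (asm) AE_restrict_space_iff) auto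
  moreover have "x \<in> Omega d \<and> \<not> P x" if "x \<in> B" for x
    by (rule box) (use that in \<open>simp_all add: B_def vectors_def PiE_iff\<close>)
  ultimately have "AE x in PiM {..<d} (\<lambda>_. lborel). x \<notin> B"
    by (rule_tac eventually_mono) auto
  moreover have "B \<in> sets (PiM {..<d} (\<lambda>_. lborel))"
    unfolding B_def by (intro sets_PiM_I_finite) auto
  ultimately have "emeasure (PiM {..<d} (\<lambda>_. lborel)) B = 0"
    by (simp add: AE_iff_null_sets[symmetric] null_setsD1)
  moreover have "emeasure (PiM {..<d} (\<lambda>_. lborel)) B = (\<Prod>i<d. emeasure lborel {lo i..hi i})"
    unfolding B_def by (rule emeasure_PiM) auto
  moreover have "(\<Prod>i<d. emeasure lborel {lo i..hi i}) \<noteq> 0"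
    using assms(1) by (force simp: less_imp_le)
  ultimately show False by simp
qed

text \<open>The term \<open>real d powr (1/2 - 1/p)\<close> is the Euclidean norm of the vectors $d^{-1/p}\sigma$, which
lie on the unit sphere of $\ell_p$. The fooling functions live on them.\<close>

lemma info_complexity_ridge_ge:
  assumes \<beta>: "0 < \<beta>" "\<beta> \<le> 1" and p: "0 < p" "p \<le> 2" and d: "1 \<le> d" and "0 \<le> \<epsilon>"
    and \<epsilon>: "\<epsilon> < (real d powr (1/2 - 1/p) / 4) powr (real s + \<beta>) / (1 + real s + \<beta>) ^ s / 2"
  shows "ereal (exp (real d / 16)) \<le> ereal_of_enat (info_complexity (ridge_class (ereal (real s + \<beta>)) p) \<epsilon> d)"
proof (rule info_complexity_ge[OF _ \<open>0 \<le> \<epsilon>\<close> \<epsilon>])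
  fix X assume X: "finite X" "X \<subseteq> Omega d" "real (card X) < exp (real d / 16)"
  define \<delta> where "\<delta> = real d powr (1/2 - 1/p)"
  \<comment> \<open>The function is large near the corner $r\sigma$ of the cube inscribed in the ball.\<close>
  define r where "r = real d powr - (1/2)"
  have pos: "0 < real d" using d by simp
  have \<delta>: "0 < \<delta>" using pos by (simp add: \<delta>_def)
  have r: "0 < r" "r\<^sup>2 = 1 / real d"
    using pos by (simp_all add: r_def powr_minus powr_half_sqrt power_divide inverse_eq_divide)
  obtain \<sigma> where \<sigma>: "\<sigma> \<in> signs d" and \<sigma>X: "\<And>x. x \<in> X \<Longrightarrow> (\<Sum>i<d. \<sigma> i * x i) \<le> sqrt (real d) / 2"
    using sign_vector_almost_orthogonal[OF X] by blast
  have sgn: "\<sigma> i = -1 \<or> \<sigma> i = 1" if "i < d" for i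
    using \<sigma> that by (auto simp: signs_def PiE_iff)
  define A where "A = real d powr - (1 / p)"
  define a where "a = restrict (\<lambda>i. A * \<sigma> i) {..<d}"
  have A: "0 < A" using pos by (simp add: A_def)
  have A\<delta>: "A * sqrt (real d) = \<delta>"
    by (simp add: A_def \<delta>_def powr_half_sqrt[symmetric] flip: powr_add)
  have inner: "inner_prod d a x = A * (\<Sum>i<d. \<sigma> i * x i)" for x
    by (simp add: inner_prod_def a_def sum_distrib_left mult.assoc)
  define f where "f = (\<lambda>x\<in>Omega d. bump s \<beta> (\<delta> / 2) (inner_prod d a x))"
  show "\<exists>f\<in>ridge_class (ereal (real s + \<beta>)) p d. (\<forall>x\<in>X. f x = 0) \<and>
      \<not> (AE x in Omega_measure d.
        \<bar>f x\<bar> \<le> (real d powr (1/2 - 1/p) / 4) powr (real s + \<beta>) / (1 + real s + \<beta>) ^ s / 2)"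
  proof (intro bexI[of _ f] conjI ballI)
    have "(\<Sum>i<d. \<bar>a i\<bar> powr p) = (\<Sum>i<d. A powr p)"
      using sgn A by (intro sum.cong) (force simp: a_def abs_mult)+
    also have "\<dots> = 1"
    proof -
      have "A powr p = real d powr (-1)" using p by (simp add: A_def powr_powr)
      then show ?thesis using pos by (simp add: powr_minus_divide)
    qed
    finally have "p_norm d p a \<le> 1" using p by (simp add: p_norm_le_one_iff)
    moreover have "bump s \<beta> (\<delta> / 2) \<in> smooth_ball (ereal (real s + \<beta>))"
      unfolding smooth_ball_eq_holder_ball[OF \<beta>] using bump_mem_holder_ball[OF \<beta>] \<delta> by simp
    moreover have "a \<in> vectors d" by (simp add: a_def vectors_def)
    ultimately show "f \<in> ridge_class (ereal (real s + \<beta>)) p d"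
      unfolding ridge_class_def f_def by blast
  next
    fix x assume x: "x \<in> X"
    have "inner_prod d a x \<le> A * (sqrt (real d) / 2)"
      unfolding inner using \<sigma>X[OF x] A by (intro mult_left_mono) auto
    also have "\<dots> = \<delta> / 2" using A\<delta> by simp
    finally show "f x = 0" using x X(2) by (auto simp: f_def bump_def)
  next
    show "\<not> (AE x in Omega_measure d.
        \<bar>f x\<bar> \<le> (real d powr (1/2 - 1/p) / 4) powr (real s + \<beta>) / (1 + real s + \<beta>) ^ s / 2)"
    proof (rule not_AE_if_box)
      fix i assume "i < d"
      then show "(if \<sigma> i = 1 then 3/4 * r else - r) < (if \<sigma> i = 1 then r else - (3/4 * r))"
        using r by simp
    next
      fix x assume x: "x \<in> vectors d" and bnd: "\<And>i. i < d \<Longrightarrow>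
        (if \<sigma> i = 1 then 3/4 * r else - r) \<le> x i \<and> x i \<le> (if \<sigma> i = 1 then r else - (3/4 * r))"
      have lo: "3/4 * r \<le> \<sigma> i * x i" and up: "\<bar>x i\<bar> \<le> r" if "i < d" for i
        using sgn[OF that] bnd[OF that] r(1) by (auto split: if_splits)
      have "(\<Sum>i<d. (x i)\<^sup>2) \<le> (\<Sum>i<d. r\<^sup>2)"
        using up r(1) by (intro sum_mono) (simp add: abs_le_square_iff[symmetric])
      also have "\<dots> = 1" using pos by (simp add: r)
      finally have O: "x \<in> Omega d" using x by (simp add: mem_Omega_iff)
      \<comment> \<open>On the part of the cube with $\sigma_i x_i \ge \frac{3}{4} r$ the argument of the profile exceeds the threshold $\delta/2$ by at least $\delta/4$.\<close>
      have "3/4 * \<delta> = A * (\<Sum>i<d. 3/4 * r)"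
        using pos by (simp add: A\<delta>[symmetric] r_def powr_minus powr_half_sqrt field_simps)
      also have "\<dots> \<le> inner_prod d a x"
        unfolding inner using A lo by (intro mult_left_mono sum_mono) auto
      finally have "\<delta> / 4 \<le> inner_prod d a x - \<delta> / 2" by simp
      then have "\<delta> / 4 \<le> max 0 (inner_prod d a x - \<delta> / 2)" by (rule max.coboundedI2)
      then have "(\<delta> / 4) powr (real s + \<beta>) \<le> max 0 (inner_prod d a x - \<delta> / 2) powr (real s + \<beta>)"
        by (rule powr_mono2[rotated 2]) (use \<delta> \<beta> in auto)
      then have "(\<delta> / 4) powr (real s + \<beta>) / (1 + real s + \<beta>) ^ s \<le> f x"
        using O \<beta> by (simp add: f_def bump_def divide_right_mono)
      moreover have "0 < (\<delta> / 4) powr (real s + \<beta>) / (1 + real s + \<beta>) ^ s" using \<delta> \<beta> by simp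
      ultimately show "x \<in> Omega d \<and> \<not> \<bar>f x\<bar> \<le>
          (real d powr (1/2 - 1/p) / 4) powr (real s + \<beta>) / (1 + real s + \<beta>) ^ s / 2"
        using O unfolding \<delta>_def by auto
    qed
  qed
qed

text \<open>For $p = 2$ the vectors $d^{-1/2}\sigma$ have norm $1$ in every dimension, so the fooling functions do
not become smaller.\<close>

lemma curse_of_dimensionality_ridge:
  assumes "0 < \<alpha>" "\<alpha> < \<infinity>"
  shows "curse_of_dimensionality (ridge_class \<alpha> 2)"
proof -
  obtain q where q: "\<alpha> = ereal q" "0 < q" using assms by (cases \<alpha>) auto
  obtain s \<beta> where s: "q = real s + \<beta>" "0 < \<beta>" "\<beta> \<le> 1" by (rule order_exponent_split[OF q(2)])
  define e where "e = (1 / 4) powr (real s + \<beta>) / (1 + real s + \<beta>) ^ s / 2"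
  have e: "0 < e" using s by (simp add: e_def)
  define \<epsilon>0 where "\<epsilon>0 = min 1 (e / 2)"
  have "ereal (1 * (1 + (exp (1/16) - 1)) ^ d) \<le> ereal_of_enat (info_complexity (ridge_class \<alpha> 2) \<epsilon> d)"
    if "1 \<le> d" "0 < \<epsilon>" "\<epsilon> \<le> \<epsilon>0" for d \<epsilon>
  proof -
    have "ereal (exp (real d / 16)) \<le> ereal_of_enat (info_complexity (ridge_class \<alpha> 2) \<epsilon> d)"
      unfolding q s(1) using that s e
      by (intro info_complexity_ridge_ge) (auto simp: \<epsilon>0_def e_def)
    then show ?thesis by (simp flip: exp_of_nat_mult)
  qed
  then have "{1..} \<subseteq> {d. 1 \<le> d \<and> (\<forall>\<epsilon>. 0 < \<epsilon> \<and> \<epsilon> \<le> \<epsilon>0 \<longrightarrow> ereal (1 * (1 + (exp (1/16) - 1)) ^ d)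
      \<le> ereal_of_enat (info_complexity (ridge_class \<alpha> 2) \<epsilon> d))}" by auto
  then have "infinite {d. 1 \<le> d \<and> (\<forall>\<epsilon>. 0 < \<epsilon> \<and> \<epsilon> \<le> \<epsilon>0 \<longrightarrow> ereal (1 * (1 + (exp (1/16) - 1)) ^ d)
      \<le> ereal_of_enat (info_complexity (ridge_class \<alpha> 2) \<epsilon> d))}"
    using infinite_Ici infinite_super by blast
  then show ?thesis
    unfolding curse_of_dimensionality_def using e
    by (intro exI[of _ 1] exI[of _ \<epsilon>0] exI[of _ "exp (1/16) - 1"]) (auto simp: \<epsilon>0_def)
qed

lemma le_ln_enat:
  assumes "ereal (exp y) \<le> ereal_of_enat n"
  shows "ereal y \<le> ln_enat n"
proof (cases n)
  case (enat k)
  with assms have "exp y \<le> real k" by simp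
  moreover from this have "0 < real k" by (meson exp_gt_zero less_le_trans)
  ultimately show ?thesis by (simp add: enat ln_enat_def ln_ge_iff)
qed (simp add: ln_enat_def)

text \<open>With $\varepsilon_d = e/d$ for a small constant $e$, the logarithm of the complexity and
$1/\varepsilon_d + d$ are both of order $d$, so their quotient stays away from $0$.\<close>

lemma intractable_ridge:
  assumes "0 < \<alpha>" "0 < p" "p < 2" "\<alpha> \<le> ereal (1 / (1 / p - 1 / 2))"
  shows "intractable (ridge_class \<alpha> p)"
proof -
  obtain q where q: "\<alpha> = ereal q" "0 < q" using assms by (cases \<alpha>) auto
  obtain s \<beta> where s: "q = real s + \<beta>" "0 < \<beta>" "\<beta> \<le> 1" by (rule order_exponent_split[OF q(2)])
  have gap: "0 < 1 / p - 1 / 2" using assms by (simp add: field_simps)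
  have "q * (1 / p - 1 / 2) \<le> 1" using assms(4) gap by (simp add: q pos_le_divide_eq)
  then have exponent: "-1 \<le> (1/2 - 1/p) * q"
    by (metis minus_diff_eq mult.commute mult_minus_left neg_le_iff_le)
  define e where "e = min 1 ((1 / 4) powr q / (1 + real s + \<beta>) ^ s / 4)"
  have e: "0 < e" "e \<le> 1" using s by (auto simp: e_def)
  have big: "ereal (real d / 16) \<le> ln_enat (info_complexity (ridge_class \<alpha> p) (e / real d) d)"
    if d: "1 \<le> d" for d
  proof -
    have "real d powr (-1) \<le> real d powr ((1/2 - 1/p) * q)"
      using exponent d by (intro powr_mono) auto
    then have "1 / real d * (1/4) powr q \<le> (real d powr (1/2 - 1/p)) powr q * (1/4) powr q"
      using d by (intro mult_right_mono) (auto simp: powr_powr powr_minus_divide)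
    also have "\<dots> = (real d powr (1/2 - 1/p) / 4) powr q"
      by (simp add: powr_divide)
    finally have 1: "(1/4) powr q / real d \<le> (real d powr (1/2 - 1/p) / 4) powr q" by simp
    have "e / real d < (1/4) powr q / real d / (1 + real s + \<beta>) ^ s / 2"
    proof -
      have "0 < (1/4) powr q / (1 + real s + \<beta>) ^ s" using s by simp
      then have "(1/4) powr q / (1 + real s + \<beta>) ^ s / 4 < (1/4) powr q / (1 + real s + \<beta>) ^ s / 2"
        by (intro divide_strict_left_mono) auto
      then have "e < (1/4) powr q / (1 + real s + \<beta>) ^ s / 2"
        unfolding e_def by (subst min_less_iff_disj) blast
      then have "e / real d < (1/4) powr q / (1 + real s + \<beta>) ^ s / 2 / real d"
        using d by (intro divide_strict_right_mono) auto
      then show ?thesis by (simp add: mult_ac)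
    qed
    also have "\<dots> \<le> (real d powr (1/2 - 1/p) / 4) powr q / (1 + real s + \<beta>) ^ s / 2"
      using 1 s by (intro divide_right_mono) auto
    finally show ?thesis
      unfolding q s(1) using assms s d e
      by (intro le_ln_enat info_complexity_ridge_ge) auto
  qed
  define h where "h = (\<lambda>(\<epsilon>::real, d::nat). 1 / \<epsilon> + real d)"
  define Q where "Q = (\<lambda>(\<epsilon>, d). ln_enat (info_complexity (ridge_class \<alpha> p) \<epsilon> d) / ereal (1 / \<epsilon> + real d))"
  \<comment> \<open>A path to infinity along which the quotient in the definition of weak tractability stays bounded below.\<close>
  define x where "x = (\<lambda>d::nat. (e / real d, d))"
  have hx: "h (x d) = (1 / e + 1) * real d" for d
    by (simp add: h_def x_def algebra_simps)
  have c: "0 < 1 / e + 1" using e by (simp add: add_pos_pos)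
  have "filterlim (\<lambda>d. (1 / e + 1) * real d) at_top sequentially"
    using c by (intro filterlim_tendsto_pos_mult_at_top[OF tendsto_const] filterlim_real_sequentially) auto
  then have "filterlim x (filtercomap h at_top) sequentially"
    by (simp add: filterlim_filtercomap_iff comp_def hx)
  moreover have "\<forall>\<^sub>F d in sequentially. x d \<in> {0<..1} \<times> {1..}"
    using eventually_ge_at_top[of 1]
  proof eventually_elim
    case (elim d)
    then have "e \<le> real d" using e by linarith
    then show ?case using elim e by (simp add: x_def divide_le_eq)
  qed
  ultimately have lim: "filterlim x (filtercomap h at_top \<sqinter> principal ({0<..1} \<times> {1..})) sequentially"
    by (simp add: filterlim_inf filterlim_principal)
  show ?thesis
    unfolding intractable_def
  proof
    assume "weakly_tractable (ridge_class \<alpha> p)"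
    then have "(Q \<longlongrightarrow> 0) (filtercomap h at_top \<sqinter> principal ({0<..1} \<times> {1..}))"
      unfolding weakly_tractable_def Q_def h_def .
    then have "((\<lambda>d. Q (x d)) \<longlongrightarrow> 0) sequentially"
      using lim by (rule filterlim_compose)
    moreover have "0 < ereal (1 / 16 / (1 / e + 1))" using c by simp
    ultimately have "\<forall>\<^sub>F d in sequentially. Q (x d) < ereal (1 / 16 / (1 / e + 1))"
      by (rule order_tendstoD(2))
    then have "\<forall>\<^sub>F d in sequentially. Q (x d) < ereal (1 / 16 / (1 / e + 1)) \<and> 1 \<le> d"
      using eventually_ge_at_top[of 1] by (rule eventually_conj)
    then obtain d where d: "Q (x d) < ereal (1 / 16 / (1 / e + 1))" "1 \<le> d"
      using eventually_happens[of _ sequentially] by auto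
    have "ereal (1 / 16 / (1 / e + 1)) = ereal (real d / 16) / ereal (h (x d))"
      unfolding hx using d(2) c by simp
    also have "\<dots> \<le> ln_enat (info_complexity (ridge_class \<alpha> p) (e / real d) d) / ereal (h (x d))"
      using big[OF d(2)] c d(2) unfolding hx by (intro ereal_divide_right_mono) auto
    also have "\<dots> = Q (x d)" by (simp add: Q_def x_def h_def)
    finally show False using d(1) by simp
  qed
qed

section \<open>Sums of lattice steps\<close>

text \<open>All sums of \<open>k\<close> elements of \<open>E\<close>. If \<open>E\<close> contains $0$, shorter sums are included.\<close>

primrec step_sums :: "rvec set \<Rightarrow> nat \<Rightarrow> rvec set" where
  "step_sums E 0 = {\<lambda>_. 0}"
| "step_sums E (Suc k) = (\<lambda>(v, e) i. v i + e i) ` (step_sums E k \<times> E)"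

lemma finite_step_sums: "finite E \<Longrightarrow> finite (step_sums E k)"
  by (induction k) auto

lemma card_step_sums: "finite E \<Longrightarrow> card (step_sums E k) \<le> card E ^ k"
proof (induction k)
  case (Suc k)
  have "card (step_sums E (Suc k)) \<le> card (step_sums E k \<times> E)"
    unfolding step_sums.simps using Suc finite_step_sums[of E k] by (intro card_image_le) simp
  also have "\<dots> \<le> card E ^ k * card E" using Suc by (simp add: card_cartesian_product)
  finally show ?case by (simp add: mult.commute)
qed simp

lemma step_sums_SucI: "v \<in> step_sums E k \<Longrightarrow> e \<in> E \<Longrightarrow> (\<lambda>i. v i + e i) \<in> step_sums E (Suc k)"
  by force

lemma step_sums_mono:
  assumes "(\<lambda>_. 0) \<in> E" "k \<le> n"
  shows "step_sums E k \<subseteq> step_sums E n"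
  using assms(2)
proof (induction rule: dec_induct)
  case (step n)
  have "step_sums E n \<subseteq> step_sums E (Suc n)"
  proof
    fix v assume "v \<in> step_sums E n"
    from step_sums_SucI[OF this assms(1)] show "v \<in> step_sums E (Suc n)" by simp
  qed
  with step show ?case by blast
qed simp

definition unit_vec :: "nat \<Rightarrow> rvec" where
  "unit_vec i = (\<lambda>j. if j = i then 1 else 0)"

definition pos_steps :: "nat \<Rightarrow> rvec set" where
  "pos_steps d = insert (\<lambda>_. 0) (unit_vec ` {..<d})"

definition all_steps :: "nat \<Rightarrow> rvec set" where
  "all_steps d = insert (\<lambda>_. 0) (unit_vec ` {..<d} \<union> (\<lambda>i j. - unit_vec i j) ` {..<d})"

lemma finite_steps: "finite (pos_steps d)" "finite (all_steps d)"
  by (auto simp: pos_steps_def all_steps_def)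

lemma card_pos_steps: "card (pos_steps d) \<le> d + 1"
proof -
  have "card (pos_steps d) \<le> Suc (card (unit_vec ` {..<d}))"
    unfolding pos_steps_def by (rule card_insert_le_m1) auto
  also have "\<dots> \<le> d + 1" using card_image_le[of "{..<d}" unit_vec] by simp
  finally show ?thesis .
qed

lemma card_all_steps: "card (all_steps d) \<le> 2 * d + 1"
proof -
  have "card (all_steps d) \<le> Suc (card (unit_vec ` {..<d} \<union> (\<lambda>i j. - unit_vec i j) ` {..<d}))"
    unfolding all_steps_def by (rule card_insert_le_m1) auto
  also have "\<dots> \<le> Suc (card (unit_vec ` {..<d}) + card ((\<lambda>i j. - unit_vec i j) ` {..<d}))"
    using card_Un_le by auto
  also have "\<dots> \<le> 2 * d + 1"
    using card_image_le[of "{..<d}" unit_vec] card_image_le[of "{..<d}" "\<lambda>i j. - unit_vec i j"] by simp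
  finally show ?thesis .
qed

lemma inner_prod_add_scale:
  "inner_prod d a (\<lambda>i. x i + c * y i) = inner_prod d a x + c * inner_prod d a y"
  by (simp add: inner_prod_def sum.distrib sum_distrib_left algebra_simps)

lemma inner_prod_unit_vec: "i < d \<Longrightarrow> inner_prod d a (unit_vec i) = a i"
  by (simp add: inner_prod_def unit_vec_def if_distrib cong: if_cong)

lemma L2_step_sums_le:
  assumes "v \<in> step_sums (pos_steps d) k"
  shows "L2_set v {..<d} \<le> real k"
  using assms
proof (induction k arbitrary: v)
  case (Suc k)
  then obtain u e where v: "v = (\<lambda>i. u i + e i)" and u: "u \<in> step_sums (pos_steps d) k"
    and e: "e \<in> pos_steps d" by auto
  have "L2_set e {..<d} \<le> (\<Sum>i<d. \<bar>e i\<bar>)" by (rule L2_set_le_sum_abs)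
  also have "\<dots> \<le> 1" using e by (auto simp: pos_steps_def unit_vec_def if_distrib cong: if_cong)
  finally have "L2_set e {..<d} \<le> 1" .
  moreover have "L2_set v {..<d} \<le> L2_set u {..<d} + L2_set e {..<d}"
    unfolding v by (rule L2_set_triangle_ineq)
  ultimately show ?case using Suc.IH[OF u] by simp
qed (simp add: L2_set_def)

section \<open>Finite differences and Taylor expansion of ridge functions\<close>

text \<open>The mixed difference $\Delta_{b_1} \cdots \Delta_{b_k} h(u)$ for a list of steps.\<close>

primrec fdiff :: "real list \<Rightarrow> (real \<Rightarrow> real) \<Rightarrow> real \<Rightarrow> real" where
  "fdiff [] h u = h u"
| "fdiff (b # bs) h u = fdiff bs h (u + b) - fdiff bs h u"

lemma holder_ball_holder:
  assumes "g \<in> holder_ball s \<beta>" "0 < \<beta>" "t \<in> {-1..1}" "u \<in> {-1..1}"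
  shows "\<bar>iterated_deriv s g t - iterated_deriv s g u\<bar> \<le> 2 * \<bar>t - u\<bar> powr \<beta>"
proof -
  have "\<bar>iterated_deriv s g t - iterated_deriv s g u\<bar> \<le> 2 * min 1 \<bar>t - u\<bar> powr \<beta>"
    using assms(1,3,4) unfolding holder_ball_def by blast
  with min_powr_le[OF assms(2), of t u] show ?thesis by linarith
qed

lemma holder_ball_DERIV:
  assumes "g \<in> holder_ball s \<beta>" "k < s" "\<bar>t\<bar> < 1"
  shows "DERIV (iterated_deriv k g) t :> iterated_deriv (Suc k) g t"
proof -
  have "(iterated_deriv k g has_real_derivative iterated_deriv (Suc k) g t) (at t within {-1..1})"
  proof -
    have "t \<in> {-1..1}" using assms(3) by auto
    then show ?thesis using assms(1,2) unfolding holder_ball_def by blast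
  qed
  moreover have "at t within {-1..1} = at t" using assms(3) by (intro at_within_Icc_at) auto
  ultimately show ?thesis by (simp only:)
qed

lemma DERIV_fdiff:
  assumes g: "g \<in> holder_ball s \<beta>" "k < s" and "\<bar>t\<bar> + (\<Sum>b\<leftarrow>bs. \<bar>b\<bar>) < 1"
  shows "DERIV (fdiff bs (iterated_deriv k g)) t :> fdiff bs (iterated_deriv (Suc k) g) t"
  using assms(3)
proof (induction bs arbitrary: t)
  case Nil
  then show ?case using holder_ball_DERIV[OF g, of t] by (simp del: iterated_deriv.simps)
next
  case (Cons b bs)
  have "DERIV (fdiff bs (iterated_deriv k g)) (t + b) :> fdiff bs (iterated_deriv (Suc k) g) (t + b)"
    using Cons.prems by (intro Cons.IH) auto
  then have "DERIV (\<lambda>t. fdiff bs (iterated_deriv k g) (t + b)) t :> fdiff bs (iterated_deriv (Suc k) g) (t + b)"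
    by (simp only: DERIV_shift)
  moreover have "DERIV (fdiff bs (iterated_deriv k g)) t :> fdiff bs (iterated_deriv (Suc k) g) t"
    using Cons.prems by (intro Cons.IH) auto
  ultimately show ?case by (simp only: fdiff.simps) (rule DERIV_diff)
qed

lemma mean_value_signed:
  fixes f f' :: "real \<Rightarrow> real"
  assumes "\<And>x. \<bar>x - u\<bar> \<le> \<bar>b\<bar> \<Longrightarrow> DERIV f x :> f' x"
  obtains z where "\<bar>z - u\<bar> \<le> \<bar>b\<bar>" "f (u + b) - f u = b * f' z"
proof -
  consider "b = 0" | "0 < b" | "b < 0" by linarith
  then show thesis
  proof cases
    case 1
    then show thesis using that[of u] by simp
  next
    case 2
    then obtain z where "u < z" "z < u + b" "f (u + b) - f u = (u + b - u) * f' z"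
      using MVT2[of u "u + b" f f'] assms by auto
    then show thesis using that[of z] 2 by auto
  next
    case 3
    then obtain z where "u + b < z" "z < u" "f u - f (u + b) = (u - (u + b)) * f' z"
      using MVT2[of "u + b" u f f'] assms by auto
    then show thesis using that[of z] 3 by auto
  qed
qed

text \<open>Each step of the difference is traded for one derivative by the mean value theorem. The factor
\<open>prod_list bs\<close> is exact, so after division by it only the modulus of continuity of the highest
derivative enters. The window of width $\sum |b|$ around \<open>u\<close> has to stay inside $(-1,1)$.\<close>

lemma fdiff_mean_value:
  assumes g: "g \<in> holder_ball s \<beta>" and "k + length bs \<le> s" "\<bar>u\<bar> + (\<Sum>b\<leftarrow>bs. \<bar>b\<bar>) < 1"
  shows "\<exists>z. \<bar>z - u\<bar> \<le> (\<Sum>b\<leftarrow>bs. \<bar>b\<bar>) \<and>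
    fdiff bs (iterated_deriv k g) u = prod_list bs * iterated_deriv (k + length bs) g z"
  using assms(2,3)
proof (induction bs arbitrary: k u)
  case Nil
  then show ?case by (intro exI[of _ u]) simp
next
  case (Cons b bs)
  define B where "B = (\<Sum>b\<leftarrow>bs. \<bar>b\<bar>)"
  have B: "\<bar>u\<bar> + (\<bar>b\<bar> + B) < 1" using Cons.prems by (simp add: B_def)
  have ks: "k < s" using Cons.prems by simp
  obtain z where z: "\<bar>z - u\<bar> \<le> \<bar>b\<bar>" "fdiff bs (iterated_deriv k g) (u + b) - fdiff bs (iterated_deriv k g) u
      = b * fdiff bs (iterated_deriv (Suc k) g) z"
  proof (rule mean_value_signed)
    fix x assume "\<bar>x - u\<bar> \<le> \<bar>b\<bar>"
    then show "DERIV (fdiff bs (iterated_deriv k g)) x :> fdiff bs (iterated_deriv (Suc k) g) x"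
      using B by (intro DERIV_fdiff[OF g ks]) (auto simp: B_def)
  qed
  have "\<bar>z\<bar> + (\<Sum>b\<leftarrow>bs. \<bar>b\<bar>) < 1" using z(1) B by (simp add: B_def)
  then obtain y where y: "\<bar>y - z\<bar> \<le> B" "fdiff bs (iterated_deriv (Suc k) g) z
      = prod_list bs * iterated_deriv (Suc k + length bs) g y"
    using Cons.IH[of "Suc k" z] Cons.prems unfolding B_def by auto
  have "\<bar>y - u\<bar> \<le> (\<Sum>b\<leftarrow>b # bs. \<bar>b\<bar>)" using y(1) z(1) by (simp add: B_def)
  moreover have "fdiff (b # bs) (iterated_deriv k g) u
      = prod_list (b # bs) * iterated_deriv (k + length (b # bs)) g y"
    using z(2) y(2) by (simp del: iterated_deriv.simps)
  ultimately show ?case by blast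
qed

text \<open>A common modulus of continuity for the derivatives of all orders up to \<open>s\<close>.\<close>

lemma holder_ball_modulus:
  assumes "g \<in> holder_ball s \<beta>" "0 < \<beta>" "\<beta> \<le> 1" "k \<le> s" "t \<in> {-1..1}" "u \<in> {-1..1}"
    and "\<bar>t - u\<bar> \<le> r" "r \<le> 1"
  shows "\<bar>iterated_deriv k g t - iterated_deriv k g u\<bar> \<le> 2 * r powr \<beta>"
proof -
  have r: "\<bar>t - u\<bar> powr \<beta> \<le> r powr \<beta>" using assms by (intro powr_mono2) auto
  show ?thesis
  proof (cases "k = s")
    case True
    show ?thesis unfolding True using r holder_ball_holder[OF assms(1,2,5,6)] by linarith
  next
    case False
    have "\<bar>iterated_deriv k g t - iterated_deriv k g u\<bar> \<le> \<bar>t - u\<bar> powr 1"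
      using holder_ball_lipschitz[OF assms(1), of k t u] False assms by simp
    also have "\<dots> \<le> \<bar>t - u\<bar> powr \<beta>" using assms by (intro powr_mono') auto
    finally show ?thesis using r powr_ge_zero[of r \<beta>] by linarith
  qed
qed

lemma abs_prod_list_le_one:
  fixes xs :: "real list"
  assumes "\<And>x. x \<in> set xs \<Longrightarrow> \<bar>x\<bar> \<le> 1"
  shows "\<bar>prod_list xs\<bar> \<le> 1"
  using assms by (induction xs) (auto simp: abs_mult mult_le_one)

lemma fdiff_approx_deriv:
  assumes g: "g \<in> holder_ball s \<beta>" "0 < \<beta>" "\<beta> \<le> 1" and I: "length I \<le> s" "\<And>i. i \<in> set I \<Longrightarrow> \<bar>a i\<bar> \<le> 1"
    and \<tau>: "0 < \<tau>" "\<bar>u\<bar> + real s * \<tau> < 1"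
  shows "\<bar>fdiff (map (\<lambda>i. \<tau> * a i) I) g u / \<tau> ^ length I - prod_list (map a I) * iterated_deriv (length I) g u\<bar>
    \<le> 2 * (real s * \<tau>) powr \<beta>"
proof -
  have "(\<Sum>b\<leftarrow>map (\<lambda>i. \<tau> * a i) I. \<bar>b\<bar>) \<le> (\<Sum>i\<leftarrow>I. \<tau>)"
    unfolding map_map comp_def using I(2) \<tau>(1)
    by (intro sum_list_mono) (simp add: abs_mult mult_left_le)
  also have "\<dots> \<le> real s * \<tau>" using I(1) \<tau>(1) by (simp add: sum_list_triv)
  finally have B: "(\<Sum>b\<leftarrow>map (\<lambda>i. \<tau> * a i) I. \<bar>b\<bar>) \<le> real s * \<tau>" .
  obtain z where z: "\<bar>z - u\<bar> \<le> (\<Sum>b\<leftarrow>map (\<lambda>i. \<tau> * a i) I. \<bar>b\<bar>)"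
    "fdiff (map (\<lambda>i. \<tau> * a i) I) g u = prod_list (map (\<lambda>i. \<tau> * a i) I) * iterated_deriv (length I) g z"
    using fdiff_mean_value[OF g(1), of 0 "map (\<lambda>i. \<tau> * a i) I" u] I(1) B \<tau> by auto
  have prod: "prod_list (map (\<lambda>i. \<tau> * a i) I) = \<tau> ^ length I * prod_list (map a I)"
    by (induction I) auto
  have zu: "\<bar>z - u\<bar> \<le> real s * \<tau>" using z(1) B by linarith
  have "\<bar>fdiff (map (\<lambda>i. \<tau> * a i) I) g u / \<tau> ^ length I - prod_list (map a I) * iterated_deriv (length I) g u\<bar>
      = \<bar>prod_list (map a I)\<bar> * \<bar>iterated_deriv (length I) g z - iterated_deriv (length I) g u\<bar>"
    using \<tau>(1) by (simp add: z(2) prod abs_mult flip: right_diff_distrib)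
  also have "\<dots> \<le> 1 * (2 * (real s * \<tau>) powr \<beta>)"
    using I zu \<tau> abs_prod_list_le_one[of "map a I"]
    by (intro mult_mono holder_ball_modulus[OF g]) auto
  finally show ?thesis by simp
qed

text \<open>Along a ridge function, moving by $\tau e_i$ moves the argument of the profile by $\tau a_i$.
Therefore the differences of the profile are combinations of samples, and they agree for two ridge
functions that agree at the sample points.\<close>

lemma fdiff_ridge_agree:
  assumes agree: "\<And>v. v \<in> step_sums (pos_steps d) s \<Longrightarrow>
      g1 (inner_prod d a1 (\<lambda>i. y i + \<tau> * v i)) = g2 (inner_prod d a2 (\<lambda>i. y i + \<tau> * v i))"
    and "v \<in> step_sums (pos_steps d) k" "k + length I \<le> s" "set I \<subseteq> {..<d}"
  shows "fdiff (map (\<lambda>i. \<tau> * a1 i) I) g1 (inner_prod d a1 (\<lambda>i. y i + \<tau> * v i)) =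
      fdiff (map (\<lambda>i. \<tau> * a2 i) I) g2 (inner_prod d a2 (\<lambda>i. y i + \<tau> * v i))"
  using assms(2-)
proof (induction I arbitrary: v k)
  case Nil
  have "(\<lambda>_. 0) \<in> pos_steps d" by (simp add: pos_steps_def)
  then show ?case using step_sums_mono[of "pos_steps d" k s] Nil agree[of v] by auto
next
  case (Cons i I)
  have i: "i < d" using Cons.prems by simp
  have v': "(\<lambda>j. v j + unit_vec i j) \<in> step_sums (pos_steps d) (Suc k)"
    using i by (intro step_sums_SucI[OF Cons.prems(1)]) (simp add: pos_steps_def)
  have shift: "inner_prod d a (\<lambda>j. y j + \<tau> * (v j + unit_vec i j)) = inner_prod d a (\<lambda>j. y j + \<tau> * v j) + \<tau> * a i" for a
    using inner_prod_add_scale[of d a "\<lambda>j. y j + \<tau> * v j" \<tau> "unit_vec i"] inner_prod_unit_vec[OF i, of a]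
    by (simp add: algebra_simps)
  show ?case
    using Cons.IH[OF v'] Cons.IH[OF Cons.prems(1)] Cons.prems by (simp add: shift)
qed

text \<open>Agreement at the points $y + \tau v$ fixes all partial derivatives at \<open>y\<close> up to order \<open>s\<close>, namely the
numbers $g^{(j)}(a \cdot y)\, a_{i_1} \cdots a_{i_j}$, up to an error that tends to $0$ with
$\tau$.\<close>

lemma ridge_derivatives_close:
  assumes g1: "g1 \<in> holder_ball s \<beta>" and g2: "g2 \<in> holder_ball s \<beta>" and \<beta>: "0 < \<beta>" "\<beta> \<le> 1"
    and a: "\<And>i. i < d \<Longrightarrow> \<bar>a1 i\<bar> \<le> 1" "\<And>i. i < d \<Longrightarrow> \<bar>a2 i\<bar> \<le> 1"
    and agree: "\<And>v. v \<in> step_sums (pos_steps d) s \<Longrightarrow>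
      g1 (inner_prod d a1 (\<lambda>i. y i + \<tau> * v i)) = g2 (inner_prod d a2 (\<lambda>i. y i + \<tau> * v i))"
    and I: "length I \<le> s" "set I \<subseteq> {..<d}" and \<tau>: "0 < \<tau>"
    and u: "\<bar>inner_prod d a1 y\<bar> + real s * \<tau> < 1" "\<bar>inner_prod d a2 y\<bar> + real s * \<tau> < 1"
  shows "\<bar>iterated_deriv (length I) g1 (inner_prod d a1 y) * prod_list (map a1 I)
      - iterated_deriv (length I) g2 (inner_prod d a2 y) * prod_list (map a2 I)\<bar> \<le> 4 * (real s * \<tau>) powr \<beta>"
proof -
  have "fdiff (map (\<lambda>i. \<tau> * a1 i) I) g1 (inner_prod d a1 y) = fdiff (map (\<lambda>i. \<tau> * a2 i) I) g2 (inner_prod d a2 y)"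
    using fdiff_ridge_agree[of d s g1 a1 y \<tau> g2 a2 "\<lambda>_. 0" 0 I] agree I by simp
  moreover have "\<bar>fdiff (map (\<lambda>i. \<tau> * a1 i) I) g1 (inner_prod d a1 y) / \<tau> ^ length I
      - prod_list (map a1 I) * iterated_deriv (length I) g1 (inner_prod d a1 y)\<bar> \<le> 2 * (real s * \<tau>) powr \<beta>"
    using I a by (intro fdiff_approx_deriv g1 \<beta> \<tau> u) auto
  moreover have "\<bar>fdiff (map (\<lambda>i. \<tau> * a2 i) I) g2 (inner_prod d a2 y) / \<tau> ^ length I
      - prod_list (map a2 I) * iterated_deriv (length I) g2 (inner_prod d a2 y)\<bar> \<le> 2 * (real s * \<tau>) powr \<beta>"
    using I a by (intro fdiff_approx_deriv g2 \<beta> \<tau> u) auto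
  ultimately show ?thesis by (simp only: mult.commute[of "prod_list _"])
qed

text \<open>Closeness of all partial derivatives of order \<open>j\<close> gives closeness of the homogeneous parts of order
\<open>j\<close> of the Taylor polynomials. The induction peels off one factor \<open>inner_prod d a z\<close> at a time and
absorbs its coefficients into \<open>c1\<close> and \<open>c2\<close>. The factor $d^j$ is harmless, as $\eta$ may be chosen
depending on \<open>d\<close>.\<close>

lemma power_forms_close:
  assumes "\<And>I. length I = j \<Longrightarrow> set I \<subseteq> {..<d} \<Longrightarrow>
      \<bar>c1 * prod_list (map a1 I) - c2 * prod_list (map a2 I)\<bar> \<le> \<eta>"
    and z: "\<And>i. i < d \<Longrightarrow> \<bar>z i\<bar> \<le> 1"
  shows "\<bar>c1 * inner_prod d a1 z ^ j - c2 * inner_prod d a2 z ^ j\<bar> \<le> real d ^ j * \<eta>"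
  using assms(1)
proof (induction j arbitrary: c1 c2)
  case 0
  then show ?case using 0[of "[]"] by simp
next
  case (Suc j)
  have IH: "\<bar>c1 * a1 i * inner_prod d a1 z ^ j - c2 * a2 i * inner_prod d a2 z ^ j\<bar> \<le> real d ^ j * \<eta>"
    if i: "i < d" for i
  proof (rule Suc.IH)
    fix I :: "nat list" assume "length I = j" "set I \<subseteq> {..<d}"
    then show "\<bar>c1 * a1 i * prod_list (map a1 I) - c2 * a2 i * prod_list (map a2 I)\<bar> \<le> \<eta>"
      using Suc.prems[of "i # I"] i by (simp add: mult.assoc)
  qed
  have eq: "c1 * inner_prod d a1 z ^ Suc j - c2 * inner_prod d a2 z ^ Suc j
      = (\<Sum>i<d. (c1 * a1 i * inner_prod d a1 z ^ j - c2 * a2 i * inner_prod d a2 z ^ j) * z i)"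
  proof -
    have "c * inner_prod d a z ^ Suc j = (\<Sum>i<d. c * a i * inner_prod d a z ^ j * z i)" for c a
    proof -
      have "c * inner_prod d a z ^ Suc j = c * inner_prod d a z ^ j * (\<Sum>i<d. a i * z i)"
        by (simp add: inner_prod_def)
      then show ?thesis by (simp only: sum_distrib_left mult_ac)
    qed
    then show ?thesis by (simp only: left_diff_distrib sum_subtractf)
  qed
  have "\<bar>c1 * inner_prod d a1 z ^ Suc j - c2 * inner_prod d a2 z ^ Suc j\<bar> \<le> (\<Sum>i<d. \<bar>(c1 * a1 i * inner_prod d a1 z ^ j - c2 * a2 i * inner_prod d a2 z ^ j) * z i\<bar>)"
    unfolding eq by (rule sum_abs)
  also have "\<dots> \<le> (\<Sum>i<d. real d ^ j * \<eta>)"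
  proof (rule sum_mono)
    fix i assume "i \<in> {..<d}"
    then have "\<bar>c1 * a1 i * inner_prod d a1 z ^ j - c2 * a2 i * inner_prod d a2 z ^ j\<bar> * \<bar>z i\<bar>
        \<le> real d ^ j * \<eta> * 1"
      using IH[of i] z[of i] by (intro mult_mono) (auto intro: order_trans[OF abs_ge_zero])
    then show "\<bar>(c1 * a1 i * inner_prod d a1 z ^ j - c2 * a2 i * inner_prod d a2 z ^ j) * z i\<bar> \<le> real d ^ j * \<eta>"
      by (simp add: abs_mult)
  qed
  also have "\<dots> = real d ^ Suc j * \<eta>" by simp
  finally show ?case .
qed

text \<open>Lagrange's form of the remainder with \<open>s\<close> terms, compared with the term of order \<open>s\<close> at \<open>u\<close> by the
Hoelder condition.\<close>

lemma holder_ball_taylor: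
  assumes g: "g \<in> holder_ball s \<beta>" and \<beta>: "0 < \<beta>" "\<beta> \<le> 1" and u: "\<bar>u\<bar> < 1" "\<bar>u + w\<bar> < 1"
  shows "\<bar>g (u + w) - (\<Sum>j\<le>s. iterated_deriv j g u / fact j * w ^ j)\<bar> \<le> 2 * \<bar>w\<bar> powr (real s + \<beta>) / fact s"
proof -
  have hol: "\<bar>iterated_deriv s g t - iterated_deriv s g u\<bar> \<le> 2 * \<bar>w\<bar> powr \<beta>" if "\<bar>t - u\<bar> \<le> \<bar>w\<bar>" "\<bar>t\<bar> < 1" for t
  proof -
    have "t \<in> {-1..1}" "u \<in> {-1..1}" using that u by auto
    note holder_ball_holder[OF g \<beta>(1) this]
    moreover have "\<bar>t - u\<bar> powr \<beta> \<le> \<bar>w\<bar> powr \<beta>" using that \<beta> by (intro powr_mono2) auto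
    ultimately show ?thesis by linarith
  qed
  have powr: "\<bar>w\<bar> powr \<beta> * \<bar>w\<bar> ^ s = \<bar>w\<bar> powr (real s + \<beta>)" if "w \<noteq> 0"
    using that by (simp add: powr_add powr_realpow)
  consider "w = 0" | "w \<noteq> 0" "s = 0" | "w \<noteq> 0" "0 < s" by auto
  then show ?thesis
  proof cases
    case 1
    have "(\<Sum>j\<le>s. iterated_deriv j g u / fact j * 0 ^ j) = g u"
      by (simp add: power_0_left if_distrib sum.delta cong: if_cong del: iterated_deriv.simps(2))
    then show ?thesis using 1 by simp
  next
    case 2
    then show ?thesis using hol[of "u + w"] u by simp
  next
    case 3
    have "\<exists>t. (if u + w < u then u + w < t \<and> t < u else u < t \<and> t < u + w) \<and>
        g (u + w) = (\<Sum>m<s. iterated_deriv m g u / fact m * (u + w - u) ^ m) + iterated_deriv s g t / fact s * (u + w - u) ^ s"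
    proof (rule Taylor[where a="min u (u + w)" and b="max u (u + w)"])
      show "\<forall>m t. m < s \<and> min u (u + w) \<le> t \<and> t \<le> max u (u + w) \<longrightarrow>
          DERIV (iterated_deriv m g) t :> iterated_deriv (Suc m) g t"
        using u by (intro allI impI holder_ball_DERIV[OF g]) (auto simp: min_def max_def abs_if split: if_splits)
    qed (use 3 in auto)
    then obtain t where t: "if u + w < u then u + w < t \<and> t < u else u < t \<and> t < u + w"
        "g (u + w) = (\<Sum>m<s. iterated_deriv m g u / fact m * w ^ m) + iterated_deriv s g t / fact s * w ^ s"
      by auto
    have tu: "\<bar>t - u\<bar> \<le> \<bar>w\<bar>" "\<bar>t\<bar> < 1" using t(1) u by (auto split: if_splits)
    have "(\<Sum>j\<le>s. iterated_deriv j g u / fact j * w ^ j)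
        = (\<Sum>m<s. iterated_deriv m g u / fact m * w ^ m) + iterated_deriv s g u / fact s * w ^ s"
      by (simp only: lessThan_Suc_atMost[symmetric] sum.lessThan_Suc)
    then have "g (u + w) - (\<Sum>j\<le>s. iterated_deriv j g u / fact j * w ^ j)
        = (iterated_deriv s g t - iterated_deriv s g u) * w ^ s / fact s"
      using t(2) by (simp add: algebra_simps diff_divide_distrib)
    also have "\<bar>\<dots>\<bar> = \<bar>iterated_deriv s g t - iterated_deriv s g u\<bar> * \<bar>w\<bar> ^ s / fact s"
      by (simp add: abs_mult power_abs)
    also have "\<dots> \<le> 2 * \<bar>w\<bar> powr \<beta> * \<bar>w\<bar> ^ s / fact s"
      using hol[OF tu] by (intro divide_right_mono mult_right_mono) auto
    finally show ?thesis using powr[OF 3(1)] by (simp add: mult.assoc)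
  qed
qed

section \<open>Sampling around a net\<close>

lemma small_radius:
  fixes \<beta> \<rho> e C :: real
  assumes "0 < \<beta>" "0 < \<rho>" "0 < e" "0 < C"
  obtains r where "0 < r" "r < \<rho>" "C * r powr \<beta> \<le> e"
proof
  define r where "r = min (\<rho> / 2) ((e / C) powr (1 / \<beta>))"
  show "0 < r" using assms by (simp add: r_def)
  show "r < \<rho>" using assms by (auto simp: r_def min_def)
  have "r powr \<beta> \<le> ((e / C) powr (1 / \<beta>)) powr \<beta>"
    using assms \<open>0 < r\<close> by (intro powr_mono2) (auto simp: r_def)
  also have "\<dots> = e / C" using assms by (simp add: powr_powr)
  finally show "C * r powr \<beta> \<le> e" using assms by (simp add: pos_le_divide_eq mult.commute)
qed

text \<open>A net of the Euclidean unit ball for the seminorm $z \mapsto \sup_{\|a\|_p \le 1} |a \cdot z|$.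
Approximation from below in each coordinate makes the net usable on all smaller balls at once: for
\<open>x\<close> in a ball around the origin, \<open>y\<close> lies in the same ball, which leaves room for the difference
steps around \<open>y\<close>.\<close>

definition solid_net :: "real \<Rightarrow> nat \<Rightarrow> real \<Rightarrow> rvec set \<Rightarrow> bool" where
  "solid_net p d \<delta> Y \<longleftrightarrow>
     (\<forall>x. (\<Sum>i<d. (x i)\<^sup>2) \<le> 1 \<longrightarrow>
       (\<exists>y\<in>Y. (\<forall>i<d. \<bar>y i\<bar> \<le> \<bar>x i\<bar> \<and> \<bar>x i - y i\<bar> \<le> 1) \<and>
          (\<forall>a. p_norm d p a \<le> 1 \<longrightarrow> \<bar>inner_prod d a (\<lambda>i. x i - y i)\<bar> \<le> \<delta>)))"

lemma p_norm_le_one_imp_sum_squares: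
  "0 < p \<Longrightarrow> p \<le> 2 \<Longrightarrow> p_norm d p a \<le> 1 \<Longrightarrow> (\<Sum>i<d. (a i)\<^sup>2) \<le> 1"
  using p_norm_le_one_mono[of p 2 d a] by (simp add: p_norm_2_le_one_iff)

lemma sum_squares_le_one_imp_abs_le_one:
  fixes a :: rvec
  assumes "(\<Sum>i<d. (a i)\<^sup>2) \<le> 1" "i < d"
  shows "\<bar>a i\<bar> \<le> 1"
proof -
  have "(a i)\<^sup>2 \<le> (\<Sum>i<d. (a i)\<^sup>2)" using assms(2) by (intro member_le_sum) auto
  then have "(a i)\<^sup>2 \<le> 1" using assms(1) by linarith
  then show ?thesis by (simp add: abs_square_le_1)
qed

text \<open>Combination of the previous estimates: both functions differ from their Taylor polynomials at \<open>y\<close> by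
$2\delta^{s+\beta}/s!$, and the polynomials nearly coincide.\<close>

lemma ridge_functions_close:
  assumes g1: "g1 \<in> holder_ball s \<beta>" and g2: "g2 \<in> holder_ball s \<beta>" and \<beta>: "0 < \<beta>" "\<beta> \<le> 1"
    and a: "(\<Sum>i<d. (a1 i)\<^sup>2) \<le> 1" "(\<Sum>i<d. (a2 i)\<^sup>2) \<le> 1"
    and agree: "\<And>v. v \<in> step_sums (pos_steps d) s \<Longrightarrow>
      g1 (inner_prod d a1 (\<lambda>i. y i + \<tau> * v i)) = g2 (inner_prod d a2 (\<lambda>i. y i + \<tau> * v i))"
    and \<tau>: "0 < \<tau>" "real s * \<tau> < \<rho>" and \<rho>: "\<rho> < 1"
    and y: "(\<Sum>i<d. (y i)\<^sup>2) \<le> (1 - \<rho>)\<^sup>2" and x: "(\<Sum>i<d. (x i)\<^sup>2) \<le> (1 - \<rho>)\<^sup>2"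
    and z: "\<And>i. i < d \<Longrightarrow> \<bar>x i - y i\<bar> \<le> 1"
    and \<delta>: "\<bar>inner_prod d a1 (\<lambda>i. x i - y i)\<bar> \<le> \<delta>" "\<bar>inner_prod d a2 (\<lambda>i. x i - y i)\<bar> \<le> \<delta>"
  shows "\<bar>g1 (inner_prod d a1 x) - g2 (inner_prod d a2 x)\<bar>
    \<le> 4 * \<delta> powr (real s + \<beta>) / fact s + (\<Sum>j\<le>s. real d ^ j / fact j) * (4 * (real s * \<tau>) powr \<beta>)"
proof -
  have pos: "0 < \<rho>" using \<tau> by (smt (verit) mult_nonneg_nonneg of_nat_0_le_iff)
  have ins: "\<bar>inner_prod d b v\<bar> \<le> 1 - \<rho>" if "(\<Sum>i<d. (b i)\<^sup>2) \<le> 1" "(\<Sum>i<d. (v i)\<^sup>2) \<le> (1 - \<rho>)\<^sup>2" for b v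
    using inner_prod_abs_le[of b d 1 v "1 - \<rho>"] that \<rho> by simp
  define u1 u2 w1 w2 where "u1 = inner_prod d a1 y" and "u2 = inner_prod d a2 y"
    and "w1 = inner_prod d a1 (\<lambda>i. x i - y i)" and "w2 = inner_prod d a2 (\<lambda>i. x i - y i)"
  have split: "inner_prod d b x = inner_prod d b y + inner_prod d b (\<lambda>i. x i - y i)" for b
    by (simp add: inner_prod_def right_diff_distrib sum_subtractf)
  have x12: "inner_prod d a1 x = u1 + w1" "inner_prod d a2 x = u2 + w2"
    unfolding u1_def u2_def w1_def w2_def by (rule split)+
  have u: "\<bar>u1\<bar> \<le> 1 - \<rho>" "\<bar>u2\<bar> \<le> 1 - \<rho>" "\<bar>u1 + w1\<bar> \<le> 1 - \<rho>" "\<bar>u2 + w2\<bar> \<le> 1 - \<rho>"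
    unfolding x12[symmetric] unfolding u1_def u2_def by (rule ins; fact)+
  have rem: "2 * \<bar>w\<bar> powr (real s + \<beta>) / fact s \<le> 2 * \<delta> powr (real s + \<beta>) / fact s" if "\<bar>w\<bar> \<le> \<delta>" for w
    using that \<beta> by (intro divide_right_mono mult_left_mono powr_mono2) auto
  have T1: "\<bar>g1 (u1 + w1) - (\<Sum>j\<le>s. iterated_deriv j g1 u1 / fact j * w1 ^ j)\<bar> \<le> 2 * \<delta> powr (real s + \<beta>) / fact s"
    using holder_ball_taylor[OF g1 \<beta>, of u1 w1] rem[of w1] u \<delta>(1) pos unfolding w1_def by linarith
  have T2: "\<bar>g2 (u2 + w2) - (\<Sum>j\<le>s. iterated_deriv j g2 u2 / fact j * w2 ^ j)\<bar> \<le> 2 * \<delta> powr (real s + \<beta>) / fact s"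
    using holder_ball_taylor[OF g2 \<beta>, of u2 w2] rem[of w2] u \<delta>(2) pos unfolding w2_def by linarith
  define \<eta> where "\<eta> = 4 * (real s * \<tau>) powr \<beta>"
  have terms: "\<bar>iterated_deriv j g1 u1 * w1 ^ j - iterated_deriv j g2 u2 * w2 ^ j\<bar> \<le> real d ^ j * \<eta>"
    if j: "j \<le> s" for j
    unfolding w1_def w2_def
  proof (rule power_forms_close[OF _ z])
    fix I :: "nat list" assume I: "length I = j" "set I \<subseteq> {..<d}"
    have "\<bar>iterated_deriv (length I) g1 (inner_prod d a1 y) * prod_list (map a1 I)
      - iterated_deriv (length I) g2 (inner_prod d a2 y) * prod_list (map a2 I)\<bar> \<le> 4 * (real s * \<tau>) powr \<beta>"
      using I j u \<tau> sum_squares_le_one_imp_abs_le_one[OF a(1)] sum_squares_le_one_imp_abs_le_one[OF a(2)]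
      by (intro ridge_derivatives_close[OF g1 g2 \<beta>] agree) (auto simp: u1_def u2_def)
    then show "\<bar>iterated_deriv j g1 u1 * prod_list (map a1 I) - iterated_deriv j g2 u2 * prod_list (map a2 I)\<bar> \<le> \<eta>"
      by (simp only: I u1_def u2_def \<eta>_def)
  qed
  have eq: "(\<Sum>j\<le>s. iterated_deriv j g1 u1 / fact j * w1 ^ j) - (\<Sum>j\<le>s. iterated_deriv j g2 u2 / fact j * w2 ^ j)
      = (\<Sum>j\<le>s. (iterated_deriv j g1 u1 * w1 ^ j - iterated_deriv j g2 u2 * w2 ^ j) / fact j)"
    by (simp add: sum_subtractf[symmetric] diff_divide_distrib)
  have "\<bar>(\<Sum>j\<le>s. iterated_deriv j g1 u1 / fact j * w1 ^ j) - (\<Sum>j\<le>s. iterated_deriv j g2 u2 / fact j * w2 ^ j)\<bar>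
      \<le> (\<Sum>j\<le>s. \<bar>(iterated_deriv j g1 u1 * w1 ^ j - iterated_deriv j g2 u2 * w2 ^ j) / fact j\<bar>)"
    unfolding eq by (rule sum_abs)
  also have "\<dots> \<le> (\<Sum>j\<le>s. real d ^ j * \<eta> / fact j)"
    using terms by (intro sum_mono) (simp add: divide_right_mono)
  also have "\<dots> = (\<Sum>j\<le>s. real d ^ j / fact j) * \<eta>" by (simp add: sum_distrib_right)
  finally show ?thesis using T1 T2 unfolding x12 \<eta>_def by (simp add: abs_le_iff)
qed

lemma zero_mem_ridge_class:
  assumes "0 < \<beta>" "\<beta> \<le> 1" "0 < p"
  shows "(\<lambda>x\<in>Omega d. 0) \<in> ridge_class (ereal (real s + \<beta>)) p d"
proof -
  have "p_norm d p (restrict (\<lambda>_. 0) {..<d}) \<le> 1" using assms by (simp add: p_norm_le_one_iff)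
  then show ?thesis
    unfolding ridge_class_def smooth_ball_eq_holder_ball[OF assms(1,2)]
    using zero_mem_holder_ball by (intro CollectI exI[of _ "\<lambda>_. 0"] exI[of _ "restrict (\<lambda>_. 0) {..<d}"])
      (auto simp: vectors_def)
qed

text \<open>The sample points are $y + \tau v$ where \<open>y\<close> runs through the points of the net in the ball of radius
$1-\rho$ and \<open>v\<close> through the sums of at most \<open>s\<close> unit vectors. These points must stay in the ball, therefore the argument is applied to
$(1-\rho)x$ instead of \<open>x\<close>; this and the finite step $\tau$ contribute to \<open>e\<close>, but not to the number of
points.\<close>

lemma info_complexity_ridge_le_net:
  assumes \<beta>: "0 < \<beta>" "\<beta> \<le> 1" and p: "0 < p" "p \<le> 2" and d: "1 \<le> d" and e: "0 < e" and "0 \<le> \<delta>"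
    and Y: "finite Y" "solid_net p d \<delta> Y"
  shows "info_complexity (ridge_class (ereal (real s + \<beta>)) p) (4 * \<delta> powr (real s + \<beta>) / fact s + e) d
    \<le> enat (card Y * (d + 1) ^ s)"
proof -
  define F where "F = ridge_class (ereal (real s + \<beta>)) p"
  define M where "M = (\<Sum>j\<le>s. real d ^ j / fact j)"
  have "0 < (\<Sum>j\<in>{0}. real d ^ j / fact j)" by simp
  also have "\<dots> \<le> M" unfolding M_def by (intro sum_mono2) auto
  finally have M: "0 < M" .
  obtain \<rho> where \<rho>: "0 < \<rho>" "\<rho> < 1" "4 * \<rho> powr \<beta> \<le> e / 2"
    by (rule small_radius[of \<beta> 1 "e / 2" 4]) (use \<beta> e in auto)
  obtain r where r: "0 < r" "r < \<rho>" "4 * M * r powr \<beta> \<le> e / 2"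
    by (rule small_radius[of \<beta> \<rho> "e / 2" "4 * M"]) (use \<beta> e \<rho> M in auto)
  \<comment> \<open>The denominator makes $s\tau \le r$ while $\tau$ stays defined for $s = 0$.\<close>
  define \<tau> where "\<tau> = r / (real s + 1)"
  have \<tau>: "0 < \<tau>" "real s * \<tau> \<le> r" using r by (auto simp: \<tau>_def divide_le_eq algebra_simps)
  define V where "V = step_sums (pos_steps d) s"
  define Y' where "Y' = {y\<in>Y. (\<Sum>i<d. (y i)\<^sup>2) \<le> (1 - \<rho>)\<^sup>2}"
  define pt where "pt = (\<lambda>(y, v). restrict (\<lambda>i. y i + \<tau> * v i :: real) {..<d})"
  define X where "X = pt ` (Y' \<times> V)"
  have fin: "finite Y'" "finite V"
    using Y(1) finite_step_sums[OF finite_steps(1)] by (auto simp: Y'_def V_def)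
  have net: "\<exists>y\<in>Y'. (\<forall>i<d. \<bar>x i - y i\<bar> \<le> 1) \<and> (\<forall>a. p_norm d p a \<le> 1 \<longrightarrow> \<bar>inner_prod d a (\<lambda>i. x i - y i)\<bar> \<le> \<delta>)"
    if x: "(\<Sum>i<d. (x i)\<^sup>2) \<le> (1 - \<rho>)\<^sup>2" for x
  proof -
    have "(1 - \<rho>)\<^sup>2 \<le> 1" using \<rho> by (intro power_le_one) auto
    with x have "(\<Sum>i<d. (x i)\<^sup>2) \<le> 1" by linarith
    then obtain y where y: "y \<in> Y" "\<forall>i<d. \<bar>y i\<bar> \<le> \<bar>x i\<bar> \<and> \<bar>x i - y i\<bar> \<le> 1"
        "\<forall>a. p_norm d p a \<le> 1 \<longrightarrow> \<bar>inner_prod d a (\<lambda>i. x i - y i)\<bar> \<le> \<delta>"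
      using Y(2) unfolding solid_net_def by blast
    have "(\<Sum>i<d. (y i)\<^sup>2) \<le> (\<Sum>i<d. (x i)\<^sup>2)"
      using y(2) by (intro sum_mono) (simp add: abs_le_square_iff)
    then have "y \<in> Y'" using x y(1) by (simp add: Y'_def)
    then show ?thesis using y by blast
  qed
  have "X \<noteq> {}"
  proof -
    have "V \<noteq> {}" using step_sums_mono[of "pos_steps d" 0 s] by (auto simp: V_def pos_steps_def)
    moreover have "Y' \<noteq> {}" using net[of "\<lambda>_. 0"] by auto
    ultimately show ?thesis by (simp add: X_def)
  qed
  have "X \<subseteq> Omega d"
  proof
    fix w assume "w \<in> X"
    then obtain y v where w: "w = pt (y, v)" "y \<in> Y'" "v \<in> V" by (auto simp: X_def)
    have "L2_set (\<lambda>i. y i + \<tau> * v i) {..<d} \<le> L2_set y {..<d} + L2_set (\<lambda>i. \<tau> * v i) {..<d}"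
      by (rule L2_set_triangle_ineq)
    also have "L2_set (\<lambda>i. \<tau> * v i) {..<d} = \<tau> * L2_set v {..<d}"
      using \<tau>(1) by (simp add: L2_set_right_distrib)
    also have "\<tau> * L2_set v {..<d} \<le> \<tau> * real s"
      using \<tau>(1) L2_step_sums_le w(3) by (intro mult_left_mono) (auto simp: V_def)
    also have "L2_set y {..<d} \<le> 1 - \<rho>"
      using w(2) \<rho> by (auto simp: Y'_def L2_set_def intro: real_le_lsqrt)
    finally have "L2_set (\<lambda>i. y i + \<tau> * v i) {..<d} \<le> 1"
      using \<tau>(2) r(2) by (simp add: mult.commute)
    then show "w \<in> Omega d" by (simp add: w(1) pt_def restrict_mem_Omega_iff L2_set_def)
  qed
  have "card X \<le> card Y * (d + 1) ^ s"
  proof -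
    have "card X \<le> card Y' * card V"
      unfolding X_def using fin card_image_le[of "Y' \<times> V" pt] by (simp add: card_cartesian_product)
    also have "\<dots> \<le> card Y * (d + 1) ^ s"
    proof (rule mult_mono)
      show "card Y' \<le> card Y" using Y(1) by (intro card_mono) (auto simp: Y'_def)
      have "card V \<le> card (pos_steps d) ^ s" unfolding V_def by (rule card_step_sums[OF finite_steps(1)])
      also have "\<dots> \<le> (d + 1) ^ s" by (intro power_mono card_pos_steps) auto
      finally show "card V \<le> (d + 1) ^ s" .
    qed auto
    finally show ?thesis .
  qed
  have close: "\<bar>f1 x - f2 x\<bar> \<le> 4 * \<delta> powr (real s + \<beta>) / fact s + e"
    if f: "f1 \<in> F d" "f2 \<in> F d" and agree: "\<And>x. x \<in> X \<Longrightarrow> f1 x = f2 x" and x: "x \<in> Omega d" for f1 f2 x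
  proof -
    obtain g1 a1 where 1: "g1 \<in> holder_ball s \<beta>" "p_norm d p a1 \<le> 1" "f1 = (\<lambda>x\<in>Omega d. g1 (inner_prod d a1 x))"
      using f(1) unfolding F_def ridge_class_def smooth_ball_eq_holder_ball[OF \<beta>] by blast
    obtain g2 a2 where 2: "g2 \<in> holder_ball s \<beta>" "p_norm d p a2 \<le> 1" "f2 = (\<lambda>x\<in>Omega d. g2 (inner_prod d a2 x))"
      using f(2) unfolding F_def ridge_class_def smooth_ball_eq_holder_ball[OF \<beta>] by blast
    have a: "(\<Sum>i<d. (a1 i)\<^sup>2) \<le> 1" "(\<Sum>i<d. (a2 i)\<^sup>2) \<le> 1"
      using 1(2) 2(2) p_norm_le_one_imp_sum_squares[OF p] by auto
    define x' where "x' = (\<lambda>i. (1 - \<rho>) * x i)"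
    have "(\<Sum>i<d. (x' i)\<^sup>2) = (1 - \<rho>)\<^sup>2 * (\<Sum>i<d. (x i)\<^sup>2)"
      by (simp add: x'_def power_mult_distrib sum_distrib_left)
    also have "\<dots> \<le> (1 - \<rho>)\<^sup>2 * 1" using x by (intro mult_left_mono) (auto simp: mem_Omega_iff)
    finally have x': "(\<Sum>i<d. (x' i)\<^sup>2) \<le> (1 - \<rho>)\<^sup>2" by simp
    obtain y where y: "y \<in> Y'" "\<And>i. i < d \<Longrightarrow> \<bar>x' i - y i\<bar> \<le> 1"
        "\<And>a. p_norm d p a \<le> 1 \<Longrightarrow> \<bar>inner_prod d a (\<lambda>i. x' i - y i)\<bar> \<le> \<delta>"
      using net[OF x'] by blast
    have "g1 (inner_prod d a1 (\<lambda>i. y i + \<tau> * v i)) = g2 (inner_prod d a2 (\<lambda>i. y i + \<tau> * v i))"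
      if "v \<in> step_sums (pos_steps d) s" for v
    proof -
      have "pt (y, v) \<in> X" using that y(1) by (auto simp: X_def V_def)
      with agree[OF this] \<open>X \<subseteq> Omega d\<close> show ?thesis
        by (auto simp: 1(3) 2(3) pt_def inner_prod_restrict)
    qed
    then have "\<bar>g1 (inner_prod d a1 x') - g2 (inner_prod d a2 x')\<bar>
        \<le> 4 * \<delta> powr (real s + \<beta>) / fact s + M * (4 * (real s * \<tau>) powr \<beta>)"
      unfolding M_def using a \<tau> r \<rho> x' y 1(2) 2(2)
      by (intro ridge_functions_close[OF 1(1) 2(1) \<beta>, where y=y and \<rho>=\<rho>]) (auto simp: Y'_def)
    also have "M * (4 * (real s * \<tau>) powr \<beta>) \<le> M * (4 * r powr \<beta>)"
      using M \<tau> \<beta> r by (intro mult_left_mono powr_mono2) auto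
    also have "\<dots> \<le> e / 2" using r(3) by (simp add: mult_ac)
    finally have inner: "\<bar>g1 (inner_prod d a1 x') - g2 (inner_prod d a2 x')\<bar> \<le> 4 * \<delta> powr (real s + \<beta>) / fact s + e / 2"
      by simp
    have shrink: "\<bar>g (inner_prod d b x) - g (inner_prod d b x')\<bar> \<le> 2 * \<rho> powr \<beta>"
      if "g \<in> holder_ball s \<beta>" "p_norm d p b \<le> 1" for g b
    proof -
      have bx: "inner_prod d b x \<in> {-1..1}"
        using inner_prod_mem_interval[OF that(2) p, of x] x by (simp add: mem_Omega_iff)
      have bx': "inner_prod d b x' = (1 - \<rho>) * inner_prod d b x"
        by (simp add: x'_def inner_prod_def sum_distrib_left mult_ac)
      have "\<bar>inner_prod d b x'\<bar> \<le> 1 * 1"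
        unfolding bx' abs_mult using bx \<rho> by (intro mult_mono) auto
      then have "inner_prod d b x' \<in> {-1..1}" by (simp add: abs_le_iff)
      moreover have "inner_prod d b x - inner_prod d b x' = \<rho> * inner_prod d b x"
        by (simp add: bx' algebra_simps)
      then have "\<bar>inner_prod d b x - inner_prod d b x'\<bar> \<le> \<rho>"
        using bx \<rho> by (auto simp: abs_mult mult_left_le)
      ultimately show ?thesis
        using holder_ball_modulus[OF that(1) \<beta>, of 0 "inner_prod d b x" "inner_prod d b x'" \<rho>] bx \<rho> by auto
    qed
    have "f1 x = g1 (inner_prod d a1 x)" "f2 x = g2 (inner_prod d a2 x)" using x 1 2 by auto
    with inner shrink[OF 1(1,2)] shrink[OF 2(1,2)] \<rho>(3) show ?thesis by linarith
  qed
  show ?thesis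
  proof (rule info_complexity_le_card[OF _ \<open>X \<noteq> {}\<close> \<open>X \<subseteq> Omega d\<close> \<open>card X \<le> card Y * (d + 1) ^ s\<close>])
    show "finite X" using fin by (simp add: X_def)
    have "0 < real s + \<beta>" using \<beta> by simp
    then show "ridge_class (ereal (real s + \<beta>)) p d \<subseteq> Linf d"
      by (intro ridge_class_subset_Linf p) simp
    show "0 \<le> 4 * \<delta> powr (real s + \<beta>) / fact s + e" using e by simp
  next
    fix f1 f2 x assume "f1 \<in> ridge_class (ereal (real s + \<beta>)) p d" "f2 \<in> ridge_class (ereal (real s + \<beta>)) p d"
      "\<And>x. x \<in> X \<Longrightarrow> f1 x = f2 x" "x \<in> Omega d"
    then show "\<bar>f1 x - f2 x\<bar> \<le> 4 * \<delta> powr (real s + \<beta>) / fact s + e"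
      using close[of f1 f2 x] by (simp add: F_def)
  next
    fix f x assume "f \<in> ridge_class (ereal (real s + \<beta>)) p d" "\<And>x. x \<in> X \<Longrightarrow> f x = 0" "x \<in> Omega d"
    moreover from this \<open>X \<subseteq> Omega d\<close> have "f x = (\<lambda>x\<in>Omega d. 0) x" if "x \<in> X" for x
      using that by auto
    ultimately show "\<bar>f x\<bar> \<le> 4 * \<delta> powr (real s + \<beta>) / fact s + e"
      using close[of f "\<lambda>x\<in>Omega d. 0" x] zero_mem_ridge_class[OF \<beta> p(1)] by (simp add: F_def)
  qed
qed

section \<open>Two nets of the Euclidean ball\<close>

text \<open>The net for $\alpha = \infty$, where smoothness alone makes the Taylor polynomial at the origin
accurate on the whole ball.\<close>

lemma solid_net_origin:
  assumes "0 < p" "p \<le> 2"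
  shows "solid_net p d 1 {\<lambda>_. 0}"
  unfolding solid_net_def
proof (intro allI impI)
  fix x :: rvec assume x: "(\<Sum>i<d. (x i)\<^sup>2) \<le> 1"
  have "\<bar>inner_prod d a x\<bar> \<le> 1" if "p_norm d p a \<le> 1" for a
    using inner_prod_mem_interval[OF that assms x] by (simp add: abs_le_iff)
  then show "\<exists>y\<in>{\<lambda>_. 0}. (\<forall>i<d. \<bar>y i\<bar> \<le> \<bar>x i\<bar> \<and> \<bar>x i - y i\<bar> \<le> 1) \<and>
      (\<forall>a. p_norm d p a \<le> 1 \<longrightarrow> \<bar>inner_prod d a (\<lambda>i. x i - y i)\<bar> \<le> 1)"
    using sum_squares_le_one_imp_abs_le_one[OF x] by simp
qed

text \<open>Counts the integer vectors of $\ell_1$-norm at most \<open>k\<close>: they are sums of \<open>k\<close> signed unit vectors or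
zeros, so there are at most $(2d+1)^k$ of them.\<close>

lemma integer_vector_mem_step_sums:
  fixes m :: "nat \<Rightarrow> int"
  assumes "\<And>i. d \<le> i \<Longrightarrow> m i = 0" "(\<Sum>i<d. \<bar>m i\<bar>) \<le> int k"
  shows "(\<lambda>i. real_of_int (m i)) \<in> step_sums (all_steps d) k"
  using assms
proof (induction k arbitrary: m)
  case 0
  have "m i = 0" for i
  proof (cases "i < d")
    case True
    then have "\<bar>m i\<bar> \<le> (\<Sum>i<d. \<bar>m i\<bar>)" by (intro member_le_sum) auto
    then show ?thesis using 0 by simp
  qed (use 0 in simp)
  then show ?case by simp
next
  case (Suc k)
  show ?case
  proof (cases "\<exists>i<d. m i \<noteq> 0")
    case False
    then have "m i = 0" for i using Suc.prems(1)[of i] by (cases "i < d") auto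
    then have "(\<lambda>i. real_of_int (m i)) \<in> step_sums (all_steps d) 0" by simp
    then show ?thesis using step_sums_mono[of "all_steps d" 0 "Suc k"] by (auto simp: all_steps_def)
  next
    case True
    then obtain i where i: "i < d" "m i \<noteq> 0" by blast
    \<comment> \<open>One step towards $0$ in a nonzero coordinate lowers the $\ell_1$-norm by one.\<close>
    define m' where "m' = m(i := m i - sgn (m i))"
    have "(\<Sum>j<d. \<bar>m j\<bar>) = \<bar>m i\<bar> + (\<Sum>j\<in>{..<d} - {i}. \<bar>m j\<bar>)" using i by (intro sum.remove) auto
    moreover have "(\<Sum>j<d. \<bar>m' j\<bar>) = \<bar>m' i\<bar> + (\<Sum>j\<in>{..<d} - {i}. \<bar>m' j\<bar>)" using i by (intro sum.remove) auto
    moreover have "(\<Sum>j\<in>{..<d} - {i}. \<bar>m' j\<bar>) = (\<Sum>j\<in>{..<d} - {i}. \<bar>m j\<bar>)"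
      by (intro sum.cong) (auto simp: m'_def)
    moreover have "\<bar>m' i\<bar> = \<bar>m i\<bar> - 1" using i(2) by (auto simp: m'_def sgn_if)
    ultimately have "(\<Sum>j<d. \<bar>m' j\<bar>) \<le> int k" using Suc.prems(2) by simp
    then have IH: "(\<lambda>j. real_of_int (m' j)) \<in> step_sums (all_steps d) k"
      using Suc.prems(1) i by (intro Suc.IH) (auto simp: m'_def)
    define e where "e = (\<lambda>j. real_of_int (sgn (m i)) * unit_vec i j)"
    have "e = unit_vec i \<or> e = (\<lambda>j. - unit_vec i j)" using i(2) by (auto simp: e_def sgn_if)
    then have "e \<in> all_steps d" using i(1) by (auto simp: all_steps_def)
    from step_sums_SucI[OF IH this] have "(\<lambda>j. real_of_int (m' j) + e j) \<in> step_sums (all_steps d) (Suc k)" .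
    moreover have "(\<lambda>j. real_of_int (m' j) + e j) = (\<lambda>j. real_of_int (m j))"
      by (auto simp: m'_def e_def unit_vec_def)
    ultimately show ?thesis by (simp only:)
  qed
qed

text \<open>Replaces Hoelder's inequality and an interpolation between $\ell_2$ and $\ell_\infty$ by an
inequality for single coordinates, which after summation bounds $|a \cdot z|$ by
$2h^{2/p-1}$ if $\|a\|_p \le 1$, $\|z\|_2 \le 1$ and $\|z\|_\infty \le h$. The case distinction is
according to which of $|a|^p$ and $z^2$ is larger.\<close>

lemma mult_le_interpolation:
  fixes a z p h :: real
  assumes "1 \<le> p" "p < 2" "\<bar>z\<bar> \<le> h"
  shows "\<bar>a\<bar> * \<bar>z\<bar> \<le> h powr (2 / p - 1) * (\<bar>a\<bar> powr p + z\<^sup>2)"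
proof (cases "z = 0 \<or> a = 0")
  case True
  then show ?thesis using assms by auto
next
  case False
  then have pos: "0 < \<bar>z\<bar>" "0 < \<bar>a\<bar>" by auto
  have gap: "0 < 2 / p - 1" using assms by simp
  have h: "\<bar>z\<bar> powr (2 / p - 1) \<le> h powr (2 / p - 1)" using assms gap by (intro powr_mono2) auto
  have "\<bar>a\<bar> * \<bar>z\<bar> \<le> \<bar>z\<bar> powr (2 / p - 1) * (\<bar>a\<bar> powr p + z\<^sup>2)"
  proof (cases "\<bar>z\<bar> powr (2 / p) \<le> \<bar>a\<bar>")
    case True
    have "\<bar>z\<bar> powr (2 / p * (p - 1)) \<le> \<bar>a\<bar> powr (p - 1)"
      unfolding powr_powr[symmetric] using True assms by (intro powr_mono2) auto
    moreover have "2 / p * (p - 1) = 1 - (2 / p - 1)" using assms by (simp add: field_simps)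
    ultimately have "\<bar>z\<bar> powr (2 / p - 1) * \<bar>z\<bar> powr (1 - (2 / p - 1)) \<le> \<bar>z\<bar> powr (2 / p - 1) * \<bar>a\<bar> powr (p - 1)"
      by (intro mult_left_mono) auto
    then have "\<bar>z\<bar> \<le> \<bar>z\<bar> powr (2 / p - 1) * \<bar>a\<bar> powr (p - 1)"
      using pos by (simp flip: powr_add)
    then have "\<bar>a\<bar> * \<bar>z\<bar> \<le> \<bar>a\<bar> * (\<bar>z\<bar> powr (2 / p - 1) * \<bar>a\<bar> powr (p - 1))"
      by (intro mult_left_mono) auto
    also have "\<dots> = \<bar>z\<bar> powr (2 / p - 1) * \<bar>a\<bar> powr p"
      using pos powr_add[of "\<bar>a\<bar>" 1 "p - 1"] by simp
    also have "\<dots> \<le> \<bar>z\<bar> powr (2 / p - 1) * (\<bar>a\<bar> powr p + z\<^sup>2)"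
      by (intro mult_left_mono) auto
    finally show ?thesis .
  next
    case False
    then have "\<bar>a\<bar> * \<bar>z\<bar> \<le> \<bar>z\<bar> powr (2 / p) * \<bar>z\<bar>" by (intro mult_right_mono) auto
    also have "\<dots> = \<bar>z\<bar> powr (2 / p - 1) * (\<bar>z\<bar> * \<bar>z\<bar>)"
      using pos powr_add[of "\<bar>z\<bar>" "2 / p - 1" 1] by simp
    also have "\<dots> \<le> \<bar>z\<bar> powr (2 / p - 1) * (\<bar>a\<bar> powr p + z\<^sup>2)"
      by (intro mult_left_mono) (auto simp: power2_eq_square)
    finally show ?thesis .
  qed
  also have "\<dots> \<le> h powr (2 / p - 1) * (\<bar>a\<bar> powr p + z\<^sup>2)" using h by (intro mult_right_mono) auto
  finally show ?thesis .
qed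

definition grid_net :: "nat \<Rightarrow> nat \<Rightarrow> rvec set" where
  "grid_net d K = (\<lambda>m i. m i / sqrt (real K)) ` step_sums (all_steps d) K"

lemma finite_grid_net: "finite (grid_net d K)"
  unfolding grid_net_def using finite_step_sums[OF finite_steps(2)] by blast

lemma card_grid_net: "card (grid_net d K) \<le> (2 * d + 1) ^ K"
proof -
  have "card (grid_net d K) \<le> card (step_sums (all_steps d) K)"
    unfolding grid_net_def by (rule card_image_le[OF finite_step_sums[OF finite_steps(2)]])
  also have "\<dots> \<le> card (all_steps d) ^ K" by (rule card_step_sums[OF finite_steps(2)])
  also have "\<dots> \<le> (2 * d + 1) ^ K" by (intro power_mono card_all_steps) auto
  finally show ?thesis .
qed

text \<open>Rounding the coordinates towards $0$ to multiples of $K^{-1/2}$ maps the ball to $K^{-1/2}$ times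
integer vectors of $\ell_2$-norm at most $K^{1/2}$. Since $|m| \le m^2$ for integers, their
$\ell_1$-norm is at most \<open>K\<close>.\<close>

lemma solid_net_grid:
  assumes p: "1 \<le> p" "p < 2" and K: "1 \<le> K"
  shows "solid_net p d (2 * real K powr (1/2 - 1/p)) (grid_net d K)"
  unfolding solid_net_def
proof (intro allI impI)
  fix x :: rvec assume x: "(\<Sum>i<d. (x i)\<^sup>2) \<le> 1"
  define R where "R = sqrt (real K)"
  have R: "1 \<le> R" "R\<^sup>2 = real K" using K by (simp_all add: R_def)
  define n where "n i = \<lfloor>R * \<bar>x i\<bar>\<rfloor>" for i
  have n: "0 \<le> n i" "real_of_int (n i) \<le> R * \<bar>x i\<bar>" "R * \<bar>x i\<bar> \<le> real_of_int (n i) + 1" for i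
    using R by (auto simp: n_def)
  define m where "m i = (if i < d then (if 0 \<le> x i then n i else - n i) else 0)" for i
  have absm: "\<bar>m i\<bar> = n i" if "i < d" for i using n[of i] that by (simp add: m_def)
  have "real_of_int (\<Sum>i<d. \<bar>m i\<bar>) \<le> (\<Sum>i<d. (R * \<bar>x i\<bar>)\<^sup>2)"
    unfolding of_int_sum
  proof (rule sum_mono)
    fix i assume "i \<in> {..<d}"
    have "n i \<le> n i * n i" using n(1)[of i] by (cases "n i = 0") (auto simp: mult_le_cancel_left1)
    then have "real_of_int (n i) \<le> (real_of_int (n i))\<^sup>2"
      unfolding power2_eq_square by (simp flip: of_int_mult)
    also have "\<dots> \<le> (R * \<bar>x i\<bar>)\<^sup>2" using n[of i] by (intro power_mono) auto
    finally show "real_of_int \<bar>m i\<bar> \<le> (R * \<bar>x i\<bar>)\<^sup>2" using absm \<open>i \<in> {..<d}\<close> by simp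
  qed
  also have "\<dots> = real K * (\<Sum>i<d. (x i)\<^sup>2)" by (simp add: power_mult_distrib R sum_distrib_left)
  also have "\<dots> \<le> real K * 1" using x by (intro mult_left_mono) auto
  finally have "(\<Sum>i<d. \<bar>m i\<bar>) \<le> int K" by linarith
  then have mem: "(\<lambda>i. real_of_int (m i)) \<in> step_sums (all_steps d) K"
    by (intro integer_vector_mem_step_sums) (auto simp: m_def)
  define y where "y = (\<lambda>i. real_of_int (m i) / R)"
  have "y \<in> grid_net d K"
    unfolding grid_net_def by (rule image_eqI[OF _ mem]) (simp add: y_def R_def)
  have ny: "real_of_int (n i) / R \<le> \<bar>x i\<bar>" "\<bar>x i\<bar> - real_of_int (n i) / R \<le> 1 / R" for i
  proof -
    show "real_of_int (n i) / R \<le> \<bar>x i\<bar>" using n[of i] R by (simp add: pos_divide_le_eq mult.commute)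
    have "\<bar>x i\<bar> \<le> (real_of_int (n i) + 1) / R" using n[of i] R by (simp add: pos_le_divide_eq mult.commute)
    then show "\<bar>x i\<bar> - real_of_int (n i) / R \<le> 1 / R" by (simp add: add_divide_distrib)
  qed
  have y_le: "\<bar>y i\<bar> \<le> \<bar>x i\<bar>" and z: "\<bar>x i - y i\<bar> \<le> \<bar>x i\<bar>" "\<bar>x i - y i\<bar> \<le> 1 / R" if "i < d" for i
  proof -
    have "0 \<le> real_of_int (n i) / R" using n(1)[of i] R by simp
    then show "\<bar>y i\<bar> \<le> \<bar>x i\<bar>" "\<bar>x i - y i\<bar> \<le> \<bar>x i\<bar>" "\<bar>x i - y i\<bar> \<le> 1 / R"
      using ny[of i] that by (auto simp: y_def m_def split: if_splits)
  qed
  have "\<bar>inner_prod d a (\<lambda>i. x i - y i)\<bar> \<le> 2 * real K powr (1/2 - 1/p)" if a: "p_norm d p a \<le> 1" for a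
  proof -
    have "\<bar>inner_prod d a (\<lambda>i. x i - y i)\<bar> \<le> (\<Sum>i<d. \<bar>a i\<bar> * \<bar>x i - y i\<bar>)"
      unfolding inner_prod_def abs_mult[symmetric] by (rule sum_abs)
    also have "\<dots> \<le> (\<Sum>i<d. (1 / R) powr (2 / p - 1) * (\<bar>a i\<bar> powr p + (x i - y i)\<^sup>2))"
      using z(2) by (intro sum_mono mult_le_interpolation p) auto
    also have "\<dots> = (1 / R) powr (2 / p - 1) * ((\<Sum>i<d. \<bar>a i\<bar> powr p) + (\<Sum>i<d. (x i - y i)\<^sup>2))"
      by (simp only: sum_distrib_left[symmetric] sum.distrib)
    also have "\<dots> \<le> (1 / R) powr (2 / p - 1) * (1 + 1)"
    proof (intro mult_left_mono add_mono)
      show "(\<Sum>i<d. \<bar>a i\<bar> powr p) \<le> 1" using a p by (simp add: p_norm_le_one_iff)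
      have "(\<Sum>i<d. (x i - y i)\<^sup>2) \<le> (\<Sum>i<d. (x i)\<^sup>2)"
        using z(1) by (intro sum_mono) (simp add: abs_le_square_iff)
      then show "(\<Sum>i<d. (x i - y i)\<^sup>2) \<le> 1" using x by linarith
    qed auto
    also have "(1 / R) powr (2 / p - 1) = real K powr (1/2 - 1/p)"
    proof -
      have "1 / R = real K powr (- (1/2))"
        using K by (simp add: R_def powr_minus_divide powr_half_sqrt)
      then show ?thesis by (simp add: powr_powr algebra_simps diff_divide_distrib)
    qed
    finally show ?thesis by simp
  qed
  moreover have "\<bar>x i - y i\<bar> \<le> 1" if "i < d" for i
    using z(1)[OF that] sum_squares_le_one_imp_abs_le_one[OF x that] by linarith
  ultimately show "\<exists>y\<in>grid_net d K. (\<forall>i<d. \<bar>y i\<bar> \<le> \<bar>x i\<bar> \<and> \<bar>x i - y i\<bar> \<le> 1) \<and>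
      (\<forall>a. p_norm d p a \<le> 1 \<longrightarrow> \<bar>inner_prod d a (\<lambda>i. x i - y i)\<bar> \<le> 2 * real K powr (1/2 - 1/p))"
    using \<open>y \<in> grid_net d K\<close> y_le by blast
qed

section \<open>Tractability of the full classes\<close>

lemma info_complexity_antimono:
  assumes "\<epsilon> \<le> \<epsilon>'"
  shows "info_complexity F \<epsilon>' d \<le> info_complexity F \<epsilon> d"
  unfolding info_complexity_def
proof (rule Inf_superset_mono, safe)
  fix n assume "1 \<le> n" "g_ada n d (F d) \<le> ennreal \<epsilon>"
  then show "\<exists>n'. enat n = enat n' \<and> 1 \<le> n' \<and> g_ada n' d (F d) \<le> ennreal \<epsilon>'"
    using order_trans[OF _ ennreal_leI[OF assms]] by blast
qed

lemma info_complexity_mono_class: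
  assumes "F d \<subseteq> G d"
  shows "info_complexity F \<epsilon> d \<le> info_complexity G \<epsilon> d"
  unfolding info_complexity_def
  using order_trans[OF g_ada_mono[OF assms]] by (intro Inf_superset_mono) blast

text \<open>For $p < 1$ the class is enlarged to the one with $p = 1$; this is the origin of the maximum.\<close>

lemma info_complexity_ridge_le_grid:
  assumes \<beta>: "0 < \<beta>" "\<beta> \<le> 1" and \<alpha>: "ereal (real s + \<beta>) \<le> \<alpha>" and p: "0 < p" "p < 2"
    and d: "1 \<le> d" and K: "1 \<le> K"
    and \<epsilon>: "4 * (2 * real K powr (1/2 - 1/max 1 p)) powr (real s + \<beta>) < \<epsilon>"
  shows "info_complexity (ridge_class \<alpha> p) \<epsilon> d \<le> enat ((2 * d + 1) ^ K * (d + 1) ^ s)"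
proof -
  define \<delta> where "\<delta> = 2 * real K powr (1/2 - 1/max 1 p)"
  define e where "e = \<epsilon> - 4 * \<delta> powr (real s + \<beta>)"
  have e: "0 < e" using \<epsilon> by (simp add: e_def \<delta>_def)
  have "ridge_class \<alpha> p d \<subseteq> ridge_class (ereal (real s + \<beta>)) (max 1 p) d"
    using \<alpha> p \<beta> by (intro ridge_class_mono) auto
  then have "info_complexity (ridge_class \<alpha> p) \<epsilon> d
      \<le> info_complexity (ridge_class (ereal (real s + \<beta>)) (max 1 p)) \<epsilon> d"
    by (rule info_complexity_mono_class)
  also have "\<dots> \<le> info_complexity (ridge_class (ereal (real s + \<beta>)) (max 1 p))
      (4 * \<delta> powr (real s + \<beta>) / fact s + e) d"
  proof (rule info_complexity_antimono)
    have "4 * \<delta> powr (real s + \<beta>) / fact s \<le> 4 * \<delta> powr (real s + \<beta>) / 1"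
      by (intro divide_left_mono) (auto simp: fact_ge_1)
    then show "4 * \<delta> powr (real s + \<beta>) / fact s + e \<le> \<epsilon>" by (simp add: e_def)
  qed
  also have "\<dots> \<le> enat (card (grid_net d K) * (d + 1) ^ s)"
    unfolding \<delta>_def using p d e
    by (intro info_complexity_ridge_le_net \<beta> finite_grid_net solid_net_grid K) auto
  also have "\<dots> \<le> enat ((2 * d + 1) ^ K * (d + 1) ^ s)"
    using card_grid_net[of d K] by (simp only: enat_ord_simps mult_le_mono1)
  finally show ?thesis .
qed

text \<open>For a fixed error the parameter \<open>K\<close> of the grid is fixed, and the number of points is polynomial in
\<open>d\<close>. The class is first enlarged to smoothness at most $1$, where no derivatives are sampled.\<close>

lemma not_curse_of_dimensionality_ridge:
  assumes "0 < \<alpha>" "0 < p" "p < 2"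
  shows "\<not> curse_of_dimensionality (ridge_class \<alpha> p)"
proof
  assume "curse_of_dimensionality (ridge_class \<alpha> p)"
  then obtain c \<epsilon> \<gamma> where c: "0 < c" "0 < \<epsilon>" "\<epsilon> \<le> 1" "0 < \<gamma>"
    and inf: "infinite {d. 1 \<le> d \<and> (\<forall>\<epsilon>'. 0 < \<epsilon>' \<and> \<epsilon>' \<le> \<epsilon> \<longrightarrow>
           ereal (c * (1 + \<gamma>) ^ d) \<le> ereal_of_enat (info_complexity (ridge_class \<alpha> p) \<epsilon>' d))}" (is "infinite ?D")
    unfolding curse_of_dimensionality_def by blast
  obtain \<beta> where \<beta>: "0 < \<beta>" "\<beta> \<le> 1" "ereal (real 0 + \<beta>) \<le> \<alpha>"
  proof (cases "\<alpha> \<le> 1")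
    case True
    with assms(1) obtain r where "\<alpha> = ereal r" "0 < r" "r \<le> 1" by (cases \<alpha>) auto
    then show ?thesis using that[of r] by simp
  next
    case False
    then have "ereal 1 \<le> \<alpha>" by (simp add: one_ereal_def)
    then show ?thesis using that[of 1] by simp
  qed
  define q where "q = 1 / max 1 p - 1 / 2"
  have q: "0 < q" using assms by (auto simp: q_def max_def field_simps)
  have "(\<lambda>K::nat. 4 * (2 * real K powr (- q)) powr (real 0 + \<beta>)) \<longlonglongrightarrow> 0"
    using q \<beta> by real_asymp
  then have "\<forall>\<^sub>F K::nat in sequentially. 4 * (2 * real K powr (- q)) powr (real 0 + \<beta>) < \<epsilon>"
    using c(2) by (rule order_tendstoD)
  then have "\<forall>\<^sub>F K::nat in sequentially. 4 * (2 * real K powr (- q)) powr (real 0 + \<beta>) < \<epsilon> \<and> 1 \<le> K"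
    using eventually_ge_at_top[of 1] by (rule eventually_conj)
  then obtain K :: nat where K: "4 * (2 * real K powr (- q)) powr (real 0 + \<beta>) < \<epsilon>" "1 \<le> K"
    using eventually_happens[of _ sequentially] by auto
  \<comment> \<open>Written as $e^{ld}$, the exponential is compared with the polynomial bound $(2d+1)^K$.\<close>
  define l where "l = ln (1 + \<gamma>)"
  have l: "0 < l" using c by (simp add: l_def)
  have "(\<lambda>d::nat. (2 * real d + 1) powr real K * exp (- l * real d)) \<longlonglongrightarrow> 0"
    using l by real_asymp
  then have "\<forall>\<^sub>F d::nat in sequentially. (2 * real d + 1) powr real K * exp (- l * real d) < c"
    using c(1) by (rule order_tendstoD)
  then obtain d0 where d0: "\<And>d. d0 \<le> d \<Longrightarrow> (2 * real d + 1) powr real K * exp (- l * real d) < c"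
    unfolding eventually_sequentially by blast
  have "?D \<subseteq> {..<d0}"
  proof
    fix d assume d: "d \<in> ?D"
    have "ereal (c * (1 + \<gamma>) ^ d) \<le> ereal_of_enat (info_complexity (ridge_class \<alpha> p) \<epsilon> d)"
      using d c by auto
    also have "\<dots> \<le> ereal_of_enat (enat ((2 * d + 1) ^ K * (d + 1) ^ 0))"
      unfolding ereal_of_enat_le_iff using d K \<beta> assms
      by (intro info_complexity_ridge_le_grid[of \<beta>]) (auto simp: q_def)
    finally have "c * (1 + \<gamma>) ^ d \<le> (2 * real d + 1) ^ K" by (simp add: algebra_simps)
    also have "(1 + \<gamma>) ^ d = exp (l * real d)"
      using c(4) by (simp add: l_def mult.commute exp_of_nat_mult)
    also have "(2 * real d + 1) ^ K = (2 * real d + 1) powr real K" by (simp add: powr_realpow)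
    finally have "c \<le> (2 * real d + 1) powr real K * exp (- l * real d)"
      by (simp add: exp_minus field_simps)
    then have "\<not> d0 \<le> d" using d0[of d] by linarith
    then show "d \<in> {..<d0}" by simp
  qed
  then show False using inf finite_subset by blast
qed

lemma ln_enat_le:
  assumes "n \<le> enat N" "1 \<le> N"
  shows "ln_enat n \<le> ereal (ln (real N))"
proof -
  obtain k where k: "n = enat k" "k \<le> N" using assms(1) by (cases n) auto
  then have "ln (real k) \<le> ln (real N)" using assms(2) by (cases "k = 0") auto
  then show ?thesis by (simp add: ln_enat_def k)
qed

lemma ln_enat_nonneg: "0 \<le> ln_enat n"
proof (cases n)
  case (enat k)
  then show ?thesis by (cases "k = 0") (auto simp: ln_enat_def)
qed (simp add: ln_enat_def)

text \<open>The error $\varepsilon$ is reached with $K$ of order $\varepsilon^{-\theta}$ for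
$\theta = 1/(q\alpha) < 1$, where $q = 1/\max\{1,p\} - 1/2$. The logarithm of the number of points is of
order $K \ln d$, hence at most of order $T^\theta \ln T = o(T)$ in terms of
$T = 1/\varepsilon + d$.\<close>

lemma weakly_tractable_ridge:
  assumes "0 < p" "p < 2" "ereal (1 / (1 / max 1 p - 1 / 2)) < \<alpha>"
  shows "weakly_tractable (ridge_class \<alpha> p)"
proof -
  define q where "q = 1 / max 1 p - 1 / 2"
  have q: "0 < q" using assms by (auto simp: q_def max_def field_simps)
  obtain r where r: "ereal r \<le> \<alpha>" "1 / q < r"
  proof (cases \<alpha>)
    case PInf
    then show ?thesis using that[of "1 / q + 1"] by simp
  qed (use assms that in \<open>auto simp: q_def\<close>)
  have "0 < 1 / q" using q by simp
  then have "0 < r" using r by linarith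
  then obtain s \<beta> where s: "r = real s + \<beta>" "0 < \<beta>" "\<beta> \<le> 1" by (rule order_exponent_split)
  define \<mu> where "\<mu> = q * r"
  have \<mu>: "1 < \<mu>" using r(2) q by (simp add: \<mu>_def field_simps)
  define C where "C = 4 * 2 powr r"
  have C: "0 < C" by (simp add: C_def)
  define \<theta> where "\<theta> = 1 / \<mu>"
  have \<theta>: "0 < \<theta>" "\<theta> < 1" using \<mu> by (auto simp: \<theta>_def)
  define U where "U T = ((2 * C) powr \<theta> * T powr \<theta> + (1 + real s)) * ln (3 * T) / T" for T :: real
  have upper: "ln_enat (info_complexity (ridge_class \<alpha> p) \<epsilon> d) / ereal (1 / \<epsilon> + real d) \<le> ereal (U (1 / \<epsilon> + real d))"
    if \<epsilon>: "0 < \<epsilon>" "\<epsilon> \<le> 1" and d: "1 \<le> d" for \<epsilon> d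
  proof -
    \<comment> \<open>The factor $2$ leaves room for the strict inequality below.\<close>
    define B where "B = (2 * C / \<epsilon>) powr \<theta>"
    have B: "0 < B" using C \<epsilon> by (simp add: B_def)
    define K where "K = nat \<lceil>B\<rceil>"
    have K: "1 \<le> K" "B \<le> real K" "real K \<le> B + 1" using B by (auto simp: K_def) linarith+
    have "B powr \<mu> = 2 * C / \<epsilon>" using \<mu> C \<epsilon> by (simp add: B_def \<theta>_def powr_powr)
    moreover have "B powr \<mu> \<le> real K powr \<mu>" using B K \<mu> by (intro powr_mono2) auto
    ultimately have "C / real K powr \<mu> \<le> C / (2 * C / \<epsilon>)"
      using C \<epsilon> K by (intro divide_left_mono) auto
    also have "\<dots> < \<epsilon>" using C \<epsilon> by (simp add: field_simps)
    finally have "C / real K powr \<mu> < \<epsilon>" .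
    moreover have "4 * (2 * real K powr (1/2 - 1/max 1 p)) powr (real s + \<beta>) = C / real K powr \<mu>"
    proof -
      have "(2 * real K powr (- q)) powr r = 2 powr r * real K powr (- q * r)"
        using K by (simp add: powr_mult powr_powr)
      also have "real K powr (- q * r) = 1 / real K powr \<mu>" by (simp add: \<mu>_def powr_minus_divide)
      finally show ?thesis by (simp add: C_def q_def s(1))
    qed
    ultimately have "info_complexity (ridge_class \<alpha> p) \<epsilon> d \<le> enat ((2 * d + 1) ^ K * (d + 1) ^ s)"
      using s r(1) assms d K by (intro info_complexity_ridge_le_grid[of \<beta>]) auto
    then have "ln_enat (info_complexity (ridge_class \<alpha> p) \<epsilon> d) \<le> ereal (ln (real ((2 * d + 1) ^ K * (d + 1) ^ s)))"
      by (rule ln_enat_le) simp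
    also have "ln (real ((2 * d + 1) ^ K * (d + 1) ^ s)) = real K * ln (2 * real d + 1) + real s * ln (real d + 1)"
      by (simp add: ln_mult ln_realpow algebra_simps)
    also have "\<dots> \<le> real K * ln (3 * real d) + real s * ln (3 * real d)"
      using d by (intro add_mono mult_left_mono) auto
    also have "\<dots> = (real K + real s) * ln (3 * real d)" by (simp add: algebra_simps)
    also have "\<dots> \<le> ((2 * C) powr \<theta> * (1 / \<epsilon> + real d) powr \<theta> + (1 + real s)) * ln (3 * (1 / \<epsilon> + real d))"
    proof (intro mult_mono)
      have "B = (2 * C) powr \<theta> * (1 / \<epsilon>) powr \<theta>"
        using C \<epsilon> by (simp add: B_def powr_mult[symmetric])
      also have "\<dots> \<le> (2 * C) powr \<theta> * (1 / \<epsilon> + real d) powr \<theta>"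
        using \<epsilon> \<theta> by (intro mult_left_mono powr_mono2) auto
      finally show "real K + real s \<le> (2 * C) powr \<theta> * (1 / \<epsilon> + real d) powr \<theta> + (1 + real s)"
        using K by linarith
      have "0 < 1 / \<epsilon>" using \<epsilon> by simp
      then have "real d \<le> 1 / \<epsilon> + real d" by linarith
      then have "3 * real d \<le> 3 * (1 / \<epsilon> + real d)" by (rule mult_left_mono) simp
      moreover have "0 < 3 * real d" using d by simp
      ultimately show "ln (3 * real d) \<le> ln (3 * (1 / \<epsilon> + real d))"
        by (metis less_le_trans ln_le_cancel_iff)
    qed (use d in auto)
    finally have "ln_enat (info_complexity (ridge_class \<alpha> p) \<epsilon> d)
        \<le> ereal (((2 * C) powr \<theta> * (1 / \<epsilon> + real d) powr \<theta> + (1 + real s)) * ln (3 * (1 / \<epsilon> + real d)))"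
      by simp
    moreover have T: "0 < 1 / \<epsilon> + real d" using \<epsilon> by (simp add: add_pos_nonneg)
    ultimately have "ln_enat (info_complexity (ridge_class \<alpha> p) \<epsilon> d) / ereal (1 / \<epsilon> + real d)
        \<le> ereal (((2 * C) powr \<theta> * (1 / \<epsilon> + real d) powr \<theta> + (1 + real s)) * ln (3 * (1 / \<epsilon> + real d))) / ereal (1 / \<epsilon> + real d)"
      by (intro ereal_divide_right_mono) auto
    also have "\<dots> = ereal (U (1 / \<epsilon> + real d))" using T by (simp add: U_def)
    finally show ?thesis .
  qed
  have "(U \<longlongrightarrow> 0) at_top" unfolding U_def using \<theta> by real_asymp
  then have U: "((\<lambda>T. ereal (U T)) \<longlongrightarrow> 0) at_top" by (simp add: zero_ereal_def)
  define h where "h = (\<lambda>(\<epsilon>::real, d::nat). 1 / \<epsilon> + real d)"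
  define Fl where "Fl = filtercomap h at_top \<sqinter> principal ({0<..1::real} \<times> {1::nat..})"
  have "filterlim h at_top Fl"
    unfolding Fl_def by (intro filterlim_mono[OF filterlim_filtercomap order_refl]) simp
  then have lim: "((\<lambda>x. ereal (U (h x))) \<longlongrightarrow> 0) Fl"
    using filterlim_compose[OF U] by blast
  have dom: "\<forall>\<^sub>F x in Fl. x \<in> {0<..1} \<times> {1..}"
    unfolding Fl_def by (simp add: eventually_inf_principal)
  have "((\<lambda>(\<epsilon>, d). ln_enat (info_complexity (ridge_class \<alpha> p) \<epsilon> d) / ereal (1 / \<epsilon> + real d)) \<longlongrightarrow> 0) Fl"
  proof (rule tendsto_sandwich[OF _ _ tendsto_const lim])
    show "\<forall>\<^sub>F x in Fl. 0 \<le> (case x of (\<epsilon>, d) \<Rightarrow> ln_enat (info_complexity (ridge_class \<alpha> p) \<epsilon> d) / ereal (1 / \<epsilon> + real d))"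
      using dom
    proof eventually_elim
      case (elim x)
      obtain \<epsilon> d where x: "x = (\<epsilon>, d)" by (cases x)
      with elim have "0 < 1 / \<epsilon> + real d" by (simp add: add_pos_nonneg)
      then show ?case using ln_enat_nonneg by (simp add: x)
    qed
    show "\<forall>\<^sub>F x in Fl. (case x of (\<epsilon>, d) \<Rightarrow> ln_enat (info_complexity (ridge_class \<alpha> p) \<epsilon> d) / ereal (1 / \<epsilon> + real d))
        \<le> ereal (U (h x))"
      using dom
    proof eventually_elim
      case (elim x)
      then show ?case using upper by (auto simp: h_def)
    qed
  qed
  then show ?thesis unfolding weakly_tractable_def Fl_def h_def .
qed

lemma two_power_le_fact_Suc: "(2::real) ^ n \<le> fact (Suc n)"
proof (induction n)
  case (Suc n)
  have "(2::real) * 2 ^ n \<le> (2 + real n) * fact (Suc n)" using Suc by (intro mult_mono) auto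
  then show ?case by (simp add: algebra_simps)
qed simp

text \<open>Sampling derivatives of order \<open>s\<close> at the origin costs $(d+1)^s$ points and gives error of order
$1/s!$, so \<open>s\<close> of order $1 + \ln(1/\varepsilon)$ is enough.\<close>

lemma quasi_polynomially_tractable_ridge:
  assumes "0 < p" "p \<le> 2"
  shows "quasi_polynomially_tractable (ridge_class \<infinity> p)"
  unfolding quasi_polynomially_tractable_def
proof (rule exI[of _ 1], rule exI[of _ 5], intro conjI allI impI)
  fix \<epsilon> :: real and d :: nat
  assume "0 < \<epsilon> \<and> \<epsilon> < 1 \<and> 1 \<le> d"
  then have \<epsilon>: "0 < \<epsilon>" "\<epsilon> < 1" and d: "1 \<le> d" by auto
  define L where "L = ln (1 / \<epsilon>)"
  have L: "0 < L" using \<epsilon> by (simp add: L_def)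
  \<comment> \<open>The order of differentiation will be $n + 1$; by $2^n \le (n+1)!$ the Taylor remainder is at most \<open>\<epsilon> / 2\<close>.\<close>
  define n where "n = nat \<lceil>log 2 (8 / \<epsilon>)\<rceil>"
  have log: "0 < log 2 (8 / \<epsilon>)" using \<epsilon> by (intro zero_less_log_cancel_iff[THEN iffD2]) auto
  have n: "log 2 (8 / \<epsilon>) \<le> real n" "real n \<le> log 2 (8 / \<epsilon>) + 1" using log by (simp_all add: n_def)
  have "8 / \<epsilon> = 2 powr (log 2 (8 / \<epsilon>))" using \<epsilon> by simp
  also have "\<dots> \<le> 2 powr real n" using n by (intro powr_mono) auto
  also have "\<dots> \<le> fact (Suc n)" using two_power_le_fact_Suc[of n] by (simp add: powr_realpow)
  finally have fact: "8 / \<epsilon> \<le> fact (Suc n)" .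
  have "4 / fact (Suc n) \<le> 4 / (8 / \<epsilon>)" using fact \<epsilon> by (intro divide_left_mono) auto
  then have small: "4 / fact (Suc n) \<le> \<epsilon> / 2" by simp
  have "log 2 (8 / \<epsilon>) = log 2 8 + L / ln 2"
    using \<epsilon> by (simp add: L_def log_def ln_div diff_divide_distrib add_divide_distrib)
  also have "log 2 8 = (3::real)" using log_pow_cancel[of "2::real" 3] by simp
  also have "L / ln 2 \<le> L / (1 / 2)"
  proof -
    have "1 / 2 \<le> ln (2::real)" using ln_le_minus_one[of "1 / 2 :: real"] by (simp add: ln_div)
    then show ?thesis using L by (intro divide_left_mono) auto
  qed
  finally have s5: "real (Suc n) \<le> 5 * (1 + L)" using n(2) L by simp
  have "info_complexity (ridge_class \<infinity> p) \<epsilon> d \<le> info_complexity (ridge_class (ereal (real (Suc n) + 1)) p) \<epsilon> d"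
    using assms by (intro info_complexity_mono_class ridge_class_mono) auto
  also have "\<dots> \<le> info_complexity (ridge_class (ereal (real (Suc n) + 1)) p)
      (4 * 1 powr (real (Suc n) + 1) / fact (Suc n) + \<epsilon> / 2) d"
    using small by (intro info_complexity_antimono) simp
  also have "\<dots> \<le> enat (card {\<lambda>_::nat. 0 :: real} * (d + 1) ^ Suc n)"
    using assms d \<epsilon> by (intro info_complexity_ridge_le_net solid_net_origin) auto
  finally have "ereal_of_enat (info_complexity (ridge_class \<infinity> p) \<epsilon> d) \<le> ereal_of_enat (enat ((d + 1) ^ Suc n))"
    unfolding ereal_of_enat_le_iff by simp
  also have "\<dots> = ereal ((real d + 1) ^ Suc n)" by (simp add: algebra_simps)
  also have "(real d + 1) ^ Suc n = exp (real (Suc n) * ln (real d + 1))"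
    by (simp only: exp_of_nat_mult) (simp add: exp_ln add_pos_nonneg)
  also have "ereal (exp (real (Suc n) * ln (real d + 1))) \<le> ereal (1 * exp (5 * (1 + ln (1 / \<epsilon>)) * (1 + ln (real d))))"
  proof -
    have "ln (real d + 1) \<le> ln (2 * real d)" using d by simp
    also have "\<dots> = ln 2 + ln (real d)" using d by (simp add: ln_mult)
    also have "\<dots> \<le> 1 + ln (real d)" using ln_2_less_1 by simp
    finally have "real (Suc n) * ln (real d + 1) \<le> 5 * (1 + L) * (1 + ln (real d))"
      using s5 d L by (intro mult_mono) auto
    then show ?thesis by (simp add: L_def)
  qed
  finally show "ereal_of_enat (info_complexity (ridge_class \<infinity> p) \<epsilon> d)
      \<le> ereal (1 * exp (5 * (1 + ln (1 / \<epsilon>)) * (1 + ln (real d))))" .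
qed auto

section \<open>Ridge functions with a nonvanishing derivative at the origin\<close>

lemma length_information: "length (information pt k f) = k"
  by (induction k) auto

lemma nth_information: "i < k \<Longrightarrow> information pt k f ! i = f (pt (information pt i f))"
  by (induction k) (auto simp: nth_append length_information less_Suc_eq)

text \<open>The zero vector is mapped to itself, because division by $0$ gives $0$.\<close>

definition normalize_vec :: "nat \<Rightarrow> rvec \<Rightarrow> rvec" where
  "normalize_vec d v = (\<lambda>i. v i / L2_set v {..<d})"

lemma inner_prod_self: "inner_prod d v v = (\<Sum>i<d. (v i)\<^sup>2)"
  by (simp add: inner_prod_def power2_eq_square)

lemma L2_set_square: "(L2_set v {..<d})\<^sup>2 = (\<Sum>i<d. (v i)\<^sup>2)"
  by (simp add: L2_set_def sum_nonneg)

lemma normalize_vec_norm: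
  "(\<Sum>i<d. (normalize_vec d v i)\<^sup>2) = (if L2_set v {..<d} = 0 then 0 else 1)"
  by (simp add: normalize_vec_def power_divide L2_set_square flip: sum_divide_distrib)
     (metis L2_set_square power_zero_numeral zero_power2 zero_eq_power2)

lemma scale_normalize_vec:
  assumes "i < d"
  shows "v i = L2_set v {..<d} * normalize_vec d v i"
proof (cases "L2_set v {..<d} = 0")
  case True
  then have "v i = 0" using assms by (simp add: L2_set_eq_0_iff)
  then show ?thesis by (simp add: normalize_vec_def)
qed (simp add: normalize_vec_def)

text \<open>The left-hand side is the inner product of \<open>a\<close> with the component of \<open>x\<close> orthogonal to \<open>v\<close>. Multiples
of \<open>v\<close> have inner product $0$ with this component, so \<open>a\<close> may be replaced by its difference to any
multiple of \<open>v\<close>. For $v = 0$ the component is \<open>x\<close> itself.\<close>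

lemma projection_error:
  fixes a v x :: rvec and \<mu> \<eta> :: real and d :: nat
  defines "v' \<equiv> normalize_vec d v"
  assumes x: "(\<Sum>i<d. (x i)\<^sup>2) \<le> 1" and \<eta>: "0 \<le> \<eta>" "(\<Sum>i<d. (a i - \<mu> * v i)\<^sup>2) \<le> \<eta>\<^sup>2"
  shows "\<bar>inner_prod d a x - inner_prod d v' x * inner_prod d a v'\<bar> \<le> \<eta>"
proof -
  define w where "w = (\<lambda>i. a i - \<mu> * v i)"
  define N where "N = L2_set v {..<d}"
  define y where "y = (\<lambda>i. x i + (- inner_prod d v' x) * v' i)"
  have v'1: "(\<Sum>i<d. (v' i)\<^sup>2) = (if N = 0 then 0 else 1)"
    unfolding v'_def N_def by (rule normalize_vec_norm)
  have ip_v: "inner_prod d v z = N * inner_prod d v' z" for z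
    unfolding inner_prod_def v'_def sum_distrib_left N_def
    using scale_normalize_vec[of _ d v] by (intro sum.cong) (auto simp flip: mult.assoc)
  have ip_a: "inner_prod d a z = inner_prod d w z + \<mu> * inner_prod d v z" for z
    by (simp add: inner_prod_def w_def left_diff_distrib sum_subtractf sum_distrib_left mult.assoc)
  have "inner_prod d v v' = N"
    unfolding ip_v inner_prod_self v'1 by simp
  then have vy: "inner_prod d v y = 0"
    unfolding y_def inner_prod_add_scale ip_v[of x] by simp
  have "inner_prod d a x - inner_prod d v' x * inner_prod d a v' = inner_prod d a y"
    unfolding y_def inner_prod_add_scale by simp
  also have "\<dots> = inner_prod d w y" unfolding ip_a vy by simp
  finally have eq: "inner_prod d a x - inner_prod d v' x * inner_prod d a v' = inner_prod d w y" .
  have "(\<Sum>i<d. (y i)\<^sup>2) = (\<Sum>i<d. (x i)\<^sup>2) - 2 * inner_prod d v' x * inner_prod d v' x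
      + (inner_prod d v' x)\<^sup>2 * (\<Sum>i<d. (v' i)\<^sup>2)"
  proof -
    have "(y i)\<^sup>2 = (x i)\<^sup>2 - 2 * inner_prod d v' x * (v' i * x i) + (inner_prod d v' x)\<^sup>2 * (v' i)\<^sup>2" for i
      by (simp add: y_def power2_eq_square algebra_simps)
    then show ?thesis
      by (simp add: sum.distrib sum_subtractf sum_distrib_left[symmetric] inner_prod_def[symmetric])
  qed
  also have "\<dots> \<le> (\<Sum>i<d. (x i)\<^sup>2)"
    unfolding v'1 by (simp add: power2_eq_square)
  finally have "(\<Sum>i<d. (y i)\<^sup>2) \<le> 1\<^sup>2" using x by simp
  then have "\<bar>inner_prod d w y\<bar> \<le> \<eta> * 1"
    using \<eta> by (intro inner_prod_abs_le) (auto simp: w_def)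
  then show ?thesis by (simp add: eq)
qed

text \<open>The differences $g(\tau a_i) - g(0)$ equal $\tau a_i g'(\xi_i)$ with $\xi_i$ near $0$, so up to the
factor $\tau g'(0)$ they are the coordinates of \<open>a\<close>. The lower bound for $|g'(0)|$ keeps the division
stable, and the error of each coordinate is proportional to that coordinate, so there is no loss in
the dimension.\<close>

lemma gradient_direction_error:
  fixes a :: rvec
  assumes g: "g \<in> holder_ball 1 \<beta>" and \<beta>: "0 < \<beta>" "\<beta> \<le> 1"
    and a: "(\<Sum>i<d. (a i)\<^sup>2) \<le> 1" and \<kappa>: "0 < \<kappa>" "\<kappa> \<le> \<bar>deriv g 0\<bar>"
    and \<tau>: "0 < \<tau>" "\<tau> < 1"
  shows "(\<Sum>i<d. (a i - 1 / (\<tau> * deriv g 0) * (g (\<tau> * a i) - g 0))\<^sup>2) \<le> (2 * \<tau> powr \<beta> / \<kappa>)\<^sup>2"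
proof -
  define c where "c = iterated_deriv 1 g 0"
  have D: "DERIV g t :> iterated_deriv 1 g t" if "\<bar>t\<bar> < 1" for t
    using holder_ball_DERIV[OF g, of 0 t] that by simp
  have c: "deriv g 0 = c" using D[of 0] by (simp add: c_def DERIV_imp_deriv del: iterated_deriv.simps)
  have c0: "0 < \<bar>c\<bar>" "\<kappa> \<le> \<bar>c\<bar>" using \<kappa> c by auto
  have each: "(a i - 1 / (\<tau> * c) * (g (\<tau> * a i) - g 0))\<^sup>2 \<le> (2 * \<tau> powr \<beta> / \<kappa>)\<^sup>2 * (a i)\<^sup>2" if i: "i < d" for i
  proof -
    have "\<bar>\<tau> * a i\<bar> \<le> \<tau> * 1"
      unfolding abs_mult using sum_squares_le_one_imp_abs_le_one[OF a i] \<tau> by (intro mult_mono) auto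
    then have ai: "\<bar>\<tau> * a i\<bar> \<le> \<tau>" by simp
    obtain z where z: "\<bar>z - 0\<bar> \<le> \<bar>\<tau> * a i\<bar>" "g (0 + \<tau> * a i) - g 0 = \<tau> * a i * iterated_deriv 1 g z"
    proof (rule mean_value_signed)
      fix x assume "\<bar>x - 0\<bar> \<le> \<bar>\<tau> * a i\<bar>"
      then show "DERIV g x :> iterated_deriv 1 g x" using ai \<tau> by (intro D) simp
    qed
    have zt: "\<bar>z\<bar> \<le> \<tau>" using z(1) ai by simp
    have "\<bar>iterated_deriv 1 g 0 - iterated_deriv 1 g z\<bar> \<le> 2 * \<tau> powr \<beta>"
      using zt \<tau> by (intro holder_ball_modulus[OF g \<beta>]) auto
    then have "\<bar>(c - iterated_deriv 1 g z) / c\<bar> \<le> 2 * \<tau> powr \<beta> / \<kappa>"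
      unfolding abs_divide c_def[symmetric] using c0 \<kappa> by (intro frac_le) auto
    then have "((c - iterated_deriv 1 g z) / c)\<^sup>2 \<le> (2 * \<tau> powr \<beta> / \<kappa>)\<^sup>2"
      using abs_le_square_iff[of "(c - iterated_deriv 1 g z) / c" "2 * \<tau> powr \<beta> / \<kappa>"] \<kappa> by simp
    then have "((c - iterated_deriv 1 g z) / c)\<^sup>2 * (a i)\<^sup>2 \<le> (2 * \<tau> powr \<beta> / \<kappa>)\<^sup>2 * (a i)\<^sup>2"
      by (intro mult_right_mono) auto
    moreover have "a i - 1 / (\<tau> * c) * (g (\<tau> * a i) - g 0) = (c - iterated_deriv 1 g z) / c * a i"
    proof -
      have "g (\<tau> * a i) - g 0 = \<tau> * a i * iterated_deriv 1 g z" using z(2) by simp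
      then show ?thesis using c0 \<tau> by (simp only:) (simp add: field_simps)
    qed
    ultimately show ?thesis by (simp only: power_mult_distrib)
  qed
  have "(\<Sum>i<d. (a i - 1 / (\<tau> * c) * (g (\<tau> * a i) - g 0))\<^sup>2) \<le> (\<Sum>i<d. (2 * \<tau> powr \<beta> / \<kappa>)\<^sup>2 * (a i)\<^sup>2)"
    using each by (intro sum_mono) auto
  also have "\<dots> = (2 * \<tau> powr \<beta> / \<kappa>)\<^sup>2 * (\<Sum>i<d. (a i)\<^sup>2)" by (rule sum_distrib_left[symmetric])
  also have "\<dots> \<le> (2 * \<tau> powr \<beta> / \<kappa>)\<^sup>2 * 1" using a by (intro mult_left_mono) auto
  finally show ?thesis by (simp add: c)
qed

text \<open>The equidistant points $-1, \dots, 1$ with distance $1/G$; larger indices are clamped so that sample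
points stay in the ball for all conceivable data.\<close>

definition line_pos :: "nat \<Rightarrow> nat \<Rightarrow> real" where
  "line_pos G l = (real (min l (2 * G)) - real G) / real G"

lemma abs_line_pos_le: "\<bar>line_pos G l\<bar> \<le> 1"
  by (auto simp: line_pos_def divide_le_eq min_def abs_le_iff le_divide_eq)

lemma line_pos_dense:
  assumes "1 \<le> G" "\<bar>u\<bar> \<le> 1"
  obtains l where "l \<le> 2 * G" "\<bar>u - line_pos G l\<bar> \<le> 1 / real G"
proof
  define n where "n = \<lfloor>(u + 1) * real G\<rfloor>"
  have G: "0 < real G" using assms by simp
  have u1: "0 \<le> u + 1" "u + 1 \<le> 2" using assms(2) by auto
  have n0: "0 \<le> n" using u1 G by (simp add: n_def)
  have "(u + 1) * real G \<le> 2 * real G" using u1 G by (intro mult_right_mono) auto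
  then have n2: "n \<le> 2 * int G" unfolding n_def by linarith
  have n: "real (nat n) \<le> (u + 1) * real G" "(u + 1) * real G \<le> real (nat n) + 1"
    using n0 by (simp_all add: n_def)
  show "nat n \<le> 2 * G" using n2 by linarith
  then have "line_pos G (nat n) = real (nat n) / real G - 1"
    using G by (simp add: line_pos_def diff_divide_distrib)
  moreover have "real (nat n) / real G \<le> u + 1" using n G by (simp add: pos_divide_le_eq)
  moreover have "u + 1 \<le> (real (nat n) + 1) / real G" using n G by (simp add: pos_le_divide_eq)
  ultimately show "\<bar>u - line_pos G (nat n)\<bar> \<le> 1 / real G"
    by (simp add: add_divide_distrib abs_le_iff)
qed

text \<open>The direction of \<open>a\<close> as seen by the algorithm: value $0$ is taken at the origin and value $i+1$ at
$\tau e_i$. Division of the differences by $\tau$ would be cancelled by the normalization.\<close>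

definition gradient_sample :: "nat \<Rightarrow> real \<Rightarrow> real list \<Rightarrow> rvec" where
  "gradient_sample d \<tau> ys = normalize_vec d (\<lambda>i. ys ! Suc i - ys ! 0)"

text \<open>The only place where adaptivity is used: the points after the first $d + 1$ lie on a line whose
direction depends on the data.\<close>

definition line_strategy :: "nat \<Rightarrow> real \<Rightarrow> nat \<Rightarrow> real list \<Rightarrow> rvec" where
  "line_strategy d \<tau> G ys =
     (if length ys = 0 then (\<lambda>i\<in>{..<d}. 0)
      else if length ys \<le> d then (\<lambda>i\<in>{..<d}. \<tau> * unit_vec (length ys - 1) i)
      else (\<lambda>i\<in>{..<d}. line_pos G (length ys - Suc d) * gradient_sample d \<tau> ys i))"

lemma line_strategy_mem_Omega:
  assumes "0 < \<tau>" "\<tau> < 1"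
  shows "line_strategy d \<tau> G ys \<in> Omega d"
proof -
  have "(\<Sum>i<d. (\<tau> * unit_vec k i)\<^sup>2) \<le> 1" for k
  proof -
    have "(\<Sum>i<d. (\<tau> * unit_vec k i)\<^sup>2) = (\<Sum>i<d. if i = k then \<tau>\<^sup>2 else 0)"
      by (intro sum.cong) (auto simp: unit_vec_def)
    also have "\<dots> \<le> \<tau>\<^sup>2" by simp
    also have "\<dots> \<le> 1" using assms by (intro power_le_one) auto
    finally show ?thesis .
  qed
  moreover have "(\<Sum>i<d. (line_pos G l * normalize_vec d v i)\<^sup>2) \<le> 1" for l v
  proof -
    have "(line_pos G l)\<^sup>2 \<le> 1" using abs_line_pos_le by (simp add: abs_square_le_1)
    then have "(line_pos G l)\<^sup>2 * (\<Sum>i<d. (normalize_vec d v i)\<^sup>2) \<le> 1"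
      by (simp add: normalize_vec_norm)
    then show ?thesis by (simp add: power_mult_distrib sum_distrib_left)
  qed
  ultimately show ?thesis
    by (simp add: line_strategy_def gradient_sample_def restrict_mem_Omega_iff)
qed

text \<open>The same differences in terms of the function instead of the data; for $i \ge d$ they vanish, as the
step then leaves the first \<open>d\<close> coordinates unchanged.\<close>

definition gradient_of :: "nat \<Rightarrow> real \<Rightarrow> (rvec \<Rightarrow> real) \<Rightarrow> rvec" where
  "gradient_of d \<tau> f = (\<lambda>i. f (\<lambda>j\<in>{..<d}. \<tau> * unit_vec i j) - f (\<lambda>j\<in>{..<d}. 0))"

lemma gradient_of_eqI:
  assumes "f1 (\<lambda>j\<in>{..<d}. 0) = f2 (\<lambda>j\<in>{..<d}. 0)"
    and "\<And>i. i < d \<Longrightarrow> f1 (\<lambda>j\<in>{..<d}. \<tau> * unit_vec i j) = f2 (\<lambda>j\<in>{..<d}. \<tau> * unit_vec i j)"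
  shows "gradient_of d \<tau> f1 = gradient_of d \<tau> f2"
proof
  fix i
  have "(\<lambda>j\<in>{..<d}. \<tau> * unit_vec i j) = (\<lambda>j\<in>{..<d}. 0)" if "\<not> i < d"
    using that by (auto simp: unit_vec_def restrict_def)
  then show "gradient_of d \<tau> f1 i = gradient_of d \<tau> f2 i"
    using assms by (cases "i < d") (simp_all add: gradient_of_def)
qed

lemma line_strategy_information:
  fixes d G \<tau> f
  defines "info k \<equiv> information (line_strategy d \<tau> G) k f"
  shows "0 < k \<Longrightarrow> info k ! 0 = f (\<lambda>i\<in>{..<d}. 0)"
    and "i < d \<Longrightarrow> Suc i < k \<Longrightarrow> info k ! Suc i = f (\<lambda>j\<in>{..<d}. \<tau> * unit_vec i j)"
    and "Suc d + l < k \<Longrightarrow> info k ! (Suc d + l) =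
      f (\<lambda>j\<in>{..<d}. line_pos G l * normalize_vec d (gradient_of d \<tau> f) j)"
proof -
  show 0: "info k ! 0 = f (\<lambda>i\<in>{..<d}. 0)" if "0 < k" for k
    unfolding info_def nth_information[OF that] by (simp add: line_strategy_def)
  show 1: "info k ! Suc i = f (\<lambda>j\<in>{..<d}. \<tau> * unit_vec i j)" if "i < d" "Suc i < k" for i k
    unfolding info_def nth_information[OF that(2)] using that(1)
    by (simp add: line_strategy_def length_information del: information.simps)
  show "info k ! (Suc d + l) = f (\<lambda>j\<in>{..<d}. line_pos G l * normalize_vec d (gradient_of d \<tau> f) j)"
    if "Suc d + l < k"
  proof -
    have eq: "info (Suc d + l) ! Suc i - info (Suc d + l) ! 0 = gradient_of d \<tau> f i" if "i < d" for i
      using that 0[of "Suc d + l"] 1[of i "Suc d + l"] by (simp add: gradient_of_def)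
    have "L2_set (\<lambda>i. info (Suc d + l) ! Suc i - info (Suc d + l) ! 0) {..<d} = L2_set (gradient_of d \<tau> f) {..<d}"
      by (rule L2_set_cong[OF refl]) (rule eq, simp)
    then have "gradient_sample d \<tau> (info (Suc d + l)) j = normalize_vec d (gradient_of d \<tau> f) j" if "j < d" for j
      using eq[OF that] by (simp add: gradient_sample_def normalize_vec_def)
    then have "line_strategy d \<tau> G (info (Suc d + l))
        = (\<lambda>j\<in>{..<d}. line_pos G l * normalize_vec d (gradient_of d \<tau> f) j)"
      unfolding line_strategy_def by (auto simp: info_def length_information restrict_def del: information.simps)
    then show ?thesis unfolding info_def nth_information[OF that] by simp
  qed
qed

text \<open>Error \<open>\<epsilon> / 4\<close> arises from moving \<open>x\<close> to its projection to the line, and \<open>\<epsilon> / 4\<close> from moving along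
the line to the next grid point.\<close>

lemma line_approximation:
  assumes g: "g \<in> holder_ball 1 \<beta>" and \<beta>: "0 < \<beta>" "\<beta> \<le> 1"
    and a: "(\<Sum>i<d. (a i)\<^sup>2) \<le> 1" and \<kappa>: "0 < \<kappa>" "\<kappa> \<le> \<bar>deriv g 0\<bar>"
    and f: "f = (\<lambda>x\<in>Omega d. g (inner_prod d a x))"
    and \<tau>: "0 < \<tau>" "\<tau> < 1" "2 * \<tau> powr \<beta> / \<kappa> \<le> \<epsilon> / 4"
    and x: "x \<in> Omega d"
    and t: "\<bar>inner_prod d (normalize_vec d (gradient_of d \<tau> f)) x - line_pos G l\<bar> \<le> \<epsilon> / 4"
  shows "\<bar>f x - f (\<lambda>j\<in>{..<d}. line_pos G l * normalize_vec d (gradient_of d \<tau> f) j)\<bar> \<le> \<epsilon> / 2"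
proof -
  define v where "v = gradient_of d \<tau> f"
  define v' where "v' = normalize_vec d v"
  define T where "T = line_pos G l"
  have unit: "(\<lambda>j\<in>{..<d}. \<tau> * unit_vec i j) \<in> Omega d" if "i < d" for i
    using line_strategy_mem_Omega[OF \<tau>(1,2), of d G "replicate (Suc i) 0"] that by (simp add: line_strategy_def)
  have zero: "(\<lambda>j\<in>{..<d}. 0) \<in> Omega d" by (simp add: restrict_mem_Omega_iff)
  have v: "v i = g (\<tau> * a i) - g 0" if "i < d" for i
  proof -
    have "inner_prod d a (\<lambda>j. \<tau> * unit_vec i j) = \<tau> * a i"
      using inner_prod_add_scale[of d a "\<lambda>_. 0" \<tau> "unit_vec i"] inner_prod_unit_vec[OF that, of a]
      by (simp add: inner_prod_def)
    moreover have "inner_prod d a (\<lambda>_. 0) = 0" by (simp add: inner_prod_def)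
    ultimately show ?thesis
      unfolding v_def gradient_of_def f using unit[OF that] zero by (simp add: inner_prod_restrict)
  qed
  have v'1: "(\<Sum>i<d. (v' i)\<^sup>2) \<le> 1" unfolding v'_def by (simp add: normalize_vec_norm)
  have xx: "(\<Sum>i<d. (x i)\<^sup>2) \<le> 1" using x by (simp add: mem_Omega_iff)
  have av': "\<bar>inner_prod d a v'\<bar> \<le> 1" using inner_prod_abs_le[of a d 1 v' 1] a v'1 by simp
  have ax: "\<bar>inner_prod d a x\<bar> \<le> 1" using inner_prod_abs_le[of a d 1 x 1] a xx by simp
  have T1: "\<bar>T\<bar> \<le> 1" unfolding T_def by (rule abs_line_pos_le)
  have aT: "\<bar>T * inner_prod d a v'\<bar> \<le> 1" unfolding abs_mult using av' T1 by (intro mult_le_one) auto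
  have "(\<Sum>i<d. (a i - 1 / (\<tau> * deriv g 0) * v i)\<^sup>2) \<le> (2 * \<tau> powr \<beta> / \<kappa>)\<^sup>2"
    using gradient_direction_error[OF g \<beta> a \<kappa> \<tau>(1,2)] by (simp add: v)
  then have "\<bar>inner_prod d a x - inner_prod d v' x * inner_prod d a v'\<bar> \<le> 2 * \<tau> powr \<beta> / \<kappa>"
    unfolding v'_def using \<kappa>(1) by (intro projection_error[OF xx, where \<mu>="1 / (\<tau> * deriv g 0)"]) auto
  moreover have "\<bar>(inner_prod d v' x - T) * inner_prod d a v'\<bar> \<le> \<epsilon> / 4 * 1"
    unfolding abs_mult T_def v'_def v_def
    using t av'[unfolded v'_def v_def] order_trans[OF abs_ge_zero t] by (intro mult_mono) auto
  ultimately have dist: "\<bar>inner_prod d a x - T * inner_prod d a v'\<bar> \<le> \<epsilon> / 2"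
    using \<tau>(3) unfolding left_diff_distrib by linarith
  have line: "(\<lambda>j\<in>{..<d}. T * v' j) \<in> Omega d"
  proof -
    have "T\<^sup>2 * (\<Sum>i<d. (v' i)\<^sup>2) \<le> 1" using T1 v'1 by (intro mult_le_one) (auto simp: abs_square_le_1 sum_nonneg)
    then show ?thesis by (simp add: restrict_mem_Omega_iff power_mult_distrib sum_distrib_left)
  qed
  have "inner_prod d a (\<lambda>j. T * v' j) = T * inner_prod d a v'"
    by (simp add: inner_prod_def sum_distrib_left mult_ac)
  then have "f x - f (\<lambda>j\<in>{..<d}. T * v' j) = g (inner_prod d a x) - g (T * inner_prod d a v')"
    using x line by (simp add: f inner_prod_restrict)
  moreover have "\<bar>g (inner_prod d a x) - g (T * inner_prod d a v')\<bar> \<le> \<bar>inner_prod d a x - T * inner_prod d a v'\<bar>"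
    using holder_ball_lipschitz[OF g, of 0 "inner_prod d a x" "T * inner_prod d a v'"] ax aT by (simp add: abs_le_iff)
  ultimately have "\<bar>f x - f (\<lambda>j\<in>{..<d}. T * v' j)\<bar> \<le> \<epsilon> / 2" using dist by linarith
  then show ?thesis by (simp only: T_def v'_def v_def)
qed

text \<open>The function $0$ need not belong to the class, but the zero data are still answered correctly: a
member with zero data is \<open>\<epsilon> / 2\<close>-close to one of its samples at every point, that is, to $0$.\<close>

lemma polynomially_tractable_ridge_deriv:
  assumes "1 < \<alpha>" "0 < p" "p \<le> 2" "0 < \<kappa>"
  shows "polynomially_tractable (ridge_class_deriv \<alpha> p \<kappa>)"
  unfolding polynomially_tractable_def
proof (rule exI[of _ 13], rule exI[of _ 1], rule exI[of _ 1], intro conjI allI impI)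
  fix \<epsilon> :: real and d :: nat
  assume "0 < \<epsilon> \<and> \<epsilon> < 1 \<and> 1 \<le> d"
  then have \<epsilon>: "0 < \<epsilon>" "\<epsilon> < 1" and d: "1 \<le> d" by auto
  obtain \<beta> where \<beta>: "0 < \<beta>" "\<beta> \<le> 1" "ereal (real 1 + \<beta>) \<le> \<alpha>"
  proof (cases \<alpha>)
    case (real r)
    then show ?thesis using that[of "min 1 (r - 1)"] assms(1) by (auto simp: min_def)
  qed (use that[of 1] assms in auto)
  obtain \<tau> where \<tau>: "0 < \<tau>" "\<tau> < 1" "2 / \<kappa> * \<tau> powr \<beta> \<le> \<epsilon> / 4"
    by (rule small_radius[of \<beta> 1 "\<epsilon> / 4" "2 / \<kappa>"]) (use \<beta> \<epsilon> assms in auto)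
  define G where "G = nat \<lceil>4 / \<epsilon>\<rceil>"
  have G4: "4 / \<epsilon> \<le> real G" "real G \<le> 4 / \<epsilon> + 1" using \<epsilon> by (simp_all add: G_def)
  have "0 < 4 / \<epsilon>" using \<epsilon> by simp
  then have G: "0 < real G" using G4 by linarith
  then have G1: "1 \<le> G" by simp
  have "1 / real G \<le> 1 / (4 / \<epsilon>)" using G4 \<epsilon> G by (intro divide_left_mono mult_pos_pos) auto
  then have Ginv: "1 / real G \<le> \<epsilon> / 4" by simp
  \<comment> \<open>One sample at the origin, \<open>d\<close> near it and $2G + 1$ on the line.\<close>
  define m where "m = Suc d + (2 * G + 1)"
  define pt where "pt = line_strategy d \<tau> G"
  define F where "F = ridge_class_deriv \<alpha> p \<kappa>"
  have approx: "\<exists>l\<le>2 * G. \<forall>f\<in>F d. gradient_of d \<tau> f = v \<longrightarrow>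
      \<bar>f x - f (\<lambda>j\<in>{..<d}. line_pos G l * normalize_vec d v j)\<bar> \<le> \<epsilon> / 2" if x: "x \<in> Omega d" for x v
  proof -
    have "\<bar>inner_prod d (normalize_vec d v) x\<bar> \<le> 1 * 1"
      using x by (intro inner_prod_abs_le) (auto simp: normalize_vec_norm mem_Omega_iff)
    then obtain l where l: "l \<le> 2 * G" "\<bar>inner_prod d (normalize_vec d v) x - line_pos G l\<bar> \<le> 1 / real G"
      using line_pos_dense[OF G1] by auto
    have "\<bar>f x - f (\<lambda>j\<in>{..<d}. line_pos G l * normalize_vec d v j)\<bar> \<le> \<epsilon> / 2"
      if f: "f \<in> F d" "gradient_of d \<tau> f = v" for f
    proof -
      obtain g a where g: "g \<in> smooth_ball \<alpha>" "p_norm d p a \<le> 1" "\<kappa> \<le> \<bar>deriv g 0\<bar>"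
        "f = (\<lambda>x\<in>Omega d. g (inner_prod d a x))"
        using f(1) unfolding F_def ridge_class_deriv_def by blast
      have "smooth_ball \<alpha> \<subseteq> smooth_ball (ereal (real 1 + \<beta>))"
        using \<beta> by (intro smooth_ball_antimono) auto
      then have "g \<in> holder_ball 1 \<beta>" using g(1) unfolding smooth_ball_eq_holder_ball[OF \<beta>(1,2)] by blast
      then show ?thesis
        unfolding f(2)[symmetric]
        by (rule line_approximation[OF _ \<beta>(1,2) p_norm_le_one_imp_sum_squares[OF assms(2,3) g(2)] assms(4) g(3,4) \<tau>(1,2) _ x])
           (use \<tau>(3) l(2) Ginv f(2) in auto)
    qed
    then show ?thesis using l(1) by blast
  qed
  have read: "information pt m f ! 0 = f (\<lambda>i\<in>{..<d}. 0)"
      "i < d \<Longrightarrow> information pt m f ! Suc i = f (\<lambda>j\<in>{..<d}. \<tau> * unit_vec i j)"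
      "l \<le> 2 * G \<Longrightarrow> information pt m f ! (Suc d + l)
        = f (\<lambda>j\<in>{..<d}. line_pos G l * normalize_vec d (gradient_of d \<tau> f) j)" for f i l
    unfolding pt_def
    by (rule line_strategy_information; simp add: m_def)+
  have "g_ada m d (F d) \<le> ennreal \<epsilon>"
  proof (rule g_ada_leI[where pt=pt])
    show "1 \<le> m" by (simp add: m_def)
    show "pt ys \<in> Omega d" for ys unfolding pt_def by (rule line_strategy_mem_Omega[OF \<tau>(1,2)])
    have "0 < \<alpha>" using assms(1) by (rule less_trans[rotated]) simp
    then have "ridge_class \<alpha> p d \<subseteq> Linf d" by (intro ridge_class_subset_Linf assms)
    moreover have "F d \<subseteq> ridge_class \<alpha> p d"
      unfolding F_def ridge_class_deriv_def ridge_class_def by blast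
    ultimately show "F d \<subseteq> Linf d" by blast
    show "0 \<le> \<epsilon>" using \<epsilon> by simp
    show "\<bar>f1 x - f2 x\<bar> \<le> \<epsilon>"
      if f: "f1 \<in> F d" "f2 \<in> F d" and info: "information pt m f1 = information pt m f2" and x: "x \<in> Omega d" for f1 f2 x
    proof -
      have origin: "f1 (\<lambda>i\<in>{..<d}. 0) = f2 (\<lambda>i\<in>{..<d}. 0)"
        unfolding read(1)[symmetric] info ..
      have axes: "f1 (\<lambda>j\<in>{..<d}. \<tau> * unit_vec i j) = f2 (\<lambda>j\<in>{..<d}. \<tau> * unit_vec i j)" if "i < d" for i
        unfolding read(2)[OF that, symmetric] info ..
      have grad: "gradient_of d \<tau> f1 = gradient_of d \<tau> f2"
        by (rule gradient_of_eqI[OF origin axes])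
      obtain l where l: "l \<le> 2 * G" "\<And>f. f \<in> F d \<Longrightarrow> gradient_of d \<tau> f = gradient_of d \<tau> f1 \<Longrightarrow>
          \<bar>f x - f (\<lambda>j\<in>{..<d}. line_pos G l * normalize_vec d (gradient_of d \<tau> f1) j)\<bar> \<le> \<epsilon> / 2"
        using approx[OF x] by blast
      have "f1 (\<lambda>j\<in>{..<d}. line_pos G l * normalize_vec d (gradient_of d \<tau> f1) j)
          = f2 (\<lambda>j\<in>{..<d}. line_pos G l * normalize_vec d (gradient_of d \<tau> f1) j)"
        using read(3)[OF l(1), of f1] read(3)[OF l(1), of f2] info grad by simp
      then show ?thesis using l(2)[OF f(1) refl] l(2)[OF f(2) grad[symmetric]] by linarith
    qed
    show "\<bar>f x\<bar> \<le> \<epsilon>" if f: "f \<in> F d" and info: "information pt m f = replicate m 0" and x: "x \<in> Omega d" for f x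
    proof -
      obtain l where l: "l \<le> 2 * G" "\<bar>f x - f (\<lambda>j\<in>{..<d}. line_pos G l * normalize_vec d (gradient_of d \<tau> f) j)\<bar> \<le> \<epsilon> / 2"
        using approx[OF x] f by blast
      have "f (\<lambda>j\<in>{..<d}. line_pos G l * normalize_vec d (gradient_of d \<tau> f) j) = 0"
        unfolding read(3)[OF l(1), symmetric] info using l(1) by (subst nth_replicate) (auto simp: m_def)
      then show ?thesis using l(2) \<epsilon> by linarith
    qed
  qed
  then have "info_complexity F \<epsilon> d \<le> enat m" by (intro info_complexity_le) (simp add: m_def)
  then have "ereal_of_enat (info_complexity F \<epsilon> d) \<le> ereal_of_enat (enat m)"
    by (simp only: ereal_of_enat_le_iff)
  also have "\<dots> \<le> ereal (13 * \<epsilon> powr (- 1) * real d powr 1)"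
  proof -
    have inv: "1 \<le> 1 / \<epsilon>" using \<epsilon> by simp
    have "real d * 1 \<le> real d * (1 / \<epsilon>)" by (rule mult_left_mono[OF inv]) simp
    moreover have "1 * (1 / \<epsilon>) \<le> real d * (1 / \<epsilon>)"
      by (rule mult_right_mono) (use d \<epsilon> in auto)
    moreover have "real m \<le> 4 + real d + 8 * (1 / \<epsilon>)" using G4(2) by (simp add: m_def)
    ultimately have "real m \<le> 13 * (real d * (1 / \<epsilon>))" using inv by linarith
    then show ?thesis using \<epsilon> by (simp add: powr_minus_divide)
  qed
  finally show "ereal_of_enat (info_complexity (ridge_class_deriv \<alpha> p \<kappa>) \<epsilon> d)
      \<le> ereal (13 * \<epsilon> powr (- 1) * real d powr 1)" by (simp add: F_def)
qed auto

section \<open>Tractability of ridge function sampling\<close>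

theorem theorem5p1:
  fixes \<alpha> :: ereal and p :: real
  assumes "0 < \<alpha>" and "0 < p" and "p \<le> 2"
  shows "(p = 2 \<and> \<alpha> < \<infinity> \<longrightarrow> curse_of_dimensionality (ridge_class \<alpha> p)) \<and>
    (p < 2 \<longrightarrow> \<not> curse_of_dimensionality (ridge_class \<alpha> p)) \<and>
    (p < 2 \<and> \<alpha> \<le> ereal (1 / (1 / p - 1 / 2)) \<longrightarrow> intractable (ridge_class \<alpha> p)) \<and>
    (p < 2 \<and> ereal (1 / (1 / max 1 p - 1 / 2)) < \<alpha> \<longrightarrow> weakly_tractable (ridge_class \<alpha> p)) \<and>
    (\<alpha> = \<infinity> \<longrightarrow> quasi_polynomially_tractable (ridge_class \<alpha> p)) \<and>
    (\<forall>\<kappa>::real. 1 < \<alpha> \<and> 0 < \<kappa> \<and> \<kappa> \<le> 1 \<longrightarrow>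
       polynomially_tractable (ridge_class_deriv \<alpha> p \<kappa>))"
proof (intro conjI impI allI)
  assume "p = 2 \<and> \<alpha> < \<infinity>"
  then show "curse_of_dimensionality (ridge_class \<alpha> p)"
    using curse_of_dimensionality_ridge assms by auto
next
  assume "p < 2"
  then show "\<not> curse_of_dimensionality (ridge_class \<alpha> p)"
    using not_curse_of_dimensionality_ridge assms by blast
next
  assume "p < 2 \<and> \<alpha> \<le> ereal (1 / (1 / p - 1 / 2))"
  then show "intractable (ridge_class \<alpha> p)" using intractable_ridge assms by blast
next
  assume "p < 2 \<and> ereal (1 / (1 / max 1 p - 1 / 2)) < \<alpha>"
  then show "weakly_tractable (ridge_class \<alpha> p)" using weakly_tractable_ridge assms by blast
next
  assume "\<alpha> = \<infinity>"
  then show "quasi_polynomially_tractable (ridge_class \<alpha> p)"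
    using quasi_polynomially_tractable_ridge assms by blast
next
  fix \<kappa> :: real
  assume "1 < \<alpha> \<and> 0 < \<kappa> \<and> \<kappa> \<le> 1"
  then show "polynomially_tractable (ridge_class_deriv \<alpha> p \<kappa>)"
    using polynomially_tractable_ridge_deriv assms by blast
qed

end
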